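(* Let $X=\mathbf{R}/\mathbf{Z}$ and let $\sigma$ be a distorted element of the group $\mathrm{PC}_{\mathbf{Aff}}(X)$. (a) There exist a standard curve $X'$ and a piecewise affine isomorphism $\varphi:X\dashrightarrow X'$ such that the image $\varphi\sigma\varphi^{-1}$ of $\sigma$ in $\mathrm{PC}_{\mathbf{Aff}}(X')$ belongs to $\mathrm{Aut}_{\mathbf{Aff}}(X')$. (b) If moreover $\sigma\in \mathrm{PC}^0_{\mathbf{Aff}}(\mathbf{R}/\mathbf{Z})$ and $\sigma$ has infinite order, then there exists $\varphi\in\mathrm{PC}^{0,+}_{\mathbf{Aff}}(\mathbf{R}/\mathbf{Z})$ such that $\varphi\sigma\varphi^{-1}$ is an irrational rotation, i.e. of the form $x\mapsto x+r$ with $r\in\mathbf{R}\smallsetminus\mathbf{Q}$.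
   Context: An element $g$ of a group $G$ is distorted if there is a finite subset $S\subset G$ with $g\in\langle S\rangle$ and $\lim_{n\to\infty}|g^n|_S/n=0$, where $|\cdot|_S$ is word length with respect to $S$ (so finite order elements are distorted). An affinely modeled curve is a Hausdorff topological space with an atlas of charts valued in open subsets of $\mathbf{R}$, with changes of charts locally of the form $x\mapsto ax+b$, $a\neq 0$. The circle $\mathbf{R}/\mathbf{Z}$ carries the affine structure inherited from $\mathbf{R}$. A standard curve is a finite disjoint union of copies of $\mathbf{R}/\mathbf{Z}$ and bounded open intervals of $\mathbf{R}$, with the obvious affine structure. An affine isomorphism is a homeomorphism that is locally affine in charts; $\mathrm{Aut}_{\mathbf{Aff}}(X')$ is the group of affine automorphisms. A piecewise affine isomorphism $X\dashrightarrow X'$ is an affine isomorphism $X\smallsetminus F\to X'\smallsetminus F'$ with $F,F'$ finite, two of these being identified if they agree on a cofinite subset; $\mathrm{PC}_{\mathbf{Aff}}(X)$ is the group of piecewise affine isomorphisms from $X$ to itself. $\mathrm{PC}^0_{\mathbf{Aff}}(X)$ is the subgroup of elements represented by self-homeomorphisms of $X$, and $\mathrm{PC}^{0,+}_{\mathbf{Aff}}(X)$ its subgroup of orientation-preserving ones. *)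

theory Defs
  imports "HOL-Analysis.Analysis" "HOL-Algebra.Generated_Groups"
begin

section \<open>Distorted elements\<close>

text \<open>The least length is meaningful only for \<open>g\<close> in the subgroup generated by \<open>S\<close>.\<close>

definition word_length :: "('a, 'b) monoid_scheme \<Rightarrow> 'a set \<Rightarrow> 'a \<Rightarrow> nat" where
  "word_length G S g =
     (LEAST n. \<exists>ws. length ws = n \<and> set ws \<subseteq> S \<union> m_inv G ` S \<and> g = foldr (mult G) ws (one G))"

definition distorted :: "('a, 'b) monoid_scheme \<Rightarrow> 'a \<Rightarrow> bool" where
  "distorted G g \<longleftrightarrow>
     (\<exists>S. finite S \<and> S \<subseteq> carrier G \<and> g \<in> generate G S \<and>
          (\<lambda>n::nat. real (word_length G S (g [^]\<^bsub>G\<^esub> n)) / real n) \<longlonglongrightarrow> 0)"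


section \<open>Affinely modeled curves\<close>

text \<open>A chart is a pair \<open>(U, f)\<close>; the values of \<open>f\<close> outside \<open>U\<close> are irrelevant.\<close>

record 'a curve =
  curve_top :: "'a topology"
  charts :: "('a set \<times> ('a \<Rightarrow> real)) set"

definition locally_affine :: "'a curve \<Rightarrow> 'b curve \<Rightarrow> ('a \<Rightarrow> 'b) \<Rightarrow> bool" where
  "locally_affine C D h \<longleftrightarrow>
     (\<forall>(U, f) \<in> charts C. \<forall>(V, g) \<in> charts D. \<forall>p \<in> U. h p \<in> V \<longrightarrow>
        (\<exists>a b W. a \<noteq> 0 \<and> openin (curve_top C) W \<and> p \<in> W \<and> W \<subseteq> U \<and> h ` W \<subseteq> V \<and>
                 (\<forall>q \<in> W. g (h q) = a * f q + b)))"

text \<open>The condition \<open>locally_affine C C id\<close> says that changes of charts are locally of the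
  form \<open>x \<mapsto> a x + b\<close> with \<open>a \<noteq> 0\<close>.\<close>

definition affinely_modeled_curve :: "'a curve \<Rightarrow> bool" where
  "affinely_modeled_curve C \<longleftrightarrow>
     Hausdorff_space (curve_top C) \<and>
     (\<Union>(U, f) \<in> charts C. U) = topspace (curve_top C) \<and>
     (\<forall>(U, f) \<in> charts C. openin (curve_top C) U \<and> open (f ` U) \<and>
        homeomorphic_map (subtopology (curve_top C) U) (top_of_set (f ` U)) f) \<and>
     locally_affine C C id"

definition affine_iso :: "'a curve \<Rightarrow> 'b curve \<Rightarrow> ('a \<Rightarrow> 'b) \<Rightarrow> bool" where
  "affine_iso C D h \<longleftrightarrow>
     homeomorphic_map (curve_top C) (curve_top D) h \<and> locally_affine C D h"

definition curve_minus :: "'a curve \<Rightarrow> 'a set \<Rightarrow> 'a curve" where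
  "curve_minus C F =
     \<lparr>curve_top = subtopology (curve_top C) (- F), charts = (\<lambda>(U, f). (U - F, f)) ` charts C\<rparr>"


section \<open>Piecewise affine isomorphisms\<close>

text \<open>The partial map \<open>C - F \<rightarrow> D - F'\<close> is represented by a total function with arbitrary
  values outside \<open>C - F\<close>. Those values do not matter after passing to the classes of \<open>pc_rel\<close>,
  which are the piecewise affine isomorphisms themselves.\<close>

definition pc_maps :: "'a curve \<Rightarrow> 'b curve \<Rightarrow> ('a \<Rightarrow> 'b) set" where
  "pc_maps C D =
     {h. \<exists>F F'. finite F \<and> F \<subseteq> topspace (curve_top C) \<and> finite F' \<and> F' \<subseteq> topspace (curve_top D) \<and>
                affine_iso (curve_minus C F) (curve_minus D F') h}"

definition pc_rel :: "'a curve \<Rightarrow> 'b curve \<Rightarrow> (('a \<Rightarrow> 'b) \<times> ('a \<Rightarrow> 'b)) set" where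
  "pc_rel C D =
     {(h, k). h \<in> pc_maps C D \<and> k \<in> pc_maps C D \<and> finite {x \<in> topspace (curve_top C). h x \<noteq> k x}}"

definition PC_iso :: "'a curve \<Rightarrow> 'b curve \<Rightarrow> ('a \<Rightarrow> 'b) set set" where
  "PC_iso C D = pc_maps C D // pc_rel C D"

text \<open>\<open>pc_comp C E \<psi> \<phi>\<close> is the composite \<open>\<psi> \<circ> \<phi>\<close>, going from \<open>C\<close> to \<open>E\<close>.\<close>

definition pc_comp :: "'a curve \<Rightarrow> 'c curve \<Rightarrow> ('b \<Rightarrow> 'c) set \<Rightarrow> ('a \<Rightarrow> 'b) set \<Rightarrow> ('a \<Rightarrow> 'c) set" where
  "pc_comp C E \<psi> \<phi> = (\<Union>g \<in> \<psi>. \<Union>h \<in> \<phi>. pc_rel C E `` {g \<circ> h})"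

definition pc_inv :: "'a curve \<Rightarrow> 'b curve \<Rightarrow> ('a \<Rightarrow> 'b) set \<Rightarrow> ('b \<Rightarrow> 'a) set" where
  "pc_inv C D \<phi> = {k \<in> pc_maps D C. \<exists>h \<in> \<phi>. (k \<circ> h, id) \<in> pc_rel C C}"

definition PC_group :: "'a curve \<Rightarrow> ('a \<Rightarrow> 'a) set monoid" where
  "PC_group C = \<lparr>carrier = PC_iso C C, mult = pc_comp C C, one = pc_rel C C `` {id}\<rparr>"

text \<open>The image of the affine automorphism group in the group of piecewise affine
  automorphisms.\<close>

definition Aut_Aff :: "'a curve \<Rightarrow> ('a \<Rightarrow> 'a) set set" where
  "Aut_Aff C = {pc_rel C C `` {h} | h. affine_iso C C h}"

definition PC0 :: "'a curve \<Rightarrow> ('a \<Rightarrow> 'a) set set" where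
  "PC0 C = {\<sigma> \<in> PC_iso C C. \<exists>h \<in> \<sigma>. homeomorphic_map (curve_top C) (curve_top C) h}"

text \<open>The charts must form an oriented atlas (increasing changes of charts) for this to be the
  usual notion; the atlas chosen for \<open>\<real>/\<int>\<close> below is oriented.\<close>

definition orientation_preserving :: "'a curve \<Rightarrow> ('a \<Rightarrow> 'a) \<Rightarrow> bool" where
  "orientation_preserving C h \<longleftrightarrow>
     (\<forall>(U, f) \<in> charts C. \<forall>(V, g) \<in> charts C. \<forall>p \<in> U. h p \<in> V \<longrightarrow>
        (\<exists>W. openin (curve_top C) W \<and> p \<in> W \<and> W \<subseteq> U \<and> h ` W \<subseteq> V \<and>
             (\<forall>x \<in> W. \<forall>y \<in> W. f x < f y \<longrightarrow> g (h x) < g (h y))))"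

definition PC0_plus :: "'a curve \<Rightarrow> ('a \<Rightarrow> 'a) set set" where
  "PC0_plus C =
     {\<sigma> \<in> PC_iso C C. \<exists>h \<in> \<sigma>. homeomorphic_map (curve_top C) (curve_top C) h \<and>
                             orientation_preserving C h}"


section \<open>The circle and standard curves\<close>

quotient_type rz = real / "\<lambda>x y::real. x - y \<in> \<int>"
  morphisms rep_rz to_rz
proof (rule equivpI)
  show "reflp (\<lambda>x y::real. x - y \<in> \<int>)"
    by (rule reflpI) simp
  show "symp (\<lambda>x y::real. x - y \<in> \<int>)"
    by (rule sympI) (drule Ints_minus, simp)
  show "transp (\<lambda>x y::real. x - y \<in> \<int>)"
    by (rule transpI) (drule (1) Ints_add, simp)
qed

instantiation rz :: topological_space
begin

definition open_rz :: "rz set \<Rightarrow> bool" where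
  "open_rz U \<longleftrightarrow> open (to_rz -` U)"

instance
  by standard (auto simp: open_rz_def vimage_Union)

end

lift_definition rotation :: "real \<Rightarrow> rz \<Rightarrow> rz" is "\<lambda>r x. x + r"
  by simp

definition RZ :: "rz curve" where
  "RZ = \<lparr>curve_top = euclidean,
         charts = {(to_rz ` {a<..<a + 1}, inv_into {a<..<a + 1} to_rz) | a. True}\<rparr>"

definition interval_curve :: "real \<Rightarrow> real \<Rightarrow> real curve" where
  "interval_curve a b = \<lparr>curve_top = top_of_set {a<..<b}, charts = {({a<..<b}, id)}\<rparr>"

text \<open>Transport of a curve along an injection \<open>i\<close> with left inverse \<open>j\<close>.\<close>

definition copy_curve :: "('a \<Rightarrow> 'b) \<Rightarrow> ('b \<Rightarrow> 'a) \<Rightarrow> 'a curve \<Rightarrow> 'b curve" where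
  "copy_curve i j C =
     \<lparr>curve_top = pullback_topology (range i) j (curve_top C),
      charts = (\<lambda>(U, f). (i ` U, f \<circ> j)) ` charts C\<rparr>"

definition disjoint_union_curve :: "'i set \<Rightarrow> ('i \<Rightarrow> 'a curve) \<Rightarrow> ('i \<times> 'a) curve" where
  "disjoint_union_curve I C =
     \<lparr>curve_top = sum_topology (\<lambda>i. curve_top (C i)) I,
      charts = (\<Union>i \<in> I. (\<lambda>(U, f). ({i} \<times> U, f \<circ> snd)) ` charts (C i))\<rparr>"

datatype component = Circle | Interval real real

fun valid_component :: "component \<Rightarrow> bool" where
  "valid_component Circle = True"
| "valid_component (Interval a b) = (a < b)"

fun component_curve :: "component \<Rightarrow> (rz + real) curve" where
  "component_curve Circle = copy_curve Inl projl RZ"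
| "component_curve (Interval a b) = copy_curve Inr projr (interval_curve a b)"

definition standard_curves :: "(nat \<times> (rz + real)) curve set" where
  "standard_curves =
     {disjoint_union_curve {..<length cs} (\<lambda>i. component_curve (cs ! i)) | cs.
        \<forall>c \<in> set cs. valid_component c}"

end

theory Submission
  imports Defs
begin

text \<open>Piecewise affine maps act by bijections on one-sided germs, that is, on points of the circle
  approached with a given velocity. At every point the two opposite germs are glued. Pulling this
  gluing back by \<open>\<sigma>\<close> to the power \<open>k\<close> gives gluings that stabilise along every infinite orbit as \<open>k\<close>
  tends to plus or minus infinity. The two limits agree, since otherwise the number of breaks of the
  \<open>n\<close>-th power would grow linearly, whereas it is \<open>o(n)\<close> for a distorted element. The limit is a
  \<open>\<sigma>\<close>-invariant gluing that differs from the standard one at finitely many points. Cutting and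
  regluing the circle accordingly gives a curve on which \<open>\<sigma>\<close> is affine, made of intervals and of
  affine circles. A circle with holonomy \<open>c \<noteq> 1\<close> is impossible. Some power of \<open>\<sigma>\<close> acts on it as a
  dilation, and distortion makes every additive functional that vanishes at \<open>ln c\<close> vanish at the
  logarithm of the slope as well. Hence a further power is the identity, all orbits are finite, the
  gluing is the standard one on this circle, and so \<open>c = 1\<close>.

  For a homeomorphism of infinite order, a periodic germ would be fixed with slope 1 by some power of
  \<open>\<sigma>\<close>, again by distortion, and then this power would be the identity. So all orbits of germs are
  infinite, all germs are glued to germs at the same point, and the conjugating map is a
  homeomorphism of the circle.\<close>

section \<open>The circle and its flow\<close>

text \<open>Germs are used because a piecewise affine map has a well-defined image of every germ,
  while its values at finitely many points are arbitrary. Breaks and slopes then behave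
  subadditively under composition with no exceptional points. A gluing pairs germs only up to a
  common positive scale, so a new circle may close up with a factor c. The usual logarithm of slopes
  cannot exclude c \<noteq> 1: on such a circle a slope makes sense only modulo powers of c, and
  multiplication by a number incommensurable with c has iterates whose slopes stay bounded once read
  in a fundamental domain. An additive functional R -> R that kills \<open>ln c\<close> is blind to
  this ambiguity, and all of these together detect whether a number is a rational multiple of
  \<open>ln c\<close>. Hence the growth condition is asked for arbitrary, possibly discontinuous
  functionals; it costs nothing, since each generator has only finitely many slopes. The self-glued
  circles are reached by taking a decomposition with the least number of components: ends of
  different components that are glued could be merged.\<close>

lemma to_rz_eq_iff: "to_rz x = to_rz y \<longleftrightarrow> x - y \<in> \<int>"
  by (rule rz.abs_eq_iff)

lemma rotation_to_rz: "rotation t (to_rz x) = to_rz (x + t)"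
  by (rule rotation.abs_eq)

lemma to_rz_cases: obtains x where "z = to_rz x"
  by (metis Quotient_abs_rep Quotient_rz)

lemma rotation_0 [simp]: "rotation 0 z = z"
  by (rule to_rz_cases[of z]) (simp add: rotation_to_rz)

lemma rotation_rotation [simp]: "rotation s (rotation t z) = rotation (s + t) z"
  by (rule to_rz_cases[of z]) (simp add: rotation_to_rz add_ac)

lemma rotation_eq_iff: "rotation s z = rotation t z \<longleftrightarrow> s - t \<in> \<int>"
  by (rule to_rz_cases[of z]) (simp add: rotation_to_rz to_rz_eq_iff)

definition fr :: "rz \<Rightarrow> real" where
  "fr z = frac (rep_rz z)"

lemma to_rz_frac [simp]: "to_rz (frac x) = to_rz x"
  by (simp add: to_rz_eq_iff frac_def)

lemma to_rz_fr [simp]: "to_rz (fr z) = z"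
  unfolding fr_def to_rz_frac by (metis Quotient_abs_rep Quotient_rz)

lemma fr_ge_0 [simp]: "0 \<le> fr z" and fr_lt_1 [simp]: "fr z < 1"
  by (auto simp: fr_def frac_lt_1)

lemma fr_to_rz: "fr (to_rz x) = frac x"
proof -
  have "to_rz (fr (to_rz x)) = to_rz x" by simp
  then have "fr (to_rz x) - x \<in> \<int>" unfolding to_rz_eq_iff .
  then obtain k where k: "x = fr (to_rz x) + of_int k"
    by (metis Ints_cases add.commute diff_add_cancel minus_diff_eq of_int_minus)
  have "frac x = frac (fr (to_rz x))" by (subst k) simp
  then show ?thesis by (simp add: frac_eq)
qed

lemma fr_to_rz_id: "0 \<le> x \<Longrightarrow> x < 1 \<Longrightarrow> fr (to_rz x) = x"
  by (simp add: fr_to_rz frac_eq)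

lemma fr_eq_0_iff: "fr z = 0 \<longleftrightarrow> z = to_rz 0"
  by (metis fr_to_rz frac_of_int of_int_0 to_rz_fr)

lemma to_rz_1: "to_rz 1 = to_rz 0"
  by (simp add: to_rz_eq_iff)

text \<open>All curves are modelled by finitely many circles: \<open>(i, z)\<close> is the point \<open>z\<close> of the \<open>i\<close>-th circle, and
  a unit interval is a circle without its point 0. The germ \<open>(x, v)\<close> is the point \<open>x\<close> approached from
  the side into which the nonzero velocity \<open>v\<close> points.\<close>

type_synonym fp = "nat \<times> rz"
type_synonym germ = "fp \<times> real"

definition fl :: "real \<Rightarrow> fp \<Rightarrow> fp" where
  "fl t x = (fst x, rotation t (snd x))"

lemma fl_pair: "fl t (i, z) = (i, rotation t z)"
  by (simp add: fl_def)

lemma fst_fl [simp]: "fst (fl t x) = fst x"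
  by (simp add: fl_def)

lemma fl_0 [simp]: "fl 0 x = x"
  by (simp add: fl_def)

lemma fl_fl [simp]: "fl s (fl t x) = fl (s + t) x"
  by (simp add: fl_def)

lemma fl_eq_iff: "fl s x = fl t x \<longleftrightarrow> s - t \<in> \<int>"
  by (simp add: fl_def rotation_eq_iff)

lemma Ints_abs_less_1: "(t::real) \<in> \<int> \<Longrightarrow> \<bar>t\<bar> < 1 \<Longrightarrow> t = 0"
  by (metis Ints_nonzero_abs_less1)

lemma fl_swap: "fl s x = fl t y \<longleftrightarrow> x = fl (t - s) y"
proof
  assume "fl s x = fl t y"
  then have "fl (-s) (fl s x) = fl (-s) (fl t y)" by simp
  then show "x = fl (t - s) y" by simp
qed simp

section \<open>One-sided neighbourhoods of time 0 and local separation on the circle\<close>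

lemma ev_right:
  "eventually P (at_right (0::real)) \<longleftrightarrow> (\<exists>e>0. \<forall>t. 0 < t \<and> t < e \<longrightarrow> P t)"
  by (auto simp: eventually_at_right_field)

lemma ev_rightI: "e > 0 \<Longrightarrow> (\<And>t. 0 < t \<Longrightarrow> t < e \<Longrightarrow> P t) \<Longrightarrow> eventually P (at_right (0::real))"
  by (auto simp: ev_right)

lemma ev_right_mult:
  assumes "eventually P (at_right (0::real))" "c > 0"
  shows "eventually (\<lambda>t. P (c * t)) (at_right 0)"
proof -
  obtain e where e: "e > 0" "\<forall>t. 0 < t \<and> t < e \<longrightarrow> P t" using assms(1) by (auto simp: ev_right)
  show ?thesis
    by (rule ev_rightI[of "e / c"]) (use e assms(2) in \<open>auto simp: field_simps\<close>)
qed

text \<open>Separation of points expressed through the flow. The displacement from \<open>z\<close>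
  to \<open>y\<close> is known modulo 1, so if its class \<open>d\<close> is nonzero, no
  displacement shorter than both \<open>d\<close> and \<open>1 - d\<close> is possible.\<close>

lemma rz_local_eq:
  assumes "\<And>e. e > 0 \<Longrightarrow> \<exists>s. \<bar>s\<bar> < e \<and> y = rotation s z"
  shows "y = z"
proof -
  obtain a b where ab: "y = to_rz a" "z = to_rz b" by (meson to_rz_cases)
  define d where "d = frac (a - b)"
  have d: "0 \<le> d" "d < 1" by (auto simp: d_def frac_lt_1)
  show ?thesis
  proof (rule ccontr)
    assume "y \<noteq> z"
    then have "a - b \<notin> \<int>" by (simp add: ab to_rz_eq_iff)
    then have d0: "d > 0" unfolding d_def by (simp add: frac_gt_0_iff)
    obtain s where s: "\<bar>s\<bar> < min d (1 - d)" "y = rotation s z"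
      using assms[of "min d (1 - d)"] d d0 by auto
    have "a - (b + s) \<in> \<int>" using s(2) by (simp add: ab rotation_to_rz to_rz_eq_iff)
    moreover have "a - b - d \<in> \<int>" by (simp add: d_def frac_def)
    ultimately have "(a - b - d) - (a - (b + s)) \<in> \<int>" by (rule Ints_diff[rotated])
    then have "s - d \<in> \<int>" by (simp add: algebra_simps)
    moreover have "\<bar>s - d\<bar> < 1" using s(1) d d0 by auto
    ultimately have "s = d" using Ints_abs_less_1[of "s - d"] by auto
    then show False using s(1) by auto
  qed
qed

section \<open>Germs of piecewise affine maps\<close>

definition ev :: "germ \<Rightarrow> real \<Rightarrow> fp" where
  "ev p t = fl (snd p * t) (fst p)"

lemma ev_pair: "ev (x, v) t = fl (v * t) x"
  by (simp add: ev_def)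

text \<open>The time parameter is matched exactly, so the ratio of the velocities is the slope, and
  its sign is the orientation. The value of \<open>f\<close> at the base point itself is never
  consulted.\<close>

definition germ_rel :: "(fp \<Rightarrow> fp) \<Rightarrow> germ \<Rightarrow> germ \<Rightarrow> bool" where
  "germ_rel f p q \<longleftrightarrow> eventually (\<lambda>t. f (ev p t) = ev q t) (at_right 0)"

definition germ_map :: "(fp \<Rightarrow> fp) \<Rightarrow> germ \<Rightarrow> germ" where
  "germ_map f p = (THE q. germ_rel f p q)"

definition germs :: "nat \<Rightarrow> germ set" where
  "germs n = {p. fst (fst p) < n \<and> snd p \<noteq> 0}"

definition pw_affine :: "nat \<Rightarrow> nat \<Rightarrow> (fp \<Rightarrow> fp) \<Rightarrow> bool" where
  "pw_affine n m f \<longleftrightarrow> (\<forall>p \<in> germs n. \<exists>q \<in> germs m. germ_rel f p q)"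

text \<open>The two maps are inverse on germs only. As functions they may fail to be inverse at
  finitely many points.\<close>

definition pw_iso :: "nat \<Rightarrow> nat \<Rightarrow> (fp \<Rightarrow> fp) \<Rightarrow> (fp \<Rightarrow> fp) \<Rightarrow> bool" where
  "pw_iso n m f g \<longleftrightarrow> pw_affine n m f \<and> pw_affine m n g \<and> (\<forall>p \<in> germs n. germ_rel (g \<circ> f) p p) \<and> (\<forall>p \<in> germs m. germ_rel (f \<circ> g) p p)"

definition opp :: "germ \<Rightarrow> germ" where
  "opp p = (fst p, - snd p)"

definition sc :: "real \<Rightarrow> germ \<Rightarrow> germ" where
  "sc c p = (fst p, c * snd p)"

lemma opp_pair [simp]: "opp (x, v) = (x, - v)" by (simp add: opp_def)
lemma sc_pair [simp]: "sc c (x, v) = (x, c * v)" by (simp add: sc_def)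
lemma opp_opp [simp]: "opp (opp p) = p" by (simp add: opp_def)
lemma sc_sc [simp]: "sc c (sc d p) = sc (c * d) p" by (simp add: sc_def)
lemma sc_1 [simp]: "sc 1 p = p" by (simp add: sc_def)
lemma sc_opp [simp]: "sc c (opp p) = opp (sc c p)" by (simp add: sc_def opp_def)
lemma fst_opp [simp]: "fst (opp p) = fst p" by (simp add: opp_def)
lemma fst_sc [simp]: "fst (sc c p) = fst p" by (simp add: sc_def)
lemma snd_opp [simp]: "snd (opp p) = - snd p" by (simp add: opp_def)
lemma snd_sc [simp]: "snd (sc c p) = c * snd p" by (simp add: sc_def)
lemma opp_germs [simp]: "opp p \<in> germs n \<longleftrightarrow> p \<in> germs n" by (simp add: germs_def)
lemma sc_germs [simp]: "c > 0 \<Longrightarrow> sc c p \<in> germs n \<longleftrightarrow> p \<in> germs n" by (simp add: germs_def)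

lemma germs_pair [simp]: "(x, v) \<in> germs n \<longleftrightarrow> fst x < n \<and> v \<noteq> 0" by (simp add: germs_def)

lemma ev_eq_imp:
  assumes "eventually (\<lambda>t. ev p t = ev q t) (at_right 0)"
  shows "p = q"
proof -
  obtain x v y w where pq: "p = (x, v)" "q = (y, w)" by (metis surj_pair)
  obtain e where e: "e > 0" "\<And>t. 0 < t \<Longrightarrow> t < e \<Longrightarrow> fl (v * t) x = fl (w * t) y"
    using assms by (auto simp: ev_right pq ev_pair)
  have x: "x = fl ((w - v) * t) y" if "0 < t" "t < e" for t
    using e(2)[OF that] by (simp add: fl_swap algebra_simps)
  \<comment> \<open>The second bound makes \<open>(w - v) * (h/2)\<close> smaller than 1 in absolute
    value. Comparing the times \<open>h\<close> and \<open>h/2\<close> shows that this number is an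
    integer, hence 0.\<close>
  define h where "h = min (e/2) (1 / (2 * (\<bar>w - v\<bar> + 1)))"
  have "0 < 1 / (2 * (\<bar>w - v\<bar> + 1))" by (simp add: add_nonneg_pos)
  then have h: "h > 0" "h \<le> e/2" using e(1) by (auto simp: h_def simp del: zero_less_divide_iff zero_less_divide_1_iff)
  have "\<bar>w - v\<bar> * h \<le> \<bar>w - v\<bar> * (1 / (2 * (\<bar>w - v\<bar> + 1)))"
    by (rule mult_left_mono) (auto simp: h_def)
  moreover have "a * (1 / (2 * (a + 1))) < 1" if "a \<ge> 0" for a :: real using that by (simp add: field_simps)
  from this[of "\<bar>w - v\<bar>"] have "\<bar>w - v\<bar> * (1 / (2 * (\<bar>w - v\<bar> + 1))) < 1" by simp
  ultimately have small: "\<bar>(w - v) * (h/2)\<bar> < 1" using h by (simp add: abs_mult)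
  have "fl ((w - v) * h) y = fl ((w - v) * (h/2)) y" using x[of h] x[of "h/2"] h e(1) by simp
  then have "(w - v) * h - (w - v) * (h/2) \<in> \<int>" by (simp add: fl_eq_iff)
  moreover have "(w - v) * h - (w - v) * (h/2) = (w - v) * (h/2)" by (simp add: field_simps)
  ultimately have "(w - v) * (h/2) \<in> \<int>" by metis
  then have "(w - v) * (h/2) = 0" using small Ints_abs_less_1 by blast
  then have "w = v" using h by simp
  then show ?thesis using x[of h] h e(1) pq by simp
qed

lemma germ_rel_unique: "germ_rel f p q \<Longrightarrow> germ_rel f p q' \<Longrightarrow> q = q'"
  unfolding germ_rel_def by (rule ev_eq_imp) (erule (1) eventually_elim2, simp)

lemma germ_map_eq: "germ_rel f p q \<Longrightarrow> germ_map f p = q"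
  unfolding germ_map_def using germ_rel_unique by blast

lemma pw_affine_germ_rel: "pw_affine n m f \<Longrightarrow> p \<in> germs n \<Longrightarrow> germ_rel f p (germ_map f p)"
  unfolding pw_affine_def using germ_map_eq by blast

lemma pw_affine_germs: "pw_affine n m f \<Longrightarrow> p \<in> germs n \<Longrightarrow> germ_map f p \<in> germs m"
  unfolding pw_affine_def using germ_map_eq by blast

lemma germ_rel_comp: "germ_rel f p q \<Longrightarrow> germ_rel g q r \<Longrightarrow> germ_rel (g \<circ> f) p r"
  unfolding germ_rel_def by (erule (1) eventually_elim2) simp

lemma germ_rel_id: "germ_rel id p p" by (simp add: germ_rel_def)

lemma germ_rel_sc:
  assumes "germ_rel f p q" "c > 0" shows "germ_rel f (sc c p) (sc c q)"
  using ev_right_mult[OF assms[unfolded germ_rel_def]] unfolding germ_rel_def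
  by (simp add: ev_def mult_ac)

lemma germ_map_sc: "pw_affine n m f \<Longrightarrow> p \<in> germs n \<Longrightarrow> c > 0 \<Longrightarrow> germ_map f (sc c p) = sc c (germ_map f p)"
  by (intro germ_map_eq germ_rel_sc pw_affine_germ_rel)

lemma germ_rel_cong:
  "germ_rel f p q \<Longrightarrow> eventually (\<lambda>t. f (ev p t) = g (ev p t)) (at_right 0) \<Longrightarrow> germ_rel g p q"
  unfolding germ_rel_def by (erule (1) eventually_elim2) simp

lemma pw_affine_comp: "pw_affine n m f \<Longrightarrow> pw_affine m k g \<Longrightarrow> pw_affine n k (g \<circ> f)"
  unfolding pw_affine_def
proof
  fix p assume a: "\<forall>p\<in>germs n. \<exists>q\<in>germs m. germ_rel f p q" "\<forall>p\<in>germs m. \<exists>q\<in>germs k. germ_rel g p q" "p \<in> germs n"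
  then obtain q where q: "q \<in> germs m" "germ_rel f p q" by blast
  then obtain r where "r \<in> germs k" "germ_rel g q r" using a by blast
  then show "\<exists>r\<in>germs k. germ_rel (g \<circ> f) p r" using germ_rel_comp[OF q(2)] by blast
qed

lemma germ_map_comp: "pw_affine n m f \<Longrightarrow> pw_affine m k g \<Longrightarrow> p \<in> germs n \<Longrightarrow> germ_map (g \<circ> f) p = germ_map g (germ_map f p)"
  by (rule germ_map_eq, rule germ_rel_comp, erule (1) pw_affine_germ_rel, rule pw_affine_germ_rel, assumption, erule (1) pw_affine_germs)

lemma pw_iso_sym: "pw_iso n m f g \<Longrightarrow> pw_iso m n g f"
  unfolding pw_iso_def by blast

lemma pw_iso_pw_affine: "pw_iso n m f g \<Longrightarrow> pw_affine n m f" "pw_iso n m f g \<Longrightarrow> pw_affine m n g"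
  unfolding pw_iso_def by blast+

lemma pw_iso_inv: "pw_iso n m f g \<Longrightarrow> p \<in> germs n \<Longrightarrow> germ_map g (germ_map f p) = p"
  using germ_map_comp[of n m f n g p] germ_map_eq[of "g \<circ> f" p p] unfolding pw_iso_def by auto

lemma pw_iso_I:
  assumes "pw_affine n m f" "pw_affine m n g" "\<And>p. p \<in> germs n \<Longrightarrow> germ_map g (germ_map f p) = p"
    "\<And>p. p \<in> germs m \<Longrightarrow> germ_map f (germ_map g p) = p"
  shows "pw_iso n m f g"
proof -
  have "germ_rel (g' \<circ> f') p p" if "pw_affine a b f'" "pw_affine b a g'" "p \<in> germs a" "germ_map g' (germ_map f' p) = p" for a b f' g' p
    using germ_rel_comp[OF pw_affine_germ_rel[OF that(1,3)] pw_affine_germ_rel[OF that(2) pw_affine_germs[OF that(1,3)]]] that(4) by simp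
  then show ?thesis unfolding pw_iso_def using assms by blast
qed

lemma pw_iso_comp:
  assumes "pw_iso n m f g" "pw_iso m k f' g'"
  shows "pw_iso n k (f' \<circ> f) (g \<circ> g')"
proof (rule pw_iso_I)
  note P = pw_iso_pw_affine[OF assms(1)] pw_iso_pw_affine[OF assms(2)]
  show P1: "pw_affine n k (f' \<circ> f)" and P2: "pw_affine k n (g \<circ> g')" using P pw_affine_comp by blast+
  show "germ_map (g \<circ> g') (germ_map (f' \<circ> f) p) = p" if "p \<in> germs n" for p
    using that P assms pw_iso_inv[OF assms(1)] pw_iso_inv[OF assms(2)]
    by (simp add: germ_map_comp[OF P(1,3)] germ_map_comp[OF P(4,2)] pw_affine_germs)
  show "germ_map (f' \<circ> f) (germ_map (g \<circ> g') p) = p" if "p \<in> germs k" for p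
    using that P assms pw_iso_inv[OF pw_iso_sym[OF assms(1)]] pw_iso_inv[OF pw_iso_sym[OF assms(2)]]
    by (simp add: germ_map_comp[OF P(1,3)] germ_map_comp[OF P(4,2)] pw_affine_germs)
qed

lemma pw_affine_id: "pw_affine n n id" unfolding pw_affine_def using germ_rel_id by blast

lemma pw_iso_id: "pw_iso n n id id" unfolding pw_iso_def using pw_affine_id germ_rel_id by simp

lemma germ_map_id [simp]: "germ_map id p = p" by (rule germ_map_eq[OF germ_rel_id])

text \<open>A single germ determines \<open>f\<close> on a whole one-sided interval, where it is
  affine of slope \<open>w / v\<close>. At the inner points of that interval both directions are
  therefore known.\<close>

lemma germ_rel_prop:
  assumes "germ_rel f (x, v) (y, w)" "v \<noteq> 0"
  shows "eventually (\<lambda>t. f (fl (v * t) x) = fl (w * t) y \<and>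
     (\<forall>v'. germ_rel f (fl (v * t) x, v') (fl (w * t) y, w * v' / v))) (at_right 0)"
proof -
  obtain e where e: "e > 0" "\<And>t. 0 < t \<Longrightarrow> t < e \<Longrightarrow> f (fl (v * t) x) = fl (w * t) y"
    using assms by (auto simp: ev_right germ_rel_def ev_pair)
  show ?thesis
  proof (rule ev_rightI[OF e(1)], intro conjI allI)
    fix t v' :: real assume t: "0 < t" "t < e"
    show "f (fl (v * t) x) = fl (w * t) y" using e t by simp
    show "germ_rel f (fl (v * t) x, v') (fl (w * t) y, w * v' / v)"
      unfolding germ_rel_def
    proof (rule ev_rightI)
      \<comment> \<open>With this bound the shifted time \<open>t + v' * s / v\<close> stays inside
        the interval from 0 to \<open>e\<close>, for either sign of \<open>v'\<close>.\<close>
      let ?d = "min t (e - t) / (\<bar>v' / v\<bar> + 1)"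
      show "?d > 0" using t by (simp add: add_nonneg_pos)
      fix s assume s: "0 < s" "s < ?d"
      have "s * (\<bar>v' / v\<bar> + 1) < min t (e - t)" using s(2)
        by (simp add: pos_less_divide_eq add_nonneg_pos)
      then have "s * \<bar>v' / v\<bar> < min t (e - t)" using s(1) by (simp only: distrib_left)
      then have "\<bar>v' * s / v\<bar> < min t (e - t)" using s(1) by (simp add: abs_mult mult_ac)
      then have "\<bar>v' * s / v\<bar> < t" "\<bar>v' * s / v\<bar> < e - t" by simp_all
          then have "0 < t + v' * s / v" "t + v' * s / v < e" by (simp_all only: abs_less_iff) linarith+
      from e(2)[OF this] show "f (ev (fl (v * t) x, v') s) = ev (fl (w * t) y, w * v' / v) s"
        using assms(2) by (simp add: ev_pair distrib_left add.commute mult_ac)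
    qed
  qed
qed

lemma germ_map_prop:
  assumes "pw_affine n m f" "(x, v) \<in> germs n" "germ_map f (x, v) = (y, w)"
  shows "eventually (\<lambda>t. f (fl (v * t) x) = fl (w * t) y \<and>
     (\<forall>v'. germ_map f (fl (v * t) x, v') = (fl (w * t) y, w * v' / v))) (at_right 0)"
  using germ_rel_prop[of f x v y w] pw_affine_germ_rel[OF assms(1,2)] assms(2,3)
  by (auto elim!: eventually_mono simp: germ_map_eq)

text \<open>Compactness of finitely many circles as an induction principle: a property inherited by
  subsets and finite unions needs to be checked only on small arcs.\<close>

lemma fp_compact_induct:
  assumes empty: "P {}" and un: "\<And>A B. P A \<Longrightarrow> P B \<Longrightarrow> P (A \<union> B)"
    and sub: "\<And>A B. P B \<Longrightarrow> A \<subseteq> B \<Longrightarrow> P A"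
    and loc: "\<And>x. fst x < n \<Longrightarrow> \<exists>e>0. P {fl t x |t. \<bar>t\<bar> < e}"
  shows "P {x. fst x < n}"
proof -
  have one: "P {x. fst x = i}" if i: "i < n" for i
  proof -
    have "\<exists>e>0. P {fl t (i, to_rz r) |t. \<bar>t\<bar> < e}" for r using loc[of "(i, to_rz r)"] i by simp
    then have "\<forall>r. \<exists>e. e > 0 \<and> P {fl t (i, to_rz r) |t. \<bar>t\<bar> < e}" by simp
    from choice[OF this] obtain e where "\<forall>r. e r > 0 \<and> P {fl t (i, to_rz r) |t. \<bar>t\<bar> < e r}" ..
    then have e: "\<And>r. e r > 0" "\<And>r. P {fl t (i, to_rz r) |t. \<bar>t\<bar> < e r}" by auto
    have "compact {0..1::real}" by simp
    moreover have "{0..1} \<subseteq> (\<Union>r\<in>{0..1}. ball r (e r))" using e(1) by force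
    ultimately obtain D where D: "D \<subseteq> {0..1}" "finite D" "{0..1} \<subseteq> (\<Union>r\<in>D. ball r (e r))"
      by (elim compactE_image) auto
    have "P (\<Union>r\<in>D. {fl t (i, to_rz r) |t. \<bar>t\<bar> < e r})"
      using D(2) by (induction) (auto intro: empty un e)
    moreover have "{x. fst x = i} \<subseteq> (\<Union>r\<in>D. {fl t (i, to_rz r) |t. \<bar>t\<bar> < e r})"
    proof
      fix x :: fp assume "x \<in> {x. fst x = i}"
      then obtain z where x: "x = (i, z)" by (cases x) auto
      have "fr z \<in> {0..1}" using fr_lt_1[of z] by (simp add: less_imp_le)
      then obtain r where r: "r \<in> D" "fr z \<in> ball r (e r)" using D(3) by blast
      have "x = fl (fr z - r) (i, to_rz r)" by (simp add: x fl_pair rotation_to_rz)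
      then show "x \<in> (\<Union>r\<in>D. {fl t (i, to_rz r) |t. \<bar>t\<bar> < e r})"
        using r by (force simp: dist_real_def)
    qed
    ultimately show ?thesis using sub by blast
  qed
  have "P (\<Union>i<m. {x. fst x = i})" if "m \<le> n" for m
    using that by (induction m) (auto simp: lessThan_Suc empty un one)
  moreover have "(\<Union>i<n. {x::fp. fst x = i}) = {x. fst x < n}" by auto
  ultimately show ?thesis by (metis order_refl)
qed

lemma ev_two_sided:
  assumes "eventually (\<lambda>t. P (fl (1 * t) x)) (at_right 0)" "eventually (\<lambda>t. P (fl (- 1 * t) x)) (at_right 0)"
  shows "\<exists>e>0. \<forall>t. t \<noteq> 0 \<and> \<bar>t\<bar> < e \<longrightarrow> P (fl t x)"
proof -
  obtain a b where a: "a > 0" "\<And>t. 0 < t \<Longrightarrow> t < a \<Longrightarrow> P (fl (1 * t) x)"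
    and b: "b > 0" "\<And>t. 0 < t \<Longrightarrow> t < b \<Longrightarrow> P (fl (- 1 * t) x)"
    using assms by (auto simp: ev_right)
  have "P (fl t x)" if "t \<noteq> 0" "\<bar>t\<bar> < min a b" for t
    using a(2)[of t] b(2)[of "-t"] that by (cases "t > 0") auto
  then show ?thesis using a(1) b(1) by (intro exI[of _ "min a b"]) auto
qed

text \<open>\<open>Q\<close> may fail at the centre of an arc but not next to it, so exceptions are
  isolated, and compactness leaves finitely many.\<close>

lemma finite_exceptions:
  assumes "\<And>x v. fst x < n \<Longrightarrow> v = 1 \<or> v = -1 \<Longrightarrow> eventually (\<lambda>t. Q (fl (v * t) x)) (at_right 0)"
  shows "finite {x. fst x < n \<and> \<not> Q x}"
proof -
  have "finite {x \<in> {x. fst x < n}. \<not> Q x}"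
  proof (rule fp_compact_induct[where P = "\<lambda>A. finite {x \<in> A. \<not> Q x}"])
    show "finite {x \<in> A \<union> B. \<not> Q x}" if "finite {x \<in> A. \<not> Q x}" "finite {x \<in> B. \<not> Q x}" for A B
      using finite_UnI[OF that] by (rule rev_finite_subset) auto
    show "finite {x \<in> A. \<not> Q x}" if "finite {x \<in> B. \<not> Q x}" "A \<subseteq> B" for A B
      using that by (auto elim: rev_finite_subset)
    fix x :: fp assume "fst x < n"
    then obtain e where e: "e > 0" "\<forall>t. t \<noteq> 0 \<and> \<bar>t\<bar> < e \<longrightarrow> Q (fl t x)"
      using ev_two_sided[of Q x] assms by blast
    have "{y \<in> {fl t x |t. \<bar>t\<bar> < e}. \<not> Q y} \<subseteq> {fl 0 x}"
    proof
      fix y assume "y \<in> {y \<in> {fl t x |t. \<bar>t\<bar> < e}. \<not> Q y}"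
      then obtain t where t: "y = fl t x" "\<bar>t\<bar> < e" "\<not> Q (fl t x)" by blast
      then have "t = 0" using e(2)[rule_format, of t] by blast
      then show "y \<in> {fl 0 x}" using t(1) by simp
    qed
    then show "\<exists>e>0. finite {y \<in> {fl t x |t. \<bar>t\<bar> < e}. \<not> Q y}" using e(1) finite_subset by blast
  qed simp
  then show ?thesis by simp
qed

text \<open>Near a point only the two one-sided slopes of that point occur. Homogeneity in the
  velocity reduces all germs to unit speed.\<close>

lemma finite_slopes:
  assumes "pw_affine n m f"
  shows "finite {\<bar>snd (germ_map f p) / snd p\<bar> |p. p \<in> germs n}"
proof -
  let ?S = "\<lambda>A. {\<bar>snd (germ_map f p) / snd p\<bar> |p. p \<in> germs n \<and> fst p \<in> A}"
  have norm: "\<exists>v'. (v' = 1 \<or> v' = -1) \<and> \<bar>snd (germ_map f (x, v)) / v\<bar> = \<bar>snd (germ_map f (x, v')) / v'\<bar>"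
    if "(x, v) \<in> germs n" for x v
  proof -
    have "(x, v) = sc \<bar>v\<bar> (x, sgn v)" by (simp add: abs_sgn)
    moreover have "(x, sgn v) \<in> germs n" using that by (auto simp: sgn_zero_iff)
    moreover have "\<bar>v\<bar> > 0" using that by simp
    ultimately have *: "germ_map f (x, v) = sc \<bar>v\<bar> (germ_map f (x, sgn v))" using germ_map_sc[OF assms] by metis
    have "\<bar>snd (germ_map f (x, v)) / v\<bar> = \<bar>snd (germ_map f (x, sgn v)) / sgn v\<bar>"
      unfolding * using that by (auto simp: abs_mult abs_divide abs_sgn_eq)
    then show ?thesis using that by (intro exI[of _ "sgn v"]) (auto simp: sgn_real_def)
  qed
  have "finite (?S {x. fst x < n})"
  proof (rule fp_compact_induct[where P = "\<lambda>A. finite (?S A)"])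
    show "finite (?S (A \<union> B))" if "finite (?S A)" "finite (?S B)" for A B
      using finite_UnI[OF that] by (rule rev_finite_subset) blast
    show "finite (?S A)" if "finite (?S B)" "A \<subseteq> B" for A B
      using that(1) by (rule rev_finite_subset) (use that(2) in blast)
    fix x :: fp assume x: "fst x < n"
    let ?Q = "\<lambda>s y. \<forall>v'. v' \<noteq> 0 \<longrightarrow> \<bar>snd (germ_map f (y, v')) / v'\<bar> \<in> s"
    define s where "s = {\<bar>snd (germ_map f (x, 1))\<bar>, \<bar>snd (germ_map f (x, -1))\<bar>}"
    have "eventually (\<lambda>t. ?Q s (fl (v * t) x)) (at_right 0)" if "v = 1 \<or> v = -1" for v
    proof -
      obtain y w where yw: "germ_map f (x, v) = (y, w)" by (cases "germ_map f (x, v)")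
      show ?thesis
      proof (rule eventually_mono[OF germ_map_prop[OF assms _ yw]])
        show "(x, v) \<in> germs n" using x that by auto
        fix t assume a: "f (fl (v * t) x) = fl (w * t) y \<and> (\<forall>v'. germ_map f (fl (v * t) x, v') = (fl (w * t) y, w * v' / v))"
        have "\<bar>w\<bar> \<in> s" using yw that by (auto simp: s_def)
        then show "?Q s (fl (v * t) x)" using a that by (auto simp: abs_mult)
      qed
    qed
    then obtain e where e: "e > 0" "\<forall>t. t \<noteq> 0 \<and> \<bar>t\<bar> < e \<longrightarrow> ?Q s (fl t x)"
      using ev_two_sided[of "?Q s" x] by blast
    have "?S {fl t x |t. \<bar>t\<bar> < e} \<subseteq> s"
    proof
      fix a assume "a \<in> ?S {fl t x |t. \<bar>t\<bar> < e}"
      then obtain p where p: "p \<in> germs n" "a = \<bar>snd (germ_map f p) / snd p\<bar>" "fst p \<in> {fl t x |t. \<bar>t\<bar> < e}"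
        by blast
      then obtain t where t': "\<bar>t\<bar> < e" "fst p = fl t x" by blast
      obtain v where v: "p = (fl t x, v)" using t'(2) by (cases p) auto
      have t: "\<bar>t\<bar> < e" "(fl t x, v) \<in> germs n" "a = \<bar>snd (germ_map f (fl t x, v)) / v\<bar>"
        using p(1,2) t'(1) by (auto simp: v)
      show "a \<in> s"
      proof (cases "t = 0")
        case True then show ?thesis using norm[of x v] t by (auto simp: s_def)
      next
        case False then show ?thesis using e(2) t by auto
      qed
    qed
    then show "\<exists>e>0. finite (?S {fl t x |t. \<bar>t\<bar> < e})"
      using e(1) finite_subset[of _ s] by (intro exI[of _ e]) (auto simp: s_def)
  qed simp
  moreover have "?S {x. fst x < n} = {\<bar>snd (germ_map f p) / snd p\<bar> |p. p \<in> germs n}" by (auto simp: germs_def)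
  ultimately show ?thesis by simp
qed

text \<open>The position of a germ in the fundamental domain, as seen from inside: the germ at the
  integer point pointing backwards sits at 1, not at 0.\<close>

definition pos :: "germ \<Rightarrow> real" where
  "pos p = (if snd (fst p) = to_rz 0 \<and> snd p < 0 then 1 else fr (snd (fst p)))"

lemma pos_bounds: "0 \<le> pos p" "pos p \<le> 1"
  by (auto simp: pos_def less_imp_le)

lemma to_rz_pos: "to_rz (pos p) = snd (fst p)"
  by (auto simp: pos_def to_rz_1)

lemma pos_inner: "snd (fst p) \<noteq> to_rz 0 \<Longrightarrow> 0 < pos p \<and> pos p < 1 \<and> pos p = fr (snd (fst p))"
  using fr_eq_0_iff[of "snd (fst p)"] fr_ge_0[of "snd (fst p)"] by (auto simp: pos_def simp del: fr_ge_0)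

lemma fr_ev:
  assumes "v \<noteq> 0"
  shows "eventually (\<lambda>t. fr (snd (fl (v * t) x)) = pos (x, v) + v * t \<and> 0 < pos (x, v) + v * t \<and> pos (x, v) + v * t < 1) (at_right 0)"
proof -
  obtain i z where x: "x = (i, z)" by (cases x)
  have "\<exists>e>0. \<forall>t. 0 < t \<and> t < e \<longrightarrow> 0 < pos (x, v) + v * t \<and> pos (x, v) + v * t < 1"
  proof -
    let ?P = "pos (x, v)"
    have A: "?P < 1" if "v > 0" using that by (simp add: pos_def)
    have B: "?P > 0" if "v < 0"
    proof (cases "z = to_rz 0")
      case True then show ?thesis using that by (simp add: pos_def x)
    next
      case False then show ?thesis using pos_inner[of "(x, v)"] by (simp add: x)
    qed
    show ?thesis
    proof (cases "v > 0")
      case True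
      then show ?thesis using A pos_bounds(1)[of "(x,v)"]
        by (intro exI[of _ "(1 - ?P) / v"]) (auto simp: pos_less_divide_eq mult.commute intro!: add_nonneg_pos)
    next
      case False
      then have v: "v < 0" using assms by simp
      show ?thesis
      proof (intro exI[of _ "?P / - v"] conjI allI impI)
        show "0 < ?P / - v" using B v by (simp add: divide_pos_neg)
        fix t assume t: "0 < t \<and> t < ?P / - v"
        then show "0 < ?P + v * t" using v by (simp add: field_simps)
        have "v * t < 0" using v t by (simp add: mult_neg_pos)
        then show "?P + v * t < 1" using pos_bounds(2)[of "(x,v)"] by simp
      qed
    qed
  qed
  then obtain e where e: "e > 0" "\<And>t. 0 < t \<Longrightarrow> t < e \<Longrightarrow> 0 < pos (x, v) + v * t \<and> pos (x, v) + v * t < 1"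
    by blast
  show ?thesis
  proof (rule ev_rightI[OF e(1)])
    fix t assume t: "0 < t" "t < e"
    have "snd (fl (v * t) x) = to_rz (pos (x, v) + v * t)"
      by (metis rotation_to_rz to_rz_pos fl_def fst_conv snd_conv)
    then show "fr (snd (fl (v * t) x)) = pos (x, v) + v * t \<and> 0 < pos (x, v) + v * t \<and> pos (x, v) + v * t < 1"
      using e(2)[OF t] fr_to_rz_id by simp
  qed
qed

lemma pos_ev:
  assumes "v \<noteq> 0"
  shows "eventually (\<lambda>t. \<forall>v'. pos (fl (v * t) x, v') = pos (x, v) + v * t \<and> snd (fl (v * t) x) \<noteq> to_rz 0) (at_right 0)"
  using fr_ev[OF assms, of x]
proof (rule eventually_mono)
  fix t assume a: "fr (snd (fl (v * t) x)) = pos (x, v) + v * t \<and> 0 < pos (x, v) + v * t \<and> pos (x, v) + v * t < 1"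
  then have "snd (fl (v * t) x) \<noteq> to_rz 0" using fr_eq_0_iff by force
  then show "\<forall>v'. pos (fl (v * t) x, v') = pos (x, v) + v * t \<and> snd (fl (v * t) x) \<noteq> to_rz 0"
    using a by (simp add: pos_def)
qed

lemma germ_eqI:
  assumes "fst (fst p) = fst (fst q)" "pos p = pos q" "snd p = snd q" shows "p = q"
  using assms to_rz_pos[of p] to_rz_pos[of q] by (metis prod.collapse)

text \<open>Connectedness of a circle cut open at 0: agreement across 0 is not demanded. The two
  germs at 0 are still covered, because local constancy ties each of them to nearby inner points.
  This is the device by which local data become constants of a component.\<close>

lemma germ_constant:
  fixes \<Phi> :: "germ \<Rightarrow> 'a"
  assumes cross: "\<And>z. z \<noteq> to_rz 0 \<Longrightarrow> \<Phi> ((i, z), -1) = \<Phi> ((i, z), 1)"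
    and locc: "\<And>z v. v = 1 \<or> v = -1 \<Longrightarrow> eventually (\<lambda>t. \<Phi> (fl (v * t) (i, z), v) = \<Phi> ((i, z), v)) (at_right 0)"
  shows "\<exists>c. \<forall>z v. v = 1 \<or> v = -1 \<longrightarrow> \<Phi> ((i, z), v) = c"
proof -
  define F where "F r = \<Phi> ((i, to_rz r), 1)" for r
  have nz: "to_rz r \<noteq> to_rz 0" if "0 < r" "r < 1" for r
    using that Ints_abs_less_1[of r] by (auto simp: to_rz_eq_iff)
  have loc: "\<exists>e>0. \<forall>r'. \<bar>r' - r\<bar> < e \<longrightarrow> F r' = F r" if r: "0 < r" "r < 1" for r
  proof -
    obtain a b where a: "a > 0" "\<And>t. 0 < t \<Longrightarrow> t < a \<Longrightarrow> \<Phi> (fl (1 * t) (i, to_rz r), 1) = \<Phi> ((i, to_rz r), 1)"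
      and b: "b > 0" "\<And>t. 0 < t \<Longrightarrow> t < b \<Longrightarrow> \<Phi> (fl (- 1 * t) (i, to_rz r), - 1) = \<Phi> ((i, to_rz r), -1)"
      using locc[of 1 "to_rz r"] locc[of "-1" "to_rz r"] by (auto simp: ev_right)
    show ?thesis
    proof (intro exI[of _ "Min {a, b, r, 1 - r}"] conjI allI impI)
      show "0 < Min {a, b, r, 1 - r}" using a b r by simp
      fix r' assume r': "\<bar>r' - r\<bar> < Min {a, b, r, 1 - r}"
      consider "r' = r" | "r' > r" | "r' < r" by linarith
      then show "F r' = F r"
      proof cases
        case 2 then show ?thesis using a(2)[of "r' - r"] r' by (simp add: F_def fl_pair rotation_to_rz)
      next
        case 3
        have "\<Phi> ((i, to_rz r'), -1) = \<Phi> ((i, to_rz r'), 1)"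
          using r' 3 by (intro cross nz) auto
        then show ?thesis using b(2)[of "r - r'"] r' 3 cross[OF nz[OF r]]
          by (simp add: F_def fl_pair rotation_to_rz)
      qed simp
    qed
  qed
  have const: "F r = F s" if "r \<in> {0<..<1}" "s \<in> {0<..<1}" for r s
  proof (rule connected_local_const[where A = "{0<..<1::real}"])
    show "connected {0<..<1::real}" by simp
    show "\<forall>a\<in>{0<..<1}. \<forall>\<^sub>F b in at a within {0<..<1}. F a = F b"
    proof
      fix a :: real assume "a \<in> {0<..<1}"
      then obtain e where e: "e > 0" "\<forall>r'. \<bar>r' - a\<bar> < e \<longrightarrow> F r' = F a" using loc by auto
      then show "\<forall>\<^sub>F b in at a within {0<..<1}. F a = F b"
        unfolding eventually_at dist_real_def
      proof (intro exI[of _ e] conjI ballI impI)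
        fix b assume "b \<noteq> a \<and> \<bar>b - a\<bar> < e"
        then have "F b = F a" using e(2) by blast
        then show "F a = F b" by (rule sym)
      qed (rule e(1))
    qed
  qed (use that in auto)
  have "\<Phi> ((i, z), v) = F (1/2)" if v: "v = 1 \<or> v = -1" for z v
  proof -
    have "v \<noteq> 0" using v by auto
    have "eventually (\<lambda>t. \<Phi> ((i, z), v) = F (1/2)) (at_right (0::real))"
      using fr_ev[OF \<open>v \<noteq> 0\<close>, of "(i, z)"] locc[OF v, of z]
    proof (rule eventually_elim2)
      fix t assume a: "fr (snd (fl (v * t) (i, z))) = pos ((i, z), v) + v * t \<and> 0 < pos ((i, z), v) + v * t \<and> pos ((i, z), v) + v * t < 1"
        and b: "\<Phi> (fl (v * t) (i, z), v) = \<Phi> ((i, z), v)"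
      define r where "r = fr (snd (fl (v * t) (i, z)))"
      have r: "0 < r" "r < 1" "fl (v * t) (i, z) = (i, to_rz r)" using a unfolding r_def to_rz_fr by (auto simp: fl_pair)
      then have "\<Phi> (fl (v * t) (i, z), v) = F r" using v cross[OF nz[OF r(1,2)]] by (auto simp: F_def)
      then show "\<Phi> ((i, z), v) = F (1/2)" using const[of r "1/2"] r b by simp
    qed
    then show ?thesis by simp
  qed
  then show ?thesis by blast
qed

declare One_nat_def [simp del]

section \<open>The invariant gluing\<close>

text \<open>Jumps and changes of slope both count. An isolated wrong value of \<open>f\<close> does
  not.\<close>

definition broken :: "(fp \<Rightarrow> fp) \<Rightarrow> fp \<Rightarrow> bool" where
  "broken f x \<longleftrightarrow> germ_map f (x, -1) \<noteq> opp (germ_map f (x, 1))"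

lemma not_broken_opp:
  assumes "pw_affine n m f" "p \<in> germs n" "\<not> broken f (fst p)"
  shows "germ_map f (opp p) = opp (germ_map f p)"
proof -
  obtain x v where p: "p = (x, v)" by (cases p)
  have v: "v \<noteq> 0" and x: "fst x < n" using assms(2) by (auto simp: p)
  have a: "p = sc \<bar>v\<bar> (x, sgn v)" "opp p = sc \<bar>v\<bar> (x, - sgn v)" by (simp_all add: p abs_mult_sgn)
  have b: "(x, sgn v) \<in> germs n" "(x, - sgn v) \<in> germs n" using v x by (auto simp: sgn_zero_iff)
  have "germ_map f (x, - sgn v) = opp (germ_map f (x, sgn v))"
    using assms(3) v by (cases "v > 0") (auto simp: broken_def p)
  moreover have "germ_map f p = sc \<bar>v\<bar> (germ_map f (x, sgn v))" unfolding a(1) by (rule germ_map_sc[OF assms(1) b(1)]) (use v in simp)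
  moreover have "germ_map f (opp p) = sc \<bar>v\<bar> (germ_map f (x, - sgn v))" unfolding a(2) by (rule germ_map_sc[OF assms(1) b(2)]) (use v in simp)
  ultimately show ?thesis by simp
qed

lemma pw_affine_regular_near:
  assumes "pw_affine n m f" "fst x < n" "v = 1 \<or> v = -1"
  shows "eventually (\<lambda>t. \<not> broken f (fl (v * t) x) \<and> f (fl (v * t) x) = fst (germ_map f (fl (v * t) x, 1))) (at_right 0)"
proof -
  obtain y w where yw: "germ_map f (x, v) = (y, w)" by (cases "germ_map f (x, v)")
  show ?thesis
    using germ_map_prop[OF assms(1) _ yw] assms(2,3)
    by (auto elim!: eventually_mono simp: broken_def)
qed

lemma finite_broken: "pw_affine n m f \<Longrightarrow> finite {x. fst x < n \<and> broken f x}"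
  using finite_exceptions[of n "\<lambda>x. \<not> broken f x"] pw_affine_regular_near[of n m f]
  by (simp add: eventually_conj_iff)

text \<open>Where \<open>f\<close> is unbroken, the two germs arrive at one point in opposite
  directions, so a break of the composite must come from \<open>g\<close> there. That point is read
  off the germ, since \<open>f x\<close> itself may be arbitrary.\<close>

lemma broken_comp:
  assumes "pw_affine n m f" "pw_affine m k g" "fst x < n" "broken (g \<circ> f) x"
  shows "broken f x \<or> broken g (fst (germ_map f (x, 1)))"
proof (rule ccontr)
  assume a: "\<not> ?thesis"
  have p: "(x, 1) \<in> germs n" "(x, -1) \<in> germs n" using assms(3) by auto
  have "germ_map f (x, -1) = opp (germ_map f (x, 1))" using a by (simp add: broken_def)
  then have "germ_map (g \<circ> f) (x, -1) = opp (germ_map (g \<circ> f) (x, 1))"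
    using a not_broken_opp[OF assms(2) pw_affine_germs[OF assms(1) p(1)]]
    by (simp add: germ_map_comp[OF assms(1,2)] p del: germs_pair)
  then show False using assms(4) by (simp add: broken_def)
qed

lemma funpow_Suc_pw_iso: "pw_iso n n f g \<Longrightarrow> pw_iso n n (f ^^ k) (g ^^ k)"
proof (induction k)
  case 0 then show ?case using pw_iso_id by (simp add: id_def)
next
  case (Suc k)
  have "pw_iso n n (f ^^ k \<circ> f) (g \<circ> g ^^ k)" using pw_iso_comp[OF Suc.prems Suc.IH[OF Suc.prems]] .
  then show ?case unfolding funpow_Suc_right[symmetric] funpow.simps(2)[symmetric] .
qed

lemma germ_map_funpow:
  assumes "pw_iso n n f g" "p \<in> germs n" shows "germ_map (f ^^ k) p = (germ_map f ^^ k) p \<and> (germ_map f ^^ k) p \<in> germs n"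
proof (induction k)
  case (Suc k)
  note P = pw_iso_pw_affine(1)[OF funpow_Suc_pw_iso[OF assms(1), of k]] pw_iso_pw_affine(1)[OF assms(1)]
  show ?case using Suc germ_map_comp[OF P assms(2)] pw_affine_germs[OF P(2)] by (simp add: comp_def)
qed (use assms in \<open>simp add: id_def[symmetric]\<close>)

lemma finite_int_bounded: "finite (S :: int set) \<Longrightarrow> \<exists>N. \<forall>k\<in>S. \<bar>k\<bar> < N"
proof (induction rule: finite_induct)
  case (insert x S)
  then obtain N where "\<forall>k\<in>S. \<bar>k\<bar> < N" by blast
  then show ?case by (intro exI[of _ "max N (\<bar>x\<bar> + 1)"]) auto
qed simp

lemma sgn_values: "sgn (r::real) \<in> {-1, 0, 1}"
  by (simp add: sgn_real_def)

text \<open>A piecewise affine self-map \<open>f\<close> of the circle, with inverse \<open>g\<close>, whose powers have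
  sublinearly many breaks and slopes that grow sublinearly under every additive functional
  of their logarithm.\<close>

locale sublinear =
  fixes f g :: "fp \<Rightarrow> fp" and l :: "nat \<Rightarrow> nat"
  assumes fg: "pw_iso 1 1 f g"
    and sub: "(\<lambda>n. real (l n) / real n) \<longlonglongrightarrow> 0"
    and breaks: "\<exists>K. \<forall>n. card {x. fst x < 1 \<and> broken (f ^^ n) x} \<le> K * l n"
    and slopes: "\<And>u :: real \<Rightarrow> real. (\<And>a b. u (a + b) = u a + u b) \<Longrightarrow>
       \<exists>K. \<forall>n. \<forall>p \<in> germs 1. \<bar>u (ln \<bar>snd (germ_map (f ^^ n) p) / snd p\<bar>)\<bar> \<le> K * real (l n)"
begin

section \<open>Integer powers acting on germs, and the invariant gluing\<close>

definition A :: "int \<Rightarrow> germ \<Rightarrow> germ" where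
  "A k p = (if k \<ge> 0 then (germ_map f ^^ nat k) p else (germ_map g ^^ nat (-k)) p)"

lemma A_0 [simp]: "A 0 p = p" by (simp add: A_def)

lemma PAf: "pw_affine 1 1 f"
  using pw_iso_pw_affine(1)[OF fg] .

definition f_pow :: "int \<Rightarrow> fp \<Rightarrow> fp" where
  "f_pow k = (if k \<ge> 0 then f ^^ nat k else g ^^ nat (-k))"

lemma f_pow_pw_iso: "pw_iso 1 1 (f_pow k) (f_pow (-k))"
  using funpow_Suc_pw_iso[OF fg, of "nat k"] funpow_Suc_pw_iso[OF pw_iso_sym[OF fg], of "nat (-k)"] pw_iso_id
  by (cases "k = 0") (auto simp: f_pow_def)

lemma f_pow_pw_affine: "pw_affine 1 1 (f_pow k)" using pw_iso_pw_affine(1)[OF f_pow_pw_iso] .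

lemma A_germ_map: "p \<in> germs 1 \<Longrightarrow> A k p = germ_map (f_pow k) p"
  using germ_map_funpow[OF fg] germ_map_funpow[OF pw_iso_sym[OF fg]] by (simp add: A_def f_pow_def)

lemma A_germs [simp]: "p \<in> germs 1 \<Longrightarrow> A k p \<in> germs 1"
  using pw_affine_germs[OF f_pow_pw_affine] A_germ_map by simp

lemma A_Suc:
  assumes "p \<in> germs 1" shows "A (k + 1) p = germ_map f (A k p)"
proof (cases "k \<ge> 0")
  case True
  then have "nat (k + 1) = Suc (nat k)" by simp
  then show ?thesis using True by (simp add: A_def)
next
  case False
  define m where "m = nat (- (k + 1))"
  have m: "nat (- k) = Suc m" using False by (simp add: m_def)
  have "(germ_map g ^^ m) p \<in> germs 1" using germ_map_funpow[OF pw_iso_sym[OF fg] assms] by blast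
  then have "germ_map f (germ_map g ((germ_map g ^^ m) p)) = (germ_map g ^^ m) p" using pw_iso_inv[OF pw_iso_sym[OF fg]] by blast
  then have "germ_map f (A k p) = (germ_map g ^^ m) p" using False m by (simp add: A_def)
  also have "\<dots> = A (k + 1) p" using False
    by (cases "k = -1") (auto simp: A_def m_def)
  finally show ?thesis by simp
qed

lemma A_add: assumes "p \<in> germs 1" shows "A (j + k) p = A j (A k p)"
proof (induction j rule: int_induct[where k = 0])
  case (step1 i)
  have "A (i + 1 + k) p = A ((i + k) + 1) p" by (simp add: algebra_simps)
  also have "\<dots> = germ_map f (A (i + k) p)" using assms by (rule A_Suc)
  also have "\<dots> = A (i + 1) (A k p)" using step1 A_Suc[OF A_germs[OF assms]] by simp
  finally show ?case .
next
  case (step2 i)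
  have "germ_map f (A (i - 1 + k) p) = A ((i - 1 + k) + 1) p" using A_Suc[OF assms] by (rule sym)
  also have "\<dots> = A (i + k) p" by (simp add: algebra_simps)
  also have "\<dots> = A i (A k p)" by (rule step2)
  also have "\<dots> = germ_map f (A (i - 1) (A k p))" using A_Suc[OF A_germs[OF assms], of "i - 1"] by simp
  finally have "germ_map g (germ_map f (A (i - 1 + k) p)) = germ_map g (germ_map f (A (i - 1) (A k p)))" by simp
  then show ?case using pw_iso_inv[OF fg] assms by simp
qed simp

lemma A_minus: "p \<in> germs 1 \<Longrightarrow> A (- k) (A k p) = p" "p \<in> germs 1 \<Longrightarrow> A k (A (- k) p) = p"
  using A_add[of p "-k" k] A_add[of p k "-k"] by auto

lemma A_inj: "p \<in> germs 1 \<Longrightarrow> q \<in> germs 1 \<Longrightarrow> A k p = A k q \<Longrightarrow> p = q"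
  by (metis A_minus(1))

lemma A_sc: "p \<in> germs 1 \<Longrightarrow> c > 0 \<Longrightarrow> A k (sc c p) = sc c (A k p)"
  using germ_map_sc[OF f_pow_pw_affine] A_germ_map by simp

text \<open>Finitely many exceptional \<open>k\<close> can only occur along an infinite orbit. If the rays of \<open>p\<close> and \<open>q\<close>
  are periodic, there are none, and \<open>q\<close> is opposite to \<open>p\<close>.\<close>

definition G :: "germ \<Rightarrow> germ \<Rightarrow> bool" where
  "G p q \<longleftrightarrow> p \<in> germs 1 \<and> q \<in> germs 1 \<and> finite {k. A k q \<noteq> opp (A k p)}"

lemma G_germs: "G p q \<Longrightarrow> p \<in> germs 1" "G p q \<Longrightarrow> q \<in> germs 1"
  by (auto simp: G_def)

lemma G_ev: "G p q \<Longrightarrow> \<exists>N. \<forall>k. \<bar>k\<bar> \<ge> N \<longrightarrow> A k q = opp (A k p)"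
proof -
  assume "G p q"
  then have "finite {k. A k q \<noteq> opp (A k p)}" by (simp add: G_def)
  then obtain N where "\<forall>k \<in> {k. A k q \<noteq> opp (A k p)}. \<bar>k\<bar> < N" using finite_int_bounded by blast
  then show ?thesis by (intro exI[of _ N]) force
qed

lemma G_I:
  assumes "p \<in> germs 1" "q \<in> germs 1" "\<And>k. \<bar>k\<bar> \<ge> N \<Longrightarrow> A k q = opp (A k p)" shows "G p q"
proof -
  have "{k. A k q \<noteq> opp (A k p)} \<subseteq> {-N..N}" using assms(3) by force
  then show ?thesis using assms(1,2) finite_subset by (auto simp: G_def)
qed

lemma G_sym: "G p q \<Longrightarrow> G q p"
proof -
  have "{k. A k p \<noteq> opp (A k q)} = {k. A k q \<noteq> opp (A k p)}" by (metis opp_opp)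
  then show "G p q \<Longrightarrow> G q p" by (simp add: G_def)
qed

lemma G_unique: assumes "G p q" "G p q'" shows "q = q'"
proof -
  obtain N N' where "\<forall>k. \<bar>k\<bar> \<ge> N \<longrightarrow> A k q = opp (A k p)" "\<forall>k. \<bar>k\<bar> \<ge> N' \<longrightarrow> A k q' = opp (A k p)"
    using assms G_ev by meson
  then have "A (max \<bar>N\<bar> \<bar>N'\<bar>) q = A (max \<bar>N\<bar> \<bar>N'\<bar>) q'" by simp
  then show ?thesis using A_inj assms G_germs by blast
qed

lemma G_A: assumes "G p q" shows "G (A j p) (A j q)"
proof -
  obtain N where N: "\<forall>k. \<bar>k\<bar> \<ge> N \<longrightarrow> A k q = opp (A k p)" using G_ev[OF assms] by blast
  show ?thesis
  proof (rule G_I[where N = "N + \<bar>j\<bar>"])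
    fix k assume "N + \<bar>j\<bar> \<le> \<bar>k\<bar>"
    then have "\<bar>k + j\<bar> \<ge> N" by linarith
    then have "A (k + j) q = opp (A (k + j) p)" using N by blast
    then show "A k (A j q) = opp (A k (A j p))" using A_add G_germs[OF assms] by simp
  qed (use G_germs[OF assms] in auto)
qed

lemma G_sc: assumes "G p q" "c > 0" shows "G (sc c p) (sc c q)"
proof -
  obtain N where N: "\<forall>k. \<bar>k\<bar> \<ge> N \<longrightarrow> A k q = opp (A k p)" using G_ev[OF assms(1)] by blast
  show ?thesis
    by (rule G_I[of _ _ N]) (use N A_sc G_germs[OF assms(1)] assms(2) in auto)
qed

text \<open>At large times the gluing would identify a positive multiple of a velocity with its
  negative.\<close>

lemma G_not_sc: assumes "G p (sc c p)" "c > 0" shows False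
proof -
  obtain N where N: "\<forall>k. \<bar>k\<bar> \<ge> N \<longrightarrow> A k (sc c p) = opp (A k p)" using G_ev[OF assms(1)] by blast
  have p: "p \<in> germs 1" using G_germs[OF assms(1)] by simp
  have "sc c (A N p) = opp (A N p)" using N A_sc[OF p assms(2)] by force
  then have "c * snd (A N p) = - snd (A N p)" by (metis snd_opp snd_sc)
  moreover have "snd (A N p) \<noteq> 0" using A_germs[OF p, of N] by (simp add: germs_def)
  ultimately have "(c + 1) * snd (A N p) = 0" "snd (A N p) \<noteq> 0" by (simp_all add: algebra_simps)
  then show False using assms(2) by simp
qed

text \<open>Periodicity of the ray rather than of the germ: a return with another speed counts, as
  at a repelling fixed point.\<close>

definition periodic :: "germ \<Rightarrow> bool" where
  "periodic p \<longleftrightarrow> (\<exists>k c. k \<noteq> 0 \<and> c > 0 \<and> A k p = sc c p)"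

abbreviation Br :: "fp set" where "Br \<equiv> {x. fst x < 1 \<and> broken f x}"

text \<open>Base point and sign of the velocity determine a germ up to positive scale, so a
  repetition would be a return of the ray.\<close>

lemma aperiodic_inj:
  assumes "p \<in> germs 1" "\<not> periodic p"
  shows "inj (\<lambda>k. (fst (A k p), sgn (snd (A k p))))"
proof (rule injI)
  fix i j assume a: "(fst (A i p), sgn (snd (A i p))) = (fst (A j p), sgn (snd (A j p)))"
  have nz: "snd (A i p) \<noteq> 0" "snd (A j p) \<noteq> 0" using A_germs[OF assms(1)] by (auto simp: germs_def)
  define c where "c = snd (A i p) / snd (A j p)"
  have "sgn (snd (A i p)) = sgn (snd (A j p))" using a by simp
  then have c: "c > 0" using nz unfolding c_def
    by (auto simp: sgn_real_def zero_less_divide_iff split: if_splits)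
  have "A i p = sc c (A j p)" using a nz by (simp add: prod_eq_iff c_def)
  then have "A (- j) (A i p) = sc c (A (-j) (A j p))" using A_sc A_germs assms(1) c by simp
  then have "A (i - j) p = sc c p" using A_add[OF assms(1), of "-j" i] A_minus[OF assms(1)] by simp
  then show "i = j" using assms(2) c unfolding periodic_def by (metis eq_iff_diff_eq_0)
qed

lemma aperiodic_finite:
  assumes "p \<in> germs 1" "\<not> periodic p" "finite B"
  shows "finite {k. fst (A k p) \<in> B}"
proof -
  have "finite (B \<times> {-1, 0, 1::real})" using assms(3) by simp
  then have "finite ((\<lambda>k. (fst (A k p), sgn (snd (A k p)))) -` (B \<times> {-1, 0, 1}))"
    using aperiodic_inj[OF assms(1,2)] by (rule finite_vimageI)
  then show ?thesis by (rule rev_finite_subset) (auto simp: sgn_real_def)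
qed

text \<open>The germ \<open>A (- k) (opp (A k p))\<close> is the partner of \<open>p\<close> under
  the standard gluing pulled back by the \<open>k\<close>-th power. It changes between
  \<open>k\<close> and \<open>k + 1\<close> only when the orbit of \<open>p\<close> passes a break
  of \<open>f\<close> at time \<open>k\<close>.\<close>

lemma A_opp_step:
  assumes "p \<in> germs 1" "fst (A k p) \<notin> Br"
  shows "A (- (k + 1)) (opp (A (k + 1) p)) = A (- k) (opp (A k p))"
proof -
  have p: "A k p \<in> germs 1" "opp (A k p) \<in> germs 1" using assms by auto
  have "\<not> broken f (fst (A k p))" using assms(2) p(1) by (auto simp: germs_def)
  then have "opp (A (k + 1) p) = germ_map f (opp (A k p))"
    using not_broken_opp[OF PAf p(1)] A_Suc[OF assms(1)] by simp
  also have "\<dots> = A 1 (opp (A k p))" using A_Suc[OF p(2), of 0] by simp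
  finally have "A (- (k + 1)) (opp (A (k + 1) p)) = A (- (k + 1)) (A 1 (opp (A k p)))" by simp
  also have "\<dots> = A (- (k + 1) + 1) (opp (A k p))" using A_add[OF p(2), of "- (k + 1)" 1] by simp
  finally show ?thesis by simp
qed

text \<open>If the two candidates for the partner of \<open>p\<close>, read off far in the future and far in the
  past, differed, then \<open>f ^^ n\<close> would be broken at about \<open>n\<close> points of the orbit of \<open>p\<close>.\<close>

lemma aperiodic_partner:
  assumes p: "p \<in> germs 1" and ap: "\<not> periodic p"
  shows "\<exists>q. G p q \<and> (\<exists>k. q = A (- k) (opp (A k p)))"
proof -
  have "finite {k. fst (A k p) \<in> Br}" using aperiodic_finite[OF p ap finite_broken[OF PAf]] .
  then obtain N0 where "\<forall>k \<in> {k. fst (A k p) \<in> Br}. \<bar>k\<bar> < N0" using finite_int_bounded by blast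
  then have N0: "\<And>k. fst (A k p) \<in> Br \<Longrightarrow> \<bar>k\<bar> < N0" by blast
  define N where "N = nat \<bar>N0\<bar> + 1"
  have N: "\<And>k. \<bar>k\<bar> \<ge> int N - 1 \<Longrightarrow> fst (A k p) \<notin> Br" using N0 unfolding N_def by force
  define q where "q k = A (- k) (opp (A k p))" for k
  have qGP: "q k \<in> germs 1" for k using p by (simp add: q_def)
  have step: "q (k + 1) = q k" if "fst (A k p) \<notin> Br" for k
    unfolding q_def using A_opp_step[OF p that] .
  have up: "q (int (N + k)) = q (int N)" for k
  proof (induction k)
    case (Suc k)
    have "q (int (N + k) + 1) = q (int (N + k))" by (rule step[OF N]) simp
    then show ?case using Suc by (simp add: add_ac)
  qed simp
  have dn: "q (- int (N + k)) = q (- int N)" for k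
  proof (induction k)
    case (Suc k)
    have "q ((- int (N + Suc k)) + 1) = q (- int (N + Suc k))" by (rule step[OF N]) simp
    then show ?case using Suc by (simp add: add_ac)
  qed simp
  have Aq: "A k (q k) = opp (A k p)" for k
    unfolding q_def using A_minus(2)[of "opp (A k p)" k] p by simp
  have "q (int N) = q (- int N)"
  proof (rule ccontr)
    assume ne: "q (int N) \<noteq> q (- int N)"
    obtain K where K: "\<And>n. card {x. fst x < 1 \<and> broken (f ^^ n) x} \<le> K * l n" using breaks by blast
    \<comment> \<open>For \<open>j\<close> between \<open>N\<close> and \<open>n - N\<close>, the
      \<open>n\<close>-th power carries \<open>A (- j) p\<close> from the range where the past
      partner is in force to the range where the future partner is. If these differ, the power is
      broken at that base point.\<close>
    have lin: "int n - 2 * int N < 3 * int (K * l n)" if n: "n > 2 * N" for n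
    proof -
      let ?B = "{x. fst x < 1 \<and> broken (f ^^ n) x}" and ?J = "{int N..int n - int N}"
      have br: "fst (A (- j) p) \<in> ?B" if j: "j \<in> ?J" for j
      proof -
        have P: "A (- j) p \<in> germs 1" using p by simp
        have f1: "germ_map (f ^^ n) r = A (int n) r" if "r \<in> germs 1" for r using A_germ_map[OF that, of "int n"] by (simp add: f_pow_def)
        have e1: "q (- j) = q (- int N)" using dn[of "nat (j - int N)"] j by simp
        have e2: "q (int n - j) = q (int N)" using up[of "nat (int n - j - int N)"] j by simp
        have "germ_map (f ^^ n) (opp (A (- j) p)) = A (int n) (A (- j) (q (- int N)))"
          using f1[of "opp (A (- j) p)"] P Aq[of "- j"] e1 by simp
        also have "\<dots> = A (int n - j) (q (- int N))" using A_add[OF qGP, of "int n" "-j"] by simp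
        also have "\<dots> \<noteq> A (int n - j) (q (int N))" using A_inj[OF qGP qGP] ne by metis
        also have "A (int n - j) (q (int N)) = opp (A (int n - j) p)" using Aq[of "int n - j"] e2 by simp
        also have "A (int n - j) p = germ_map (f ^^ n) (A (- j) p)" using A_add[OF p, of "int n" "-j"] f1[OF P] by simp
        finally have "broken (f ^^ n) (fst (A (- j) p))"
          using not_broken_opp[OF _ P, of 1 "f ^^ n"] pw_iso_pw_affine(1)[OF funpow_Suc_pw_iso[OF fg]] by blast
        then show ?thesis using P by (auto simp: germs_def)
      qed
      have fin: "finite ?B" using finite_broken pw_iso_pw_affine(1)[OF funpow_Suc_pw_iso[OF fg]] by blast
      \<comment> \<open>The points of the orbit are distinct up to scale, so a base point is counted
        at most once for each value of the sign. This is the origin of the factor 3.\<close>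
      have "card ?J \<le> card (?B \<times> {-1, 0, 1::real})"
      proof (rule card_inj_on_le[of "\<lambda>j. (fst (A (- j) p), sgn (snd (A (- j) p)))"])
        have "inj ((\<lambda>k. (fst (A k p), sgn (snd (A k p)))) \<circ> uminus)"
          by (rule inj_compose[OF aperiodic_inj[OF p ap]]) (auto intro: injI)
        then show "inj_on (\<lambda>j. (fst (A (- j) p), sgn (snd (A (- j) p)))) ?J"
          by (auto simp: o_def intro: inj_on_subset)
        show "(\<lambda>j. (fst (A (- j) p), sgn (snd (A (- j) p)))) ` ?J \<subseteq> ?B \<times> {-1, 0, 1}"
          using br sgn_values by blast
      qed (use fin in simp)
      also have "\<dots> \<le> K * l n * 3" using K[of n] by (simp add: card_cartesian_product)
      finally have "int (card ?J) \<le> int (K * l n * 3)" by (rule of_nat_mono)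
      moreover have "int (card ?J) = int n - 2 * int N + 1" using n by simp
      ultimately show ?thesis by simp
    qed
    \<comment> \<open>Sublinearity of \<open>l\<close> beats the constant \<open>2 * N\<close> and
      the factor \<open>3 * K\<close> for large \<open>n\<close>, against the linear lower bound
      just obtained.\<close>
    have "(\<lambda>n. 3 * real K * (real (l n) / real n) + 2 * real N / real n) \<longlonglongrightarrow> 3 * real K * 0 + 0"
      by (intro tendsto_intros sub lim_const_over_n)
    then have "eventually (\<lambda>n. 3 * real K * (real (l n) / real n) + 2 * real N / real n < 1) sequentially"
      by (rule order_tendstoD(2)) simp
    then obtain n where n: "n > 2 * N" "3 * real K * (real (l n) / real n) + 2 * real N / real n < 1"
      using eventually_happens'[OF _ eventually_conj[OF _ eventually_gt_at_top[of "2 * N"]]]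
      by (metis (mono_tags, lifting) sequentially_bot)
    then have "3 * real K * real (l n) + 2 * real N < real n" by (simp add: field_simps)
    moreover have "real_of_int (int n - 2 * int N) < real_of_int (3 * int (K * l n))"
      using lin[OF n(1)] of_int_less_iff by blast
    ultimately show False by simp
  qed
  then have "A k (q (int N)) = opp (A k p)" if "\<bar>k\<bar> \<ge> int N" for k
    using Aq[of k] up[of "nat (\<bar>k\<bar> - int N)"] dn[of "nat (\<bar>k\<bar> - int N)"] that
    by (cases "k \<ge> 0") auto
  then have "G p (q (int N))" using G_I p qGP by blast
  then show ?thesis unfolding q_def by blast
qed

lemma periodic_orbit_finite:
  assumes "p \<in> germs 1" "periodic p"
  shows "finite (range (\<lambda>k. fst (A k p)))"
proof -
  obtain k c where kc: "k \<noteq> 0" "c > 0" "A k p = sc c p" using assms(2) by (auto simp: periodic_def)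
  have 1: "fst (A (j + k) p) = fst (A j p)" for j
    using A_add[OF assms(1), of j k] A_sc[OF assms(1) kc(2)] kc(3) by simp
  have 2: "fst (A (j + int m * k) p) = fst (A j p)" for j m
  proof (induction m)
    case (Suc m)
    have "fst (A (j + int (Suc m) * k) p) = fst (A ((j + int m * k) + k) p)" by (simp add: algebra_simps)
    then show ?case using 1 Suc by simp
  qed simp
  have 3: "fst (A (j + m * k) p) = fst (A j p)" for j m
  proof (cases "m \<ge> 0")
    case True then show ?thesis using 2[of j "nat m"] by simp
  next
    case False then show ?thesis using 2[of "j + m * k" "nat (-m)"] by simp
  qed
  have "fst (A j p) \<in> (\<lambda>k. fst (A k p)) ` {-\<bar>k\<bar>..\<bar>k\<bar>}" for j
  proof -
    have "fst (A j p) = fst (A (j mod k) p)" using 3[of "j mod k" "j div k"] by simp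
    moreover have "j mod k \<in> {-\<bar>k\<bar>..\<bar>k\<bar>}" using abs_mod_less[OF kc(1), of j] by auto
    ultimately show ?thesis by blast
  qed
  then have "range (\<lambda>k. fst (A k p)) \<subseteq> (\<lambda>k. fst (A k p)) ` {-\<bar>k\<bar>..\<bar>k\<bar>}" by blast
  then show ?thesis using finite_subset by blast
qed

text \<open>An orbit that meets no break is glued in the standard way, so deviations lie on the
  orbits of the finitely many broken germs. Such an orbit has finitely many base points if it is
  periodic. Otherwise its partner is the standard one for all large
  \<open>\<bar>k\<bar>\<close>.\<close>

lemma G_cofinite: "finite {x. fst x < 1 \<and> \<not> G (x, 1) (x, -1)}"
proof -
  let ?E = "{(b, v). b \<in> Br \<and> (v = 1 \<or> v = (-1::real))}"
  have finE: "finite ?E"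
    by (rule finite_subset[of _ "Br \<times> {1, -1}"]) (use finite_broken[OF PAf] in auto)
  define X where "X p = {x. \<exists>k. x = fst (A k p) \<and> \<not> G (A k p) (opp (A k p))}" for p
  have EGP: "p \<in> germs 1" if "p \<in> ?E" for p using that by auto
  have finX: "finite (X p)" if p: "p \<in> germs 1" for p
  proof (cases "periodic p")
    case True
    show ?thesis by (rule finite_subset[OF _ periodic_orbit_finite[OF p True]]) (auto simp: X_def)
  next
    case False
    then obtain q where q: "G p q" using aperiodic_partner[OF p] by blast
    then obtain N where N: "\<forall>k. \<bar>k\<bar> \<ge> N \<longrightarrow> A k q = opp (A k p)" using G_ev by blast
    have "X p \<subseteq> (\<lambda>k. fst (A k p)) ` {-N..N}"
    proof
      fix x assume "x \<in> X p"
      then obtain k where k: "x = fst (A k p)" "\<not> G (A k p) (opp (A k p))" by (auto simp: X_def)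
      then have "\<not> \<bar>k\<bar> \<ge> N" using G_A[OF q, of k] N by metis
      then show "x \<in> (\<lambda>k. fst (A k p)) ` {-N..N}" using k(1) by force
    qed
    then show ?thesis using finite_subset by blast
  qed
  have "{x. fst x < 1 \<and> \<not> G (x, 1) (x, -1)} \<subseteq> (\<Union>p\<in>?E. X p)"
  proof
    fix x assume "x \<in> {x. fst x < 1 \<and> \<not> G (x, 1) (x, -1)}"
    then have x: "fst x < 1" "\<not> G (x, 1) (x, -1)" by auto
    let ?p = "(x, 1::real)"
    have p: "?p \<in> germs 1" using x by simp
    have "\<exists>k. fst (A k ?p) \<in> Br"
    proof (rule ccontr)
      assume no: "\<not> ?thesis"
      have "A (- k) (opp (A k ?p)) = opp ?p" for k
      proof (induction k rule: int_induct[where k = 0])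
        case (step1 i) then show ?case using A_opp_step[OF p, of i] no by metis
      next
        case (step2 i) then show ?case using A_opp_step[OF p, of "i - 1"] no by (metis diff_add_cancel)
      qed simp
      then have "A k (opp ?p) = opp (A k ?p)" for k
        using A_minus(2)[of "opp (A k ?p)" k] p by (metis A_germs opp_germs)
      then have "G ?p (opp ?p)" using G_I[of ?p "opp ?p" 0] p by simp
      then show False using x(2) by simp
    qed
    then obtain k where k: "fst (A k ?p) \<in> Br" by blast
    obtain b v where bv: "A k ?p = (b, v)" by (cases "A k ?p")
    have v: "v \<noteq> 0" using A_germs[OF p, of k] bv by simp
    define r where "r = (b, sgn v)"
    have r: "r \<in> ?E" using v k by (auto simp: r_def bv sgn_real_def)
    have rG: "r \<in> germs 1" using EGP[OF r] .
    have "A k ?p = sc \<bar>v\<bar> r" by (simp add: bv r_def abs_mult_sgn)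
    then have "A (- k) (A k ?p) = sc \<bar>v\<bar> (A (- k) r)" using A_sc[OF rG] v by simp
    then have e: "?p = sc \<bar>v\<bar> (A (- k) r)" using A_minus[OF p] by simp
    have "\<not> G (A (- k) r) (opp (A (- k) r))"
    proof
      assume "G (A (- k) r) (opp (A (- k) r))"
      then have "G ?p (opp ?p)" using G_sc[of _ _ "\<bar>v\<bar>"] v e by (metis sc_opp zero_less_abs_iff)
      then show False using x(2) by simp
    qed
    moreover have "x = fst (A (- k) r)" using e by (metis fst_conv fst_sc)
    ultimately have "x \<in> X r" unfolding X_def by blast
    then show "x \<in> (\<Union>p\<in>?E. X p)" using r by blast
  qed
  moreover have "finite (\<Union>p\<in>?E. X p)" using finE finX EGP by blast
  ultimately show ?thesis using finite_subset by blast
qed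

text \<open>Some multiple of the period lies beyond all exceptional times, and there the defining
  relation can be read at the germs themselves.\<close>

lemma periodic_G:
  assumes "G p q" "k \<noteq> 0" "A k p = p" "A k q = q" shows "q = opp p"
proof -
  have pq: "p \<in> germs 1" "q \<in> germs 1" using G_germs[OF assms(1)] .
  obtain N where N: "\<forall>k. \<bar>k\<bar> \<ge> N \<longrightarrow> A k q = opp (A k p)" using G_ev[OF assms(1)] by blast
  have it: "A (int m * k) r = r" if "r \<in> germs 1" "A k r = r" for r m
  proof (induction m)
    case (Suc m)
    have "A (int (Suc m) * k) r = A (int m * k + k) r" by (simp add: algebra_simps)
    then show ?case using A_add[OF that(1), of "int m * k" k] Suc that(2) by simp
  qed simp
  have "\<bar>int (nat \<bar>N\<bar>) * k\<bar> \<ge> N"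
  proof -
    have "\<bar>N\<bar> * 1 \<le> \<bar>N\<bar> * \<bar>k\<bar>" using assms(2) by (intro mult_left_mono) auto
    then show ?thesis by (simp add: abs_mult)
  qed
  then have "A (int (nat \<bar>N\<bar>) * k) q = opp (A (int (nat \<bar>N\<bar>) * k) p)" using N by blast
  then show ?thesis using it[OF pq(1) assms(3), of "nat \<bar>N\<bar>"] it[OF pq(2) assms(4), of "nat \<bar>N\<bar>"] by metis
qed

text \<open>A linear rate \<open>a\<close> along the multiples of \<open>K\<close> contradicts the
  bound by \<open>l\<close>, which is sublinear along this subsequence too. The error
  \<open>C\<close> leaves room for a change of coordinates.\<close>

lemma slope_growth:
  fixes u :: "real \<Rightarrow> real"
  assumes u: "\<And>a b. u (a + b) = u a + u b" and K: "K > 0"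
    and p: "p \<in> germs 1" and bd: "\<And>n. \<bar>u (ln \<bar>snd (A (int (K * n)) p) / snd p\<bar>) - real n * a\<bar> \<le> C"
  shows "a = 0"
proof -
  obtain M where M: "\<And>n p. p \<in> germs 1 \<Longrightarrow> \<bar>u (ln \<bar>snd (germ_map (f ^^ n) p) / snd p\<bar>)\<bar> \<le> M * real (l n)"
    using slopes[OF u] by blast
  have bd2: "real n * \<bar>a\<bar> \<le> M * real (l (K * n)) + C" for n
  proof -
    have "A (int (K * n)) p = germ_map (f ^^ (K * n)) p" using A_germ_map[OF p, of "int (K * n)"] unfolding f_pow_def nat_int by simp
    then have "\<bar>real n * a\<bar> \<le> M * real (l (K * n)) + C" using bd[of n] M[OF p, of "K * n"] by simp
    then show ?thesis by (simp add: abs_mult)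
  qed
  have KK: "filterlim (\<lambda>n. K * n) at_top sequentially" using K
    by (intro filterlim_subseq) (simp add: strict_mono_def)
  have s: "(\<lambda>n. real (l (K * n)) / real (K * n)) \<longlonglongrightarrow> 0"
    using filterlim_compose[OF sub KK] .
  have "(\<lambda>n. M * (real K * (real (l (K * n)) / real (K * n))) + C / real n) \<longlonglongrightarrow> M * (real K * 0) + 0"
    by (intro tendsto_intros s lim_const_over_n)
  moreover have "eventually (\<lambda>n. \<bar>a\<bar> \<le> M * (real K * (real (l (K * n)) / real (K * n))) + C / real n) sequentially"
    using eventually_gt_at_top[of 0]
  proof eventually_elim
    case (elim n)
    then show ?case using bd2[of n] K by (simp add: field_simps)
  qed
  ultimately have "\<bar>a\<bar> \<le> M * (real K * 0) + 0"
    by (intro tendsto_lowerbound[where F = sequentially]) auto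
  then show ?thesis by simp
qed

end

section \<open>Cutting and merging components\<close>

lemma pw_iso_fun:
  assumes "pw_affine n m f" "pw_affine m n g" "\<And>x. fst x < n \<Longrightarrow> g (f x) = x" "\<And>x. fst x < m \<Longrightarrow> f (g x) = x"
  shows "pw_iso n m f g"
  unfolding pw_iso_def germ_rel_def using assms by (auto simp: germs_def ev_def)

lemma fr_pos: "z \<noteq> to_rz 0 \<Longrightarrow> 0 < fr z"
  using fr_ge_0[of z] fr_eq_0_iff[of z] by (simp only: less_le) auto

lift_definition rz_neg :: "rz \<Rightarrow> rz" is uminus
  by (metis Ints_minus minus_diff_minus)

lemma rz_neg_to_rz: "rz_neg (to_rz x) = to_rz (- x)"
  by (rule rz_neg.abs_eq)

lemma rz_neg_rotation: "rz_neg (rotation t z) = rotation (- t) (rz_neg z)"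
  by (rule to_rz_cases[of z]) (simp add: rotation_to_rz rz_neg_to_rz)

lemma rz_neg_neg [simp]: "rz_neg (rz_neg z) = z"
  by (rule to_rz_cases[of z]) (simp add: rz_neg_to_rz)

lemma rz_neg_0 [simp]: "rz_neg (to_rz 0) = to_rz 0"
  by (simp add: rz_neg_to_rz)

lemma rz_neg_eq_0_iff [simp]: "rz_neg z = to_rz 0 \<longleftrightarrow> z = to_rz 0"
  by (metis rz_neg_neg rz_neg_0)

definition permute_flip :: "(nat \<Rightarrow> nat) \<Rightarrow> (nat \<Rightarrow> bool) \<Rightarrow> fp \<Rightarrow> fp" where
  "permute_flip \<pi> e x = (\<pi> (fst x), if e (fst x) then rz_neg (snd x) else snd x)"

lemma germ_rel_permute_flip:
  "germ_rel (permute_flip \<pi> e) ((k, z), v) ((\<pi> k, if e k then rz_neg z else z), if e k then - v else v)"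
  unfolding germ_rel_def by (rule ev_rightI[of 1]) (auto simp: permute_flip_def ev_def fl_def rz_neg_rotation)

lemma germ_map_permute_flip: "germ_map (permute_flip \<pi> e) ((k, z), v) = ((\<pi> k, if e k then rz_neg z else z), if e k then - v else v)"
  by (rule germ_map_eq[OF germ_rel_permute_flip])

text \<open>As \<open>\<pi>\<close> is an involution, the inverse permutes by \<open>\<pi>\<close>
  again, but it must read the reversal flag at the index to which it returns.\<close>

lemma pw_iso_permute_flip:
  assumes "\<And>k. \<pi> (\<pi> k) = k" "\<And>k. k < n \<Longrightarrow> \<pi> k < n"
  shows "pw_iso n n (permute_flip \<pi> e) (permute_flip \<pi> (e \<circ> \<pi>))"
proof (rule pw_iso_fun)
  have "pw_affine n n (permute_flip \<pi> e)" for e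
    unfolding pw_affine_def
  proof
    fix p :: germ assume p: "p \<in> germs n"
    obtain k z v where [simp]: "p = ((k, z), v)" by (metis surj_pair)
    show "\<exists>q\<in>germs n. germ_rel (permute_flip \<pi> e) p q"
      by (rule bexI[of _ "((\<pi> k, if e k then rz_neg z else z), if e k then - v else v)"])
        (use p assms(2) germ_rel_permute_flip in auto)
  qed
  then show "pw_affine n n (permute_flip \<pi> e)" "pw_affine n n (permute_flip \<pi> (e \<circ> \<pi>))" by auto
qed (auto simp: permute_flip_def assms)

text \<open>\<open>merge_comps i m d\<close> merges the components \<open>i\<close> and \<open>m\<close> into the component \<open>i\<close>, in which they
  occupy the intervals below and above \<open>d\<close>; \<open>cut_comp i m d\<close> cuts the component \<open>i\<close> at \<open>0\<close> and \<open>d\<close>.\<close>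

definition merge_comps :: "nat \<Rightarrow> nat \<Rightarrow> real \<Rightarrow> fp \<Rightarrow> fp" where
  "merge_comps i m d x = (if fst x = i then (i, to_rz (d * fr (snd x))) else
     if fst x = m then (i, to_rz (d + (1 - d) * fr (snd x))) else x)"

definition cut_comp :: "nat \<Rightarrow> nat \<Rightarrow> real \<Rightarrow> fp \<Rightarrow> fp" where
  "cut_comp i m d x = (if fst x = i then
     (if fr (snd x) < d then (i, to_rz (fr (snd x) / d)) else (m, to_rz ((fr (snd x) - d) / (1 - d)))) else x)"

text \<open>An affine formula in the coordinate \<open>fr\<close> extends to the ends through
  \<open>pos\<close>, the limit of \<open>fr\<close> along the germ, which is 1 for the backward
  germ at 0.\<close>

lemma germ_rel_affine:
  assumes "eventually (\<lambda>t. f (ev p t) = (j, to_rz (\<alpha> * fr (snd (ev p t)) + \<beta>))) (at_right 0)" "snd p \<noteq> 0"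
  shows "germ_rel f p ((j, to_rz (\<alpha> * pos p + \<beta>)), \<alpha> * snd p)"
  unfolding germ_rel_def
  using assms(1) fr_ev[OF assms(2), of "fst p"]
proof (rule eventually_elim2)
  fix t assume a: "f (ev p t) = (j, to_rz (\<alpha> * fr (snd (ev p t)) + \<beta>))"
    and b: "fr (snd (fl (snd p * t) (fst p))) = pos (fst p, snd p) + snd p * t \<and>
      0 < pos (fst p, snd p) + snd p * t \<and> pos (fst p, snd p) + snd p * t < 1"
  from b have "fr (snd (ev p t)) = pos p + snd p * t" by (simp add: ev_def)
  then show "f (ev p t) = ev ((j, to_rz (\<alpha> * pos p + \<beta>)), \<alpha> * snd p) t"
    unfolding a by (simp add: ev_def fl_pair rotation_to_rz algebra_simps)
qed

lemma germ_map_merge_comps: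
  assumes "v \<noteq> 0"
  shows "germ_rel (merge_comps i m d) ((k, z), v) (if k = i then ((i, to_rz (d * pos ((k, z), v))), d * v) else
    if k = m then ((i, to_rz (d + (1 - d) * pos ((k, z), v))), (1 - d) * v) else ((k, z), v))"
proof -
  consider "k = i" | "k \<noteq> i" "k = m" | "k \<noteq> i" "k \<noteq> m" by blast
  then show ?thesis
  proof cases
    case 1
    show ?thesis using germ_rel_affine[of "merge_comps i m d" "((k, z), v)" i d 0] assms 1
      by (simp add: merge_comps_def ev_def)
  next
    case 2
    show ?thesis using germ_rel_affine[of "merge_comps i m d" "((k, z), v)" i "1 - d" d] assms 2
      by (simp add: merge_comps_def ev_def add.commute)
  next
    case 3
    then show ?thesis by (simp add: germ_rel_def merge_comps_def ev_def)
  qed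
qed

lemma germ_map_cut_comp_other: "k \<noteq> i \<Longrightarrow> germ_rel (cut_comp i m d) ((k, z), v) ((k, z), v)"
  by (simp add: germ_rel_def cut_comp_def ev_def)

text \<open>At the cut \<open>d\<close> the two directions part: the backward germ belongs to the
  left piece and the forward germ to the right one.\<close>

lemma germ_map_cut_comp_left:
  assumes "v \<noteq> 0" "pos ((i, z), v) < d \<or> pos ((i, z), v) = d \<and> v < 0"
  shows "germ_rel (cut_comp i m d) ((i, z), v) ((i, to_rz (pos ((i, z), v) / d)), v / d)"
proof -
  let ?L = "pos ((i, z), v)"
  have "eventually (\<lambda>t. ?L + v * t < d) (at_right 0)"
  proof (cases "v < 0")
    case True
    show ?thesis
    proof (rule ev_rightI[of 1])
      fix t :: real assume "0 < t"
      then have "v * t < 0" using True by (simp add: mult_neg_pos)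
      then show "?L + v * t < d" using assms(2) by auto
    qed simp
  next
    case False
    then have "v > 0" "?L < d" using assms by auto
    then show ?thesis by (intro ev_rightI[of "(d - ?L) / v"]) (auto simp: pos_less_divide_eq mult.commute)
  qed
  then have "eventually (\<lambda>t. cut_comp i m d (ev ((i, z), v) t) = (i, to_rz (1 / d * fr (snd (ev ((i, z), v) t)) + 0))) (at_right 0)"
    using fr_ev[OF assms(1), of "(i, z)"] by (rule eventually_elim2) (simp add: cut_comp_def ev_def)
  from germ_rel_affine[OF this] assms(1) show ?thesis by simp
qed

lemma germ_map_cut_comp_right:
  assumes "v \<noteq> 0" "pos ((i, z), v) > d \<or> pos ((i, z), v) = d \<and> v > 0"
  shows "germ_rel (cut_comp i m d) ((i, z), v) ((m, to_rz ((pos ((i, z), v) - d) / (1 - d))), v / (1 - d))"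
proof -
  let ?L = "pos ((i, z), v)"
  have "eventually (\<lambda>t. ?L + v * t \<ge> d) (at_right 0)"
  proof (cases "v > 0")
    case True
    then show ?thesis using assms(2)
      by (intro ev_rightI[of 1]) (auto intro: add_increasing2)
  next
    case False
    then have v: "v < 0" "?L > d" using assms by auto
    show ?thesis
    proof (intro ev_rightI[of "(?L - d) / - v"])
      show "0 < (?L - d) / - v" using v by (simp add: divide_pos_neg)
      fix t assume t: "0 < t" "t < (?L - d) / - v"
      have "t * - v < ?L - d" using t(2) v(1) by (subst pos_less_divide_eq[symmetric]) auto
      then show "d \<le> ?L + v * t" by (simp add: mult.commute)
    qed
  qed
  then have "eventually (\<lambda>t. cut_comp i m d (ev ((i, z), v) t) =
      (m, to_rz (1 / (1 - d) * fr (snd (ev ((i, z), v) t)) + - d / (1 - d)))) (at_right 0)"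
    using fr_ev[OF assms(1), of "(i, z)"]
    by (rule eventually_elim2) (simp add: cut_comp_def ev_def diff_divide_distrib)
  from germ_rel_affine[OF this] assms(1) show ?thesis by (simp add: diff_divide_distrib)
qed

lemma affine_below: "0 < d \<Longrightarrow> 0 \<le> r \<Longrightarrow> r < 1 \<Longrightarrow> d < 1 \<Longrightarrow> 0 \<le> d * r \<and> d * r < d" for d r :: real
  using mult_strict_left_mono[of r 1 d] by simp

lemma affine_above: "0 < d \<Longrightarrow> 0 \<le> r \<Longrightarrow> r < 1 \<Longrightarrow> d < 1 \<Longrightarrow> d \<le> d + (1 - d) * r \<and> d + (1 - d) * r < 1" for d r :: real
proof -
  assume a: "0 < d" "0 \<le> r" "r < 1" "d < 1"
  define x where "x = (1 - d) * r"
  have "(1 - d) * r < (1 - d) * 1" by (rule mult_strict_left_mono) (use a in auto)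
  then have "x < 1 - d" unfolding x_def mult_1_right .
  moreover have "0 \<le> x" unfolding x_def by (rule mult_nonneg_nonneg) (use a in auto)
  ultimately show ?thesis unfolding x_def[symmetric] by simp
qed

lemma cut_comp_merge_comps:
  assumes d: "0 < d" "d < 1" and i: "i \<noteq> m" shows "cut_comp i m d (merge_comps i m d x) = x"
proof -
  obtain k z where x: "x = (k, z)" by (cases x)
  have r: "0 \<le> fr z" "fr z < 1" by auto
  define r1 r2 where r12: "r1 = d * fr z" "r2 = d + (1 - d) * fr z"
  have A: "0 \<le> r1" "r1 < d" "r1 / d = fr z" using affine_below[OF d(1) r d(2)] d by (auto simp: r12)
  have B: "d \<le> r2" "r2 < 1" "(r2 - d) / (1 - d) = fr z" using affine_above[OF d(1) r d(2)] d by (auto simp: r12)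
  have "merge_comps i m d x = (if k = i then (i, to_rz r1) else if k = m then (i, to_rz r2) else x)"
    by (simp add: merge_comps_def x r12)
  moreover have "fr (to_rz r1) = r1" "fr (to_rz r2) = r2" using A B d by (auto intro!: fr_to_rz_id)
  ultimately show ?thesis using A B d i by (auto simp: cut_comp_def x)
qed

lemma pw_iso_merge_comps:
  assumes i: "i < m" and d: "0 < d" "d < 1"
  shows "pw_iso (Suc m) m (merge_comps i m d) (cut_comp i m d)"
proof (rule pw_iso_fun)
  show "pw_affine (Suc m) m (merge_comps i m d)"
    unfolding pw_affine_def
  proof
    fix p :: germ assume p: "p \<in> germs (Suc m)"
    obtain k z v where p': "p = ((k, z), v)" by (metis surj_pair)
    have v: "v \<noteq> 0" "k < Suc m" using p p' by auto
    show "\<exists>q\<in>germs m. germ_rel (merge_comps i m d) p q"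
      unfolding p' by (rule bexI, rule germ_map_merge_comps[OF v(1)]) (use v i d in auto)
  qed
  show "pw_affine m (Suc m) (cut_comp i m d)"
    unfolding pw_affine_def
  proof
    fix p :: germ assume p: "p \<in> germs m"
    obtain k z v where p': "p = ((k, z), v)" by (metis surj_pair)
    have v: "v \<noteq> 0" "k < m" using p p' by auto
    consider "k \<noteq> i" | "k = i" "pos ((i, z), v) < d \<or> pos ((i, z), v) = d \<and> v < 0"
      | "k = i" "pos ((i, z), v) > d \<or> pos ((i, z), v) = d \<and> v > 0" using v by fastforce
    then show "\<exists>q\<in>germs (Suc m). germ_rel (cut_comp i m d) p q"
    proof cases
      case 1
      show ?thesis unfolding p' by (rule bexI, rule germ_map_cut_comp_other[OF 1]) (use v in auto)
    next
      case 2
      show ?thesis unfolding p' 2(1) by (rule bexI, rule germ_map_cut_comp_left[OF v(1) 2(2)]) (use v i d in auto)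
    next
      case 3
      show ?thesis unfolding p' 3(1) by (rule bexI, rule germ_map_cut_comp_right[OF v(1) 3(2)]) (use v i d in auto)
    qed
  qed
  fix x :: fp
  obtain k z where x: "x = (k, z)" by (cases x)
  have r: "0 \<le> fr z" "fr z < 1" by auto
  show "cut_comp i m d (merge_comps i m d x) = x" using cut_comp_merge_comps d i by simp
  assume "fst x < m"
  then have k: "k < m" by (simp add: x)
  show "merge_comps i m d (cut_comp i m d x) = x"
  proof (cases "k = i")
    case True
    show ?thesis
    proof (cases "fr z < d")
      case l: True
      have "fr (to_rz (fr z / d)) = fr z / d" using l d by (intro fr_to_rz_id) auto
      then show ?thesis using True l d by (simp add: merge_comps_def cut_comp_def x)
    next
      case False
      have "fr (to_rz ((fr z - d) / (1 - d))) = (fr z - d) / (1 - d)"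
        using False d by (intro fr_to_rz_id) auto
      then show ?thesis using True False d i by (simp add: merge_comps_def cut_comp_def x)
    qed
  next
    case False
    then show ?thesis using k by (simp add: merge_comps_def cut_comp_def x)
  qed
qed

lemma inner_to_rz: "0 < r \<Longrightarrow> r < 1 \<Longrightarrow> to_rz r \<noteq> to_rz 0"
  by (metis fr_eq_0_iff fr_to_rz_id less_irrefl less_le)

text \<open>One factor \<open>a\<close> serves both directions, so no inner point is broken. The
  seam \<open>d\<close> is hit by no inner point of the merged pieces, which makes a cut remove
  exactly that point from the list of bad ones.\<close>

lemma merge_comps_inner:
  assumes "0 < d" "d < 1" "z \<noteq> to_rz 0" "i < m"
  shows "snd (merge_comps i m d (k, z)) \<noteq> to_rz 0" "merge_comps i m d (k, z) \<noteq> (i, to_rz d) \<or> k \<noteq> i \<and> k \<noteq> m"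
    "\<exists>a>0. \<forall>v. v \<noteq> 0 \<longrightarrow> germ_rel (merge_comps i m d) ((k, z), v) (merge_comps i m d (k, z), a * v)"
proof -
  have z: "0 < fr z" "fr z < 1" using assms(3) fr_pos by auto
  have p: "pos ((k, z), v) = fr z" for v using pos_inner[of "((k, z), v)"] assms(3) by simp
  define r1 r2 where r12: "r1 = d * fr z" "r2 = d + (1 - d) * fr z"
  have A: "0 < r1" "r1 < d" using affine_below[OF assms(1) less_imp_le[OF z(1)] z(2) assms(2)] z assms(1) by (auto simp: r12 mult_pos_pos)
  have "0 < (1 - d) * fr z" using z assms(2) by (intro mult_pos_pos) auto
  then have B: "d < r2" "r2 < 1" using affine_above[OF assms(1) less_imp_le[OF z(1)] z(2) assms(2)] unfolding r12 by linarith+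
  have M: "merge_comps i m d (k, z) = (if k = i then (i, to_rz r1) else if k = m then (i, to_rz r2) else (k, z))"
    by (simp add: merge_comps_def r12)
  show "snd (merge_comps i m d (k, z)) \<noteq> to_rz 0"
    using inner_to_rz[of r1] inner_to_rz[of r2] A B assms by (simp add: M)
  have inj: "r = s" if "to_rz r = to_rz s" "0 \<le> r" "r < 1" "0 \<le> s" "s < 1" for r s
    using that by (metis fr_to_rz_id)
  show "merge_comps i m d (k, z) \<noteq> (i, to_rz d) \<or> k \<noteq> i \<and> k \<noteq> m"
    using A B assms inj[of r1 d] inj[of r2 d] by (auto simp: M)
  show "\<exists>a>0. \<forall>v. v \<noteq> 0 \<longrightarrow> germ_rel (merge_comps i m d) ((k, z), v) (merge_comps i m d (k, z), a * v)"
  proof (intro exI[of _ "if k = i then d else if k = m then 1 - d else 1"] conjI allI impI)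
    fix v :: real assume "v \<noteq> 0"
    from germ_map_merge_comps[OF this, of i m d k z, unfolded p] show "germ_rel (merge_comps i m d) ((k, z), v) (merge_comps i m d (k, z), (if k = i then d else if k = m then 1 - d else 1) * v)"
      by (auto simp: p merge_comps_def split: if_splits)
  qed (use assms in auto)
qed

context sublinear
begin

text \<open>Here \<open>\<zeta>\<close> identifies \<open>n\<close> circles, cut open at 0, with the given circle; \<open>H \<zeta>\<close> is
  the invariant gluing in these coordinates.\<close>

definition H :: "(fp \<Rightarrow> fp) \<Rightarrow> germ \<Rightarrow> germ \<Rightarrow> bool" where
  "H \<zeta> p q \<longleftrightarrow> G (germ_map \<zeta> p) (germ_map \<zeta> q)"

text \<open>All deviation of the invariant gluing from the standard one is pushed to the ends of the
  components. Nothing is said about the germs at 0.\<close>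

definition Good :: "nat \<Rightarrow> (fp \<Rightarrow> fp) \<Rightarrow> (fp \<Rightarrow> fp) \<Rightarrow> bool" where
  "Good n \<zeta> \<psi> \<longleftrightarrow> pw_iso n 1 \<zeta> \<psi> \<and> (\<forall>x. fst x < n \<and> snd x \<noteq> to_rz 0 \<longrightarrow> H \<zeta> (x, 1) (x, -1))"

lemma H_sc:
  assumes "pw_affine n 1 \<zeta>" "p \<in> germs n" "q \<in> germs n" "H \<zeta> p q" "c > 0" shows "H \<zeta> (sc c p) (sc c q)"
  using assms G_sc germ_map_sc[OF assms(1)] unfolding H_def by simp

lemma H_sym: "H \<zeta> p q \<Longrightarrow> H \<zeta> q p"
  unfolding H_def by (rule G_sym)

lemma H_all:
  assumes "pw_affine n 1 \<zeta>" "fst x < n" "H \<zeta> (x, 1) (x, -1)" "v \<noteq> 0" shows "H \<zeta> (x, v) (x, -v)"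
proof (cases "v > 0")
  case True
  then show ?thesis using H_sc[OF assms(1) _ _ assms(3), of v] assms(2) by simp
next
  case False
  then show ?thesis using H_sc[OF assms(1) _ _ H_sym[OF assms(3)], of "-v"] assms(2,4) by simp
qed

lemma H_one:
  assumes "pw_affine n 1 \<zeta>" "fst x < n" "H \<zeta> (x, v) (x, -v)" "v \<noteq> 0" shows "H \<zeta> (x, 1) (x, -1)"
proof (cases "v > 0")
  case True
  then show ?thesis using H_sc[OF assms(1) _ _ assms(3), of "1/v"] assms(2) by simp
next
  case False
  then show ?thesis using H_sc[OF assms(1) _ _ H_sym[OF assms(3)], of "-1/v"] assms(2,4) by simp
qed

lemma Good_pw_iso: "Good n \<zeta> \<psi> \<Longrightarrow> pw_iso n 1 \<zeta> \<psi>" by (simp add: Good_def)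

lemma Good_inner:
  assumes "Good n \<zeta> \<psi>" "fst x < n" "snd x \<noteq> to_rz 0" "v \<noteq> 0" shows "H \<zeta> (x, v) (x, -v)"
  using H_all[OF pw_iso_pw_affine(1)[OF Good_pw_iso[OF assms(1)]] assms(2) _ assms(4)] assms unfolding Good_def by blast

definition unglued :: "nat \<Rightarrow> (fp \<Rightarrow> fp) \<Rightarrow> fp set" where
  "unglued n \<zeta> = {x. fst x < n \<and> snd x \<noteq> to_rz 0 \<and> \<not> H \<zeta> (x, 1) (x, -1)}"

text \<open>Induction on the number of inner points that are not glued to themselves. Cutting at one
  of them turns it into ends, creates no new bad inner point, and costs one more component. The
  point 0 counts as cut from the outset.\<close>

lemma exists_Good_aux:
  "pw_iso n 1 \<zeta> \<psi> \<Longrightarrow> finite (unglued n \<zeta>) \<Longrightarrow> card (unglued n \<zeta>) = c \<Longrightarrow> \<exists>n \<zeta> \<psi>. Good n \<zeta> \<psi>"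
proof (induction c arbitrary: n \<zeta> \<psi> rule: less_induct)
  case (less c)
  show ?case
  proof (cases "unglued n \<zeta> = {}")
    case True
    then have "Good n \<zeta> \<psi>" using less.prems(1) by (auto simp: Good_def unglued_def)
    then show ?thesis by blast
  next
    case False
    then obtain i z where iz: "(i, z) \<in> unglued n \<zeta>" by auto
    then have i: "i < n" and z: "z \<noteq> to_rz 0" by (auto simp: unglued_def)
    define d where "d = fr z"
    have d: "0 < d" "d < 1" using z fr_pos by (auto simp: d_def)
    note M = pw_iso_merge_comps[OF i d]
    note P = pw_iso_comp[OF M less.prems(1)]
    let ?unglued = "unglued (Suc n) (\<zeta> \<circ> merge_comps i n d)"
    have inj: "inj_on (merge_comps i n d) ?unglued"
    proof (rule inj_on_inverseI[of _ "cut_comp i n d"])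
      show "cut_comp i n d (merge_comps i n d x) = x" for x using cut_comp_merge_comps[OF d] i by simp
    qed
    have img: "merge_comps i n d ` ?unglued \<subseteq> unglued n \<zeta> - {(i, z)}"
    proof
      fix y assume "y \<in> merge_comps i n d ` ?unglued"
      then obtain x where x: "x \<in> ?unglued" "y = merge_comps i n d x" by blast
      obtain k z' where kz: "x = (k, z')" by (cases x)
      have k: "k < Suc n" and z': "z' \<noteq> to_rz 0" and nH: "\<not> H (\<zeta> \<circ> merge_comps i n d) (x, 1) (x, -1)"
        using x(1) by (auto simp: unglued_def kz)
      obtain a where a: "a > 0" "\<And>v. v \<noteq> 0 \<Longrightarrow> germ_rel (merge_comps i n d) (x, v) (y, a * v)"
        using merge_comps_inner(3)[OF d z' i] x(2) kz by blast
      have germ_map: "germ_map (\<zeta> \<circ> merge_comps i n d) (x, v) = germ_map \<zeta> (y, a * v)" if "v \<noteq> 0" for v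
        using germ_map_comp[OF pw_iso_pw_affine(1)[OF M] pw_iso_pw_affine(1)[OF less.prems(1)], of "(x, v)"] germ_map_eq[OF a(2)[OF that]] k that
        by (simp add: kz)
      have fy: "fst y < n" using i k by (auto simp: x(2) merge_comps_def kz)
      have "\<not> H \<zeta> (y, a) (y, -a)" using nH germ_map[of 1] germ_map[of "-1"] by (simp add: H_def)
      then have "\<not> H \<zeta> (y, 1) (y, -1)" using H_all[OF pw_iso_pw_affine(1)[OF less.prems(1)] fy, of a] a(1) by auto
      moreover have "snd y \<noteq> to_rz 0" using merge_comps_inner(1)[OF d z' i] x(2) kz by simp
      moreover have "y \<noteq> (i, z)"
        using merge_comps_inner(2)[OF d z' i, of k] x(2) kz d_def i nH Good_def
      proof (cases "k = i \<or> k = n")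
        case False
        then have "y = x" by (simp add: x(2) kz merge_comps_def)
        then show ?thesis using False kz by auto
      qed (auto simp: d_def)
      ultimately show "y \<in> unglued n \<zeta> - {(i, z)}" using fy by (simp add: unglued_def)
    qed
    have fin: "finite ?unglued" using img inj less.prems(2) by (meson finite_Diff finite_imageD finite_subset)
    have "card ?unglued = card (merge_comps i n d ` ?unglued)" using card_image[OF inj] by simp
    also have "\<dots> \<le> card (unglued n \<zeta> - {(i, z)})" using img less.prems(2) by (intro card_mono) auto
    also have "\<dots> < c" using iz less.prems(2,3) by (metis card_Diff1_less)
    finally show ?thesis using less.IH[OF _ P fin refl] by blast
  qed
qed

lemma exists_Good: "\<exists>n \<zeta> \<psi>. Good n \<zeta> \<psi>"
proof (rule exists_Good_aux[OF pw_iso_id _ refl])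
  show "finite (unglued 1 id)" by (rule finite_subset[OF _ G_cofinite]) (auto simp: unglued_def H_def)
qed

text \<open>Ends of different components that are glued to each other become an ordinary inner point
  after the two components are placed side by side, with lengths adjusted to the speeds of the
  gluing.\<close>

lemma merge_Good:
  assumes good: "Good (Suc m) \<zeta> \<psi>" and ij: "i < Suc m" "j < Suc m" "i \<noteq> j"
    and ab: "a \<noteq> 0" "b \<noteq> 0" and glue: "H \<zeta> ((i, to_rz 0), a) ((j, to_rz 0), b)"
  shows "\<exists>\<zeta> \<psi>. Good m \<zeta> \<psi>"
proof -
  define \<pi> where "\<pi> = Transposition.transpose j m"
  \<comment> \<open>The glued germ of \<open>i\<close> must become the right end of the left piece,
    hence point backward. That of \<open>j\<close> must become the left end of the right piece,
    hence point forward.\<close>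
  define e where "e k = (if k = i then a > 0 else if k = j then b < 0 else False)" for k
  have \<pi>\<pi>: "\<pi> (\<pi> k) = k" for k by (simp add: \<pi>_def)
  have \<pi>n: "\<pi> k < Suc m" if "k < Suc m" for k using that ij by (auto simp: \<pi>_def Transposition.transpose_def)
  have i': "\<pi> i < m" using ij by (auto simp: \<pi>_def Transposition.transpose_def)
  have \<pi>m: "\<pi> m = j" by (simp add: \<pi>_def)
  \<comment> \<open>Unit velocities at the seam \<open>d\<close> correspond to the speeds
    \<open>1 / d\<close> and \<open>1 / (1 - d)\<close> in the two pieces. Their ratio has to be
    \<open>\<bar>a\<bar>\<close> to \<open>\<bar>b\<bar>\<close>.\<close>
  define d where "d = \<bar>b\<bar> / (\<bar>a\<bar> + \<bar>b\<bar>)"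
  have d: "0 < d" "d < 1" using ab by (auto simp: d_def divide_less_eq_1 add_pos_pos)
  let ?F' = "permute_flip \<pi> (e \<circ> \<pi>)" and ?k = "cut_comp (\<pi> i) m d"
  note PF = pw_iso_sym[OF pw_iso_permute_flip[of \<pi> "Suc m" e, OF \<pi>\<pi> \<pi>n]]
  note PK = pw_iso_sym[OF pw_iso_merge_comps[OF i' d]]
  note P0 = Good_pw_iso[OF good]
  note P1 = pw_iso_comp[OF PK PF]
  note P = pw_iso_comp[OF P1 P0]
  let ?\<zeta> = "\<zeta> \<circ> (?F' \<circ> ?k)"
  have gmk: "germ_map ?\<zeta> p = germ_map \<zeta> ((\<pi> k, if e (\<pi> k) then rz_neg z else z), if e (\<pi> k) then - v else v)"
    if "p \<in> germs m" "germ_rel ?k p ((k, z), v)" for p k z v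
    using germ_map_comp[OF pw_iso_pw_affine(1)[OF P1] pw_iso_pw_affine(1)[OF P0] that(1)] germ_map_comp[OF pw_iso_pw_affine(1)[OF PK] pw_iso_pw_affine(1)[OF PF] that(1)]
      germ_map_eq[OF that(2)] germ_map_permute_flip[of \<pi> "e \<circ> \<pi>" k z v] by simp
  have inner: "H ?\<zeta> (x, 1) (x, -1)"
    if x: "fst x < m" "germ_rel ?k (x, 1) ((k, z), v)" "germ_rel ?k (x, -1) ((k, z), - v)" "z \<noteq> to_rz 0" "k < Suc m" "v \<noteq> 0" for x k z v
  proof -
    have "H \<zeta> ((\<pi> k, if e (\<pi> k) then rz_neg z else z), if e (\<pi> k) then - v else v)
      ((\<pi> k, if e (\<pi> k) then rz_neg z else z), - (if e (\<pi> k) then - v else v))"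
      using x \<pi>n by (intro Good_inner[OF good]) auto
    then show ?thesis unfolding H_def using gmk[OF _ x(2)] gmk[OF _ x(3)] x(1) by (cases "e (\<pi> k)") simp_all
  qed
  have "H ?\<zeta> (x, 1) (x, -1)" if x: "fst x < m" "snd x \<noteq> to_rz 0" for x
  proof -
    obtain k z where kz: "x = (k, z)" by (cases x)
    have p: "pos ((k, z), v) = fr z" for v using pos_inner[of "((k, z), v)"] x(2) by (simp add: kz)
    have z: "0 < fr z" "fr z < 1" using x(2) fr_pos by (auto simp: kz)
    show ?thesis
    proof (cases "k = \<pi> i")
      case False
      show ?thesis using x kz
        by (intro inner[of x k z 1]) (auto intro: germ_map_cut_comp_other[OF False])
    next
      case True
      consider "fr z < d" | "fr z > d" | "fr z = d" by linarith
      then show ?thesis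
      proof cases
        case 1
        show ?thesis
        proof (rule inner[of x "\<pi> i" "to_rz (fr z / d)" "1 / d"])
          show "germ_rel ?k (x, 1) ((\<pi> i, to_rz (fr z / d)), 1 / d)"
            using germ_map_cut_comp_left[of 1 "\<pi> i" z d m] 1 p True by (simp add: kz)
          show "germ_rel ?k (x, - 1) ((\<pi> i, to_rz (fr z / d)), - (1 / d))"
            using germ_map_cut_comp_left[of "-1" "\<pi> i" z d m] 1 p True by (simp add: kz)
          show "to_rz (fr z / d) \<noteq> to_rz 0" using 1 z d by (intro inner_to_rz) auto
        qed (use x i' d in auto)
      next
        case 2
        show ?thesis
        proof (rule inner[of x m "to_rz ((fr z - d) / (1 - d))" "1 / (1 - d)"])
          show "germ_rel ?k (x, 1) ((m, to_rz ((fr z - d) / (1 - d))), 1 / (1 - d))"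
            using germ_map_cut_comp_right[of 1 d "\<pi> i" z m] 2 p True by (simp add: kz)
          show "germ_rel ?k (x, - 1) ((m, to_rz ((fr z - d) / (1 - d))), - (1 / (1 - d)))"
            using germ_map_cut_comp_right[of "-1" d "\<pi> i" z m] 2 p True by (simp add: kz)
          show "to_rz ((fr z - d) / (1 - d)) \<noteq> to_rz 0" using 2 z d by (intro inner_to_rz) auto
        qed (use x i' d in auto)
      next
        case 3
        have k1: "germ_rel ?k (x, 1) ((m, to_rz 0), 1 / (1 - d))"
          using germ_map_cut_comp_right[of 1 d "\<pi> i" z m] 3 p True by (simp add: kz)
        have k2: "germ_rel ?k (x, - 1) ((\<pi> i, to_rz 0), - 1 / d)"
          using germ_map_cut_comp_left[of "-1" "\<pi> i" z d m] 3 p True d by (simp add: kz to_rz_1)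
        define s where "s = \<bar>a\<bar> + \<bar>b\<bar>"
        \<comment> \<open>This scale brings the glued velocities to the size they have at the seam:
          \<open>c * \<bar>a\<bar> = 1 / d\<close> and
          \<open>c * \<bar>b\<bar> = 1 / (1 - d)\<close>.\<close>
        define c where "c = s / (\<bar>a\<bar> * \<bar>b\<bar>)"
        have s: "s > 0" using ab by (simp add: s_def add_pos_pos)
        have c: "c > 0" using ab s by (simp add: c_def)
        have d0: "d = \<bar>b\<bar> / s" by (simp add: d_def s_def)
        have d1: "1 - d = \<bar>a\<bar> / s" using s by (simp add: d0 field_simps) (simp add: s_def)
        have ca: "c * a = sgn a / d" and base_map: "c * b = sgn b / (1 - d)"
          unfolding d1 unfolding d0 c_def real_sgn_eq using ab s by (simp_all add: field_simps)
        have e1: "germ_map ?\<zeta> (x, 1) = germ_map \<zeta> (sc c ((j, to_rz 0), b))"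
          using gmk[OF _ k1] x(1) ij ab unfolding sc_pair base_map \<pi>m by (cases "b < 0") (auto simp: e_def)
        have e2: "germ_map ?\<zeta> (x, -1) = germ_map \<zeta> (sc c ((i, to_rz 0), a))"
          using gmk[OF _ k2] x(1) ij ab unfolding sc_pair ca \<pi>\<pi> by (cases "a > 0") (auto simp: e_def)
        have "H \<zeta> (sc c ((j, to_rz 0), b)) (sc c ((i, to_rz 0), a))"
          using H_sc[OF pw_iso_pw_affine(1)[OF P0] _ _ H_sym[OF glue] c] ij ab by auto
        then show ?thesis unfolding H_def e1 e2 .
      qed
    qed
  qed
  then have "Good m ?\<zeta> (merge_comps (\<pi> i) m d \<circ> permute_flip \<pi> e \<circ> \<psi>)" using P by (auto simp: Good_def comp_assoc)
  then show ?thesis by blast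
qed

text \<open>With the least number of components, \<open>merge_Good\<close> forbids gluing between
  different ones, and \<open>G_not_sc\<close> forbids gluing an end to itself. What remains is an
  end with no partner or the two ends of one component.\<close>

lemma minimal_Good:
  obtains n \<zeta> \<psi> where "Good n \<zeta> \<psi>"
    "\<And>i j a b. i < n \<Longrightarrow> j < n \<Longrightarrow> a \<noteq> 0 \<Longrightarrow> b \<noteq> 0 \<Longrightarrow> H \<zeta> ((i, to_rz 0), a) ((j, to_rz 0), b) \<Longrightarrow> i = j \<and> a * b < 0"
proof -
  define n where "n = (LEAST n. \<exists>\<zeta> \<psi>. Good n \<zeta> \<psi>)"
  obtain \<zeta> \<psi> where good: "Good n \<zeta> \<psi>"
    using LeastI_ex[of "\<lambda>n. \<exists>\<zeta> \<psi>. Good n \<zeta> \<psi>"] exists_Good unfolding n_def by blast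
  show thesis
  proof (rule that[OF good])
    fix i j a b assume h: "i < n" "j < n" "a \<noteq> (0::real)" "b \<noteq> (0::real)" "H \<zeta> ((i, to_rz 0), a) ((j, to_rz 0), b)"
    have ij: "i = j"
    proof (rule ccontr)
      assume ne: "i \<noteq> j"
      obtain m where m: "n = Suc m" using h(1) by (cases n) auto
      have "\<exists>\<zeta> \<psi>. Good m \<zeta> \<psi>" using merge_Good[of m \<zeta> \<psi> i j a b] good h ne m by simp
      then have "n \<le> m" unfolding n_def by (rule Least_le)
      then show False using m by simp
    qed
    have "\<not> a * b > 0"
    proof
      assume p: "a * b > 0"
      then have c: "b / a > 0" by (auto simp: zero_less_mult_iff zero_less_divide_iff)
      have "((j, to_rz 0), b) = sc (b / a) ((i, to_rz 0), a)" using ij h by simp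
      then have "germ_map \<zeta> ((j, to_rz 0), b) = sc (b / a) (germ_map \<zeta> ((i, to_rz 0), a))"
        using germ_map_sc[OF pw_iso_pw_affine(1)[OF Good_pw_iso[OF good]] _ c, of "((i, to_rz 0), a)"] h by simp
      then show False using G_not_sc[of "germ_map \<zeta> ((i, to_rz 0), a)" "b / a"] h(5) c by (simp add: H_def)
    qed
    then show "i = j \<and> a * b < 0" using ij h(3,4) by (simp add: not_less less_le)
  qed
qed

end

section \<open>Affine circles with nontrivial holonomy do not occur\<close>

text \<open>By extending \<open>{a, b}\<close> to a Hamel basis.\<close>

lemma additive_separation:
  fixes a b :: real
  assumes b: "b \<noteq> 0" and u: "\<And>u. (\<And>x y. u (x + y) = u x + u y) \<Longrightarrow> u b = (0::real) \<Longrightarrow> u a = 0"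
  shows "\<exists>(k::nat) (l::int). k > 0 \<and> real k * a = of_int l * b"
proof -
  let ?s = "\<lambda>(q::rat) (x::real). of_rat q * x"
  interpret rv: vector_space ?s
    by unfold_locales (auto simp: algebra_simps of_rat_add of_rat_mult)
  interpret rp: vector_space_pair ?s ?s ..
  have "a \<in> rv.span {b}"
  proof (rule ccontr)
    assume a: "a \<notin> rv.span {b}"
    have ab: "a \<noteq> b" using a rv.span_base[of b "{b}"] by auto
    have "rv.independent {b}" using b by simp
    then have "rv.independent {a, b}" using a by (simp add: rv.independent_insert)
    then obtain g where g: "Vector_Spaces.linear ?s ?s g" "\<forall>x\<in>{a, b}. g x = (if x = a then 1 else 0)"
      using rp.linear_independent_extend[of "{a, b}" "\<lambda>x. if x = a then 1 else 0"] by blast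
    interpret g: Vector_Spaces.linear ?s ?s g by (rule g(1))
    have "g a = 0" by (rule u) (use g(2) ab g.add in auto)
    then show False using g(2) by simp
  qed
  then obtain q where q: "a = of_rat q * b" by (auto simp: rv.span_singleton)
  obtain m l where ml: "q = Fract l m" "m > 0" by (cases q) auto
  have "real (nat m) * a = of_int l * b" using ml q by (simp add: of_rat_rat)
  then show ?thesis using ml(2) by (intro exI[of _ "nat m"] exI[of _ l]) auto
qed

lemma additive_int:
  fixes u :: "real \<Rightarrow> real"
  assumes u: "\<And>x y. u (x + y) = u x + u y"
  shows "u (of_int j * x) = of_int j * u x"
proof -
  have 0: "u 0 = 0" using u[of 0 0] by simp
  have n: "u (real k * x) = real k * u x" for k x
    by (induction k) (simp_all add: 0 u distrib_right)
  have m: "u (- x) = - u x" for x using u[of x "-x"] 0 by simp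
  show ?thesis
  proof (cases "j \<ge> 0")
    case True then show ?thesis using n[of "nat j" x] by simp
  next
    case False then show ?thesis using n[of "nat (-j)" x] m[of "of_int (-j) * x"] by simp
  qed
qed

section \<open>The induced action on the components of a minimal decomposition\<close>

locale minimal = sublinear +
  fixes n \<zeta> \<psi>
  assumes good: "Good n \<zeta> \<psi>"
    and ends: "\<And>i j a b. i < n \<Longrightarrow> j < n \<Longrightarrow> a \<noteq> 0 \<Longrightarrow> b \<noteq> 0 \<Longrightarrow>
      H \<zeta> ((i, to_rz 0), a) ((j, to_rz 0), b) \<Longrightarrow> i = j \<and> a * b < 0"
begin

lemma \<zeta>\<psi>: "pw_iso n 1 \<zeta> \<psi>" using Good_pw_iso[OF good] .
lemma pw_affine\<zeta>: "pw_affine n 1 \<zeta>" and pw_affine\<psi>: "pw_affine 1 n \<psi>" using pw_iso_pw_affine[OF \<zeta>\<psi>] by auto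

abbreviation HH :: "germ \<Rightarrow> germ \<Rightarrow> bool" where "HH \<equiv> H \<zeta>"

definition B :: "int \<Rightarrow> germ \<Rightarrow> germ" where "B k p = germ_map \<psi> (A k (germ_map \<zeta> p))"

definition B_fun :: "int \<Rightarrow> fp \<Rightarrow> fp" where "B_fun k = \<psi> \<circ> (f_pow k \<circ> \<zeta>)"

lemma B_fun_pw_iso: "pw_iso n n (B_fun k) (B_fun (- k))"
  using pw_iso_comp[OF pw_iso_comp[OF \<zeta>\<psi> f_pow_pw_iso] pw_iso_sym[OF \<zeta>\<psi>], of k] by (simp add: B_fun_def comp_assoc)

lemma B_fun_pw_affine: "pw_affine n n (B_fun k)" using pw_iso_pw_affine(1)[OF B_fun_pw_iso] .

lemma B_germ_map: "p \<in> germs n \<Longrightarrow> B k p = germ_map (B_fun k) p"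
  using pw_affine_germs[OF pw_affine\<zeta>] A_germ_map unfolding B_def B_fun_def
  by (simp add: germ_map_comp[OF pw_affine_comp[OF pw_affine\<zeta> f_pow_pw_affine] pw_affine\<psi>] germ_map_comp[OF pw_affine\<zeta> f_pow_pw_affine])

lemma B_germs [simp]: "p \<in> germs n \<Longrightarrow> B k p \<in> germs n"
  using pw_affine_germs[OF B_fun_pw_affine] B_germ_map by simp

lemma B_0 [simp]: "p \<in> germs n \<Longrightarrow> B 0 p = p"
  using pw_iso_inv[OF \<zeta>\<psi>] by (simp add: B_def)

lemma \<zeta>B: "p \<in> germs n \<Longrightarrow> germ_map \<zeta> (B k p) = A k (germ_map \<zeta> p)"
  unfolding B_def using pw_iso_inv[OF pw_iso_sym[OF \<zeta>\<psi>]] pw_affine_germs[OF pw_affine\<zeta>] by simp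

lemma B_add: "p \<in> germs n \<Longrightarrow> B (j + k) p = B j (B k p)"
  unfolding B_def[of j] \<zeta>B by (simp add: A_add pw_affine_germs[OF pw_affine\<zeta>] B_def)

lemma B_sc: "p \<in> germs n \<Longrightarrow> c > 0 \<Longrightarrow> B k (sc c p) = sc c (B k p)"
  using germ_map_sc[OF B_fun_pw_affine] by (simp add: B_germ_map)

lemma B_minus: "p \<in> germs n \<Longrightarrow> B (- k) (B k p) = p"
  using B_add[of p "-k" k] by simp

lemma HH_B: "p \<in> germs n \<Longrightarrow> q \<in> germs n \<Longrightarrow> HH p q \<Longrightarrow> HH (B k p) (B k q)"
  unfolding H_def using G_A by (simp add: \<zeta>B)

lemma HH_unique: "p \<in> germs n \<Longrightarrow> q \<in> germs n \<Longrightarrow> q' \<in> germs n \<Longrightarrow> HH p q \<Longrightarrow> HH p q' \<Longrightarrow> q = q'"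
  unfolding H_def using G_unique pw_iso_inv[OF \<zeta>\<psi>] by metis

lemma HH_inner: "p \<in> germs n \<Longrightarrow> snd (fst p) \<noteq> to_rz 0 \<Longrightarrow> HH p (opp p)"
  using Good_inner[OF good, of "fst p" "snd p"] by (cases p) (auto simp: germs_def)

text \<open>Inner germs already have their opposite as the unique partner, so a germ at 0 can be
  paired only with a germ at 0, where \<open>ends\<close> applies. The speeds of the two ends are
  not compared yet.\<close>

lemma HH_form:
  assumes "p \<in> germs n" "q \<in> germs n" "HH p q"
  shows "snd (fst p) \<noteq> to_rz 0 \<and> q = opp p \<or> snd (fst p) = to_rz 0 \<and> fst q = fst p \<and> snd p * snd q < 0"
proof (cases "snd (fst p) = to_rz 0")
  case False
  then show ?thesis using HH_unique[OF assms(1,2) _ assms(3) HH_inner[OF assms(1)]] assms(1) by simp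
next
  case True
  have "snd (fst q) = to_rz 0"
  proof (rule ccontr)
    assume "snd (fst q) \<noteq> to_rz 0"
    then have "p = opp q" using HH_unique[OF assms(2,1) _ H_sym[OF assms(3)] HH_inner[OF assms(2)]] assms(2) by simp
    then show False using True \<open>snd (fst q) \<noteq> to_rz 0\<close> by simp
  qed
  then have "fst (fst p) = fst (fst q) \<and> snd p * snd q < 0"
  proof (intro ends)
    have "((fst (fst p), to_rz 0), snd p) = p" "((fst (fst q), to_rz 0), snd q) = q"
      using True \<open>snd (fst q) = to_rz 0\<close> by (simp_all add: prod_eq_iff)
    then show "HH ((fst (fst p), to_rz 0), snd p) ((fst (fst q), to_rz 0), snd q)" using assms(3) by simp
  qed (use assms in \<open>auto simp: germs_def\<close>)
  then show ?thesis using True \<open>snd (fst q) = to_rz 0\<close> by (simp add: prod_eq_iff)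
qed

lemma HH_comp: "p \<in> germs n \<Longrightarrow> q \<in> germs n \<Longrightarrow> HH p q \<Longrightarrow> fst q = fst p"
  using HH_form by fastforce

lemma B_prop:
  assumes "(x, v) \<in> germs n" "B k (x, v) = (y, w)"
  shows "eventually (\<lambda>t. \<forall>v'. v' \<noteq> 0 \<longrightarrow> B k (fl (v * t) x, v') = (fl (w * t) y, w * v' / v)) (at_right 0)"
  using germ_map_prop[OF B_fun_pw_affine assms(1), of k y w] assms
  by (auto elim!: eventually_mono simp: B_germ_map)

lemma norm_germ: assumes "p \<in> germs n"
  obtains v where "v = 1 \<or> v = (-1::real)" "p = sc \<bar>snd p\<bar> (fst p, v)" "(fst p, v) \<in> germs n" "\<bar>snd p\<bar> > 0"
proof (rule that[of "sgn (snd p)"])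
  show "p = sc \<bar>snd p\<bar> (fst p, sgn (snd p))" by (cases p) (simp add: abs_mult_sgn)
qed (use assms in \<open>auto simp: germs_def sgn_real_def\<close>)

text \<open>Glued germs lie in the same component and the action preserves the gluing, so the
  component of the image cannot change at an inner point.\<close>

lemma B_comp: "i < n \<Longrightarrow> \<exists>j<n. \<forall>p\<in>germs n. fst (fst p) = i \<longrightarrow> fst (fst (B k p)) = j"
proof -
  assume i: "i < n"
  have "\<exists>c. \<forall>z v. v = 1 \<or> v = - 1 \<longrightarrow> fst (fst (B k ((i, z), v))) = c"
  proof (rule germ_constant)
    fix z assume z: "z \<noteq> to_rz 0"
    have "HH (B k ((i, z), 1)) (B k ((i, z), -1))"
      by (rule HH_B) (use HH_inner[of "((i, z), 1)"] i z in auto)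
    then show "fst (fst (B k ((i, z), - 1))) = fst (fst (B k ((i, z), 1)))"
      using HH_comp[of "B k ((i, z), 1)" "B k ((i, z), -1)"] i by simp
  next
    fix z and v :: real assume v: "v = 1 \<or> v = -1"
    obtain y w where yw: "B k ((i, z), v) = (y, w)" by (cases "B k ((i, z), v)")
    show "\<forall>\<^sub>F t in at_right 0. fst (fst (B k (fl (v * t) (i, z), v))) = fst (fst (B k ((i, z), v)))"
      using B_prop[OF _ yw] i v by (auto elim!: eventually_mono simp: yw)
  qed
  then obtain c where c: "\<And>z v. v = 1 \<or> v = - 1 \<Longrightarrow> fst (fst (B k ((i, z), v))) = c" by blast
  have "fst (fst (B k p)) = c" if p: "p \<in> germs n" "fst (fst p) = i" for p
  proof -
    obtain v where v: "v = 1 \<or> v = (-1::real)" "p = sc \<bar>snd p\<bar> (fst p, v)" "(fst p, v) \<in> germs n" "\<bar>snd p\<bar> > 0"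
      using norm_germ[OF p(1)] .
    have "B k p = sc \<bar>snd p\<bar> (B k (fst p, v))" using B_sc[OF v(3,4)] v(2) by metis
    then show ?thesis using c[OF v(1), of "snd (fst p)"] p(2) by (metis fst_sc prod.collapse)
  qed
  moreover have "c < n" using c[of 1 "to_rz 0"] B_germs[of "((i, to_rz 0), 1)" k] i by (auto simp: germs_def)
  ultimately show ?thesis by blast
qed

text \<open>By pigeonhole two powers send the component \<open>i\<close> to the same component.
  Undoing the smaller power from there leads back to \<open>i\<close>.\<close>

lemma B_comp_periodic:
  assumes i: "i < n"
  shows "\<exists>K::nat. K > 0 \<and> (\<forall>p\<in>germs n. fst (fst p) = i \<longrightarrow> fst (fst (B (int K) p)) = i)"
proof -
  have "\<forall>k::nat. \<exists>j. j < n \<and> (\<forall>p\<in>germs n. fst (fst p) = i \<longrightarrow> fst (fst (B (int k) p)) = j)"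
    using B_comp[OF i] by blast
  then obtain j where j: "\<And>k. j k < n" "\<And>k p. p \<in> germs n \<Longrightarrow> fst (fst p) = i \<Longrightarrow> fst (fst (B (int k) p)) = j k"
    using choice[of "\<lambda>k j. j < n \<and> (\<forall>p\<in>germs n. fst (fst p) = i \<longrightarrow> fst (fst (B (int k) p)) = j)"] by blast
  have "\<not> inj j"
  proof
    assume "inj j"
    moreover have "range j \<subseteq> {..<n}" using j(1) by auto
    ultimately show False using finite_subset[of "range j" "{..<n}"] range_inj_infinite by blast
  qed
  then obtain a b where ab: "a < b" "j a = j b" unfolding inj_def by (metis linorder_neqE_nat)
  obtain c where c: "\<And>q. q \<in> germs n \<Longrightarrow> fst (fst q) = j a \<Longrightarrow> fst (fst (B (- int a) q)) = c"
    using B_comp[OF j(1)[of a], of "- int a"] by blast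
  have "c = i"
    using c[of "B (int a) ((i, to_rz 0), 1)"] j(2)[of "((i, to_rz 0), 1)" a] B_minus[of "((i, to_rz 0), 1)"] i by simp
  have "fst (fst (B (int (b - a)) p)) = i" if p: "p \<in> germs n" "fst (fst p) = i" for p
  proof -
    have "B (int (b - a)) p = B (- int a) (B (int b) p)"
      using B_add[OF p(1), of "- int a" "int b"] ab(1) by (simp add: of_nat_diff)
    then show ?thesis using c[of "B (int b) p"] j(2)[OF p, of b] ab(2) p(1) \<open>c = i\<close> by simp
  qed
  then show ?thesis using ab(1) by (intro exI[of _ "b - a"]) auto
qed

end

text \<open>The ends of the component \<open>i\<close> are glued with scale \<open>c\<close>. The affine structure obtained in
  this way is that of the quotient of a half-line by a dilation centred at \<open>centre\<close>.\<close>

locale bad_circle = minimal +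
  fixes i :: nat and c :: real
  assumes i: "i < n" and c: "c > 0" "c \<noteq> 1" and glue: "H \<zeta> ((i, to_rz 0), 1) ((i, to_rz 0), - c)"
begin

text \<open>The fixed point of \<open>x \<mapsto> c * x + 1\<close>, the affine map that continues
  the coordinate at 0 across the end 1.\<close>

definition centre :: real where "centre = - 1 / (c - 1)"

text \<open>The signed time since the germ, moving with its velocity, left the centre.\<close>

definition centre_time :: "germ \<Rightarrow> real" where "centre_time p = (pos p - centre) / snd p"

lemma HH_end:
  assumes "p \<in> germs n" "q \<in> germs n" "HH p q" "fst p = (i, to_rz 0)"
  shows "q = ((i, to_rz 0), if snd p > 0 then - c * snd p else - snd p / c)"
proof -
  obtain v where p: "p = ((i, to_rz 0), v)" using assms(4) by (cases p) auto
  have v: "v \<noteq> 0" using assms(1) p by simp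
  show ?thesis
  proof (cases "v > 0")
    case True
    have "HH p ((i, to_rz 0), - c * v)"
      using H_sc[OF pw_affine\<zeta> _ _ glue True] i c by (simp add: p mult.commute)
    then show ?thesis using HH_unique[OF assms(1,2) _ assms(3)] True i c p by simp
  next
    case False
    then have v': "- v / c > 0" using v c by (simp add: divide_neg_pos)
    have "HH p ((i, to_rz 0), - v / c)"
      using H_sc[OF pw_affine\<zeta> _ _ H_sym[OF glue] v'] i c by (simp add: p)
    then show ?thesis using HH_unique[OF assms(1,2) _ assms(3), of "((i, to_rz 0), - v / c)"] False v i c p by simp
  qed
qed

text \<open>The gluing of the ends is a dilation about the centre, so it multiplies distance from
  the centre and speed by the same factor. Only the reversal of direction changes the
  quotient.\<close>

lemma HH_centre_time:
  assumes "p \<in> germs n" "q \<in> germs n" "HH p q" "fst (fst p) = i"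
  shows "centre_time q = - centre_time p"
proof (cases "snd (fst p) = to_rz 0")
  case False
  then have "q = opp p" using HH_form[OF assms(1-3)] by blast
  then show ?thesis using False by (cases p) (simp add: centre_time_def pos_def)
next
  case True
  then have f: "fst p = (i, to_rz 0)" using assms(4) by (simp add: prod_eq_iff)
  obtain v where p: "p = ((i, to_rz 0), v)" using f by (cases p) auto
  have v: "v \<noteq> 0" using assms(1) p by simp
  note q = HH_end[OF assms(1-3) f]
  have fr0: "fr (to_rz 0) = 0" by (simp add: fr_eq_0_iff)
  have c1: "c - 1 \<noteq> 0" using c by simp
  have c2: "1 - centre = c / (c - 1)" "- centre = 1 / (c - 1)" using c1 by (simp_all add: centre_def field_simps)
  show ?thesis
  proof (cases "v > 0")
    case True
    have "- c * v < 0" using True c by simp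
    then have q': "pos q = 1" "snd q = - c * v" unfolding q by (simp_all add: pos_def p True)
    have p': "pos p = 0" using True by (simp add: p pos_def fr0)
    show ?thesis unfolding centre_time_def q' p' using c2 c v by (simp add: p)
  next
    case False
    then have v0: "v < 0" using v by simp
    have "- v / c > 0" using v0 c by (simp add: divide_neg_pos)
    then have q': "pos q = 0" "snd q = - v / c" unfolding q using False by (simp_all add: pos_def p fr0)
    have p': "pos p = 1" using v0 by (simp add: p pos_def)
    show ?thesis unfolding centre_time_def q' p' using c2 c v by (simp add: p)
  qed
qed

lemma HH_ln:
  assumes "p \<in> germs n" "q \<in> germs n" "HH p q" "fst (fst p) = i"
  shows "\<exists>j::int. ln \<bar>snd q\<bar> = ln \<bar>snd p\<bar> + of_int j * ln c"
proof (cases "snd (fst p) = to_rz 0")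
  case False
  then have "q = opp p" using HH_form[OF assms(1-3)] by blast
  then show ?thesis by (intro exI[of _ 0]) simp
next
  case True
  then have f: "fst p = (i, to_rz 0)" using assms(4) by (simp add: prod_eq_iff)
  have v: "snd p \<noteq> 0" using assms(1) by (simp add: germs_def)
  have "\<bar>snd q\<bar> = c * \<bar>snd p\<bar> \<or> \<bar>snd q\<bar> = \<bar>snd p\<bar> / c"
    unfolding HH_end[OF assms(1-3) f] using c by (auto simp: abs_mult)
  then show ?thesis
  proof
    assume "\<bar>snd q\<bar> = c * \<bar>snd p\<bar>"
    then show ?thesis using c v by (intro exI[of _ 1]) (simp add: ln_mult)
  next
    assume "\<bar>snd q\<bar> = \<bar>snd p\<bar> / c"
    then show ?thesis using c v by (intro exI[of _ "-1"]) (simp add: ln_div)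
  qed
qed

lemma centre_time_sc: "a > 0 \<Longrightarrow> centre_time (sc a p) = centre_time p / a"
  by (simp add: centre_time_def pos_def mult_less_0_iff)

text \<open>A map of the quotient by a dilation must fix the centre of the dilation, because its
  translation part would be multiplied by \<open>c \<noteq> 1\<close> when carried once
  around.\<close>

lemma centre_time_invariant:
  assumes K: "\<And>p. p \<in> germs n \<Longrightarrow> fst (fst p) = i \<Longrightarrow> fst (fst (B K p)) = i"
    and p: "p \<in> germs n" "fst (fst p) = i"
  shows "centre_time (B K p) = centre_time p"
proof -
  \<comment> \<open>In the developed picture this is the translation part of the map divided by its
    slope; hence it is constant along the component and insensitive to scaling.\<close>
  define \<Theta> where "\<Theta> p = snd p * (centre_time (B K p) - centre_time p)" for p
  have opp: "centre_time (B K q) - centre_time q = - (centre_time (B K p) - centre_time p)"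
    if "p \<in> germs n" "q \<in> germs n" "HH p q" "fst (fst p) = i" for p q
    using HH_centre_time[OF that] HH_centre_time[OF _ _ HH_B[OF that(1-3), of K]] that K by simp
  have "\<exists>d. \<forall>z v. v = 1 \<or> v = - 1 \<longrightarrow> \<Theta> ((i, z), v) = d"
  proof (rule germ_constant)
    fix z assume z: "z \<noteq> to_rz 0"
    show "\<Theta> ((i, z), - 1) = \<Theta> ((i, z), 1)"
      unfolding \<Theta>_def using opp[of "((i, z), 1)" "((i, z), -1)"] HH_inner[of "((i, z), 1)"] z by (simp add: i)
  next
    fix z and v :: real assume v: "v = 1 \<or> v = -1"
    obtain y w where yw: "B K ((i, z), v) = (y, w)" by (cases "B K ((i, z), v)")
    have P: "((i, z), v) \<in> germs n" using v by (auto simp: i)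
    have v0: "v \<noteq> 0" using v by auto
    have w0: "w \<noteq> 0" using B_germs[OF P, of K] yw by simp
    show "\<forall>\<^sub>F t in at_right 0. \<Theta> (fl (v * t) (i, z), v) = \<Theta> ((i, z), v)"
      using B_prop[OF P yw] pos_ev[OF v0, of "(i, z)"] pos_ev[OF w0, of y]
    proof eventually_elim
      case (elim t)
      then have "B K (fl (v * t) (i, z), v) = (fl (w * t) y, w)" using v0 by simp
      moreover have "centre_time (fl (w * t) y, w) = centre_time (y, w) + t" using elim w0 by (simp add: centre_time_def field_simps)
      moreover have "centre_time (fl (v * t) (i, z), v) = centre_time ((i, z), v) + t" using elim v0 by (simp add: centre_time_def field_simps)
      ultimately show ?case by (simp add: \<Theta>_def yw)
    qed
  qed
  then obtain d where d: "\<And>z v. v = 1 \<or> v = - 1 \<Longrightarrow> \<Theta> ((i, z), v) = d" by blast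
  have sc: "\<Theta> (sc a p) = \<Theta> p" if "p \<in> germs n" "a > 0" for p a
    using that B_sc[OF that, of K] by (simp add: \<Theta>_def centre_time_sc right_diff_distrib)
  let ?p0 = "((i, to_rz 0), 1::real)" and ?q0 = "((i, to_rz 0), - c)"
  have "\<Theta> ?q0 = \<Theta> ((i, to_rz 0), -1)" using sc[of "((i, to_rz 0), -1)" c] c by (simp add: i)
  also have "\<dots> = \<Theta> ?p0" using d[of "-1" "to_rz 0"] d[of 1 "to_rz 0"] by simp
  finally have "\<Theta> ?q0 = \<Theta> ?p0" .
  \<comment> \<open>At the glued ends the time differences are opposite and the velocities are
    \<open>1\<close> and \<open>- c\<close>, which yields the factor \<open>c\<close>.\<close>
  moreover have "\<Theta> ?q0 = c * \<Theta> ?p0"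
    unfolding \<Theta>_def using opp[of ?p0 ?q0] glue c by (simp add: i right_diff_distrib)
  ultimately have "\<Theta> ?p0 = 0" using c by simp
  then have d0: "d = 0" using d[of 1 "to_rz 0"] by simp
  obtain v where v: "v = 1 \<or> v = (-1::real)" "p = sc \<bar>snd p\<bar> (fst p, v)" "(fst p, v) \<in> germs n" "\<bar>snd p\<bar> > 0"
    using norm_germ[OF p(1)] .
  have "\<Theta> p = \<Theta> (fst p, v)" using sc[OF v(3,4)] v(2) by metis
  also have "\<dots> = 0" using d[OF v(1), of "snd (fst p)"] p(2) d0 by (metis prod.collapse)
  finally show ?thesis using v(4) by (simp add: \<Theta>_def)
qed

text \<open>Slopes of the return map jump only where an end is crossed, and by \<open>HH_ln\<close>
  the jump is a power of \<open>c\<close>. Hence the coset of the logarithm modulo integer multiples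
  of \<open>ln c\<close> is constant.\<close>

lemma slope_mod:
  assumes K: "\<And>p. p \<in> germs n \<Longrightarrow> fst (fst p) = i \<Longrightarrow> fst (fst (B K p)) = i"
  shows "\<exists>m0. \<forall>p \<in> germs n. fst (fst p) = i \<longrightarrow> (\<exists>j::int. ln \<bar>snd (B K p) / snd p\<bar> = m0 + of_int j * ln c)"
proof -
  define R where "R a = {a + of_int j * ln c |j::int. True}" for a
  have R_eq: "R (a + of_int j * ln c) = R a" for a and j :: int
  proof -
    have "a + of_int j * ln c + of_int k * ln c = a + of_int (j + k) * ln c" for k :: int by (simp add: algebra_simps)
    moreover have "a + of_int k * ln c = a + of_int j * ln c + of_int (k - j) * ln c" for k :: int by (simp add: algebra_simps)
    ultimately show ?thesis unfolding R_def by blast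
  qed
  have R_self: "a \<in> R a" for a unfolding R_def by (rule CollectI, rule exI[of _ 0]) simp
  define \<Phi> where "\<Phi> p = R (ln \<bar>snd (B K p) / snd p\<bar>)" for p
  have "\<exists>d. \<forall>z v. v = 1 \<or> v = - 1 \<longrightarrow> \<Phi> ((i, z), v) = d"
  proof (rule germ_constant)
    fix z assume z: "z \<noteq> to_rz 0"
    have "HH (B K ((i, z), 1)) (B K ((i, z), -1))"
      by (rule HH_B) (use HH_inner[of "((i, z), 1)"] z in \<open>auto simp: i\<close>)
    then obtain j :: int where "ln \<bar>snd (B K ((i, z), -1))\<bar> = ln \<bar>snd (B K ((i, z), 1))\<bar> + of_int j * ln c"
      using HH_ln[of "B K ((i, z), 1)" "B K ((i, z), -1)"] K by (auto simp: i)
    then show "\<Phi> ((i, z), - 1) = \<Phi> ((i, z), 1)" by (simp add: \<Phi>_def R_eq)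
  next
    fix z and v :: real assume v: "v = 1 \<or> v = -1"
    obtain y w where yw: "B K ((i, z), v) = (y, w)" by (cases "B K ((i, z), v)")
    have v0: "v \<noteq> 0" using v by auto
    show "\<forall>\<^sub>F t in at_right 0. \<Phi> (fl (v * t) (i, z), v) = \<Phi> ((i, z), v)"
      using B_prop[OF _ yw] v0 by (auto elim!: eventually_mono simp: yw \<Phi>_def i)
  qed
  then obtain d where d: "\<And>z v. v = 1 \<or> v = - 1 \<Longrightarrow> \<Phi> ((i, z), v) = d" by blast
  define m0 where "m0 = ln \<bar>snd (B K ((i, to_rz 0), 1))\<bar>"
  have dm: "d = R m0" using d[of 1 "to_rz 0"] by (simp add: \<Phi>_def m0_def)
  have "\<exists>j::int. ln \<bar>snd (B K p) / snd p\<bar> = m0 + of_int j * ln c" if p: "p \<in> germs n" "fst (fst p) = i" for p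
  proof -
    obtain v where v: "v = 1 \<or> v = (-1::real)" "p = sc \<bar>snd p\<bar> (fst p, v)" "(fst p, v) \<in> germs n" "\<bar>snd p\<bar> > 0"
      using norm_germ[OF p(1)] .
    have "B K p = sc \<bar>snd p\<bar> (B K (fst p, v))" using B_sc[OF v(3,4)] v(2) by metis
    then have "\<bar>snd (B K p) / snd p\<bar> = \<bar>snd (B K (fst p, v))\<bar>" using v(4) by (simp add: abs_mult)
    also have "\<dots> = \<bar>snd (B K (fst p, v)) / v\<bar>" using v(1) by auto
    finally have "\<Phi> p = \<Phi> (fst p, v)" by (simp add: \<Phi>_def)
    also have "\<dots> = R m0" using d[OF v(1), of "snd (fst p)"] p(2) dm by (metis prod.collapse)
    finally have "ln \<bar>snd (B K p) / snd p\<bar> \<in> R m0" using R_self unfolding \<Phi>_def by blast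
    then show ?thesis unfolding R_def by blast
  qed
  then show ?thesis by blast
qed

lemma return_iterate:
  assumes K: "\<And>p. p \<in> germs n \<Longrightarrow> fst (fst p) = i \<Longrightarrow> fst (fst (B K p)) = i"
    and p: "p \<in> germs n" "fst (fst p) = i"
  shows "fst (fst (B (int N * K) p)) = i"
proof (induction N)
  case (Suc N)
  have "B (int (Suc N) * K) p = B K (B (int N * K) p)" using B_add[OF p(1), of K "int N * K"] by (simp add: algebra_simps)
  then show ?case using K[OF B_germs[OF p(1)] Suc] by simp
qed (use p in simp)

lemma slope_iterate:
  assumes K: "\<And>p. p \<in> germs n \<Longrightarrow> fst (fst p) = i \<Longrightarrow> fst (fst (B K p)) = i"
    and m0: "\<And>p. p \<in> germs n \<Longrightarrow> fst (fst p) = i \<Longrightarrow> \<exists>j::int. ln \<bar>snd (B K p) / snd p\<bar> = m0 + of_int j * ln c"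
    and p: "p \<in> germs n" "fst (fst p) = i"
  shows "\<exists>j::int. ln \<bar>snd (B (int N * K) p) / snd p\<bar> = real N * m0 + of_int j * ln c"
proof (induction N)
  case 0
  show ?case using p by (intro exI[of _ 0]) (auto simp: germs_def)
next
  case (Suc N)
  let ?q = "B (int N * K) p"
  have q: "?q \<in> germs n" "fst (fst ?q) = i" using p return_iterate[OF K p] by auto
  obtain j1 :: int where j1: "ln \<bar>snd ?q / snd p\<bar> = real N * m0 + of_int j1 * ln c" using Suc by blast
  obtain j2 :: int where j2: "ln \<bar>snd (B K ?q) / snd ?q\<bar> = m0 + of_int j2 * ln c" using m0[OF q] by blast
  have nz: "snd p \<noteq> 0" "snd ?q \<noteq> 0" "snd (B K ?q) \<noteq> 0" using p q B_germs[OF q(1), of K] by (auto simp: germs_def)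
  have "B (int (Suc N) * K) p = B K ?q" using B_add[OF p(1), of K "int N * K"] by (simp add: algebra_simps)
  then have "ln \<bar>snd (B (int (Suc N) * K) p) / snd p\<bar> = ln \<bar>snd (B K ?q) / snd ?q\<bar> + ln \<bar>snd ?q / snd p\<bar>"
    using nz by (simp add: ln_div)
  also have "\<dots> = real (Suc N) * m0 + of_int (j1 + j2) * ln c" using j1 j2 by (simp add: algebra_simps)
  finally show ?case by blast
qed

text \<open>Only the coset of the logarithm modulo \<open>ln c\<close> is controlled along the
  iterates. A functional that kills \<open>ln c\<close> sees this coset as a number that grows
  linearly, and sublinearity makes its rate \<open>u m0\<close> vanish.\<close>

lemma return_slope_rational:
  assumes K: "K > 0" "\<And>p. p \<in> germs n \<Longrightarrow> fst (fst p) = i \<Longrightarrow> fst (fst (B (int K) p)) = i"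
    and m0: "\<And>p. p \<in> germs n \<Longrightarrow> fst (fst p) = i \<Longrightarrow> \<exists>j::int. ln \<bar>snd (B (int K) p) / snd p\<bar> = m0 + of_int j * ln c"
  shows "\<exists>(k::nat) (l::int). k > 0 \<and> real k * m0 = of_int l * ln c"
proof (rule additive_separation)
  show "ln c \<noteq> 0" using c by simp
  fix u :: "real \<Rightarrow> real" assume u: "\<And>x y. u (x + y) = u x + u y" and uc: "u (ln c) = 0"
  let ?p = "((i, to_rz 0), 1::real)"
  have p: "?p \<in> germs n" "fst (fst ?p) = i" by (simp_all add: i)
  have zp: "germ_map \<zeta> ?p \<in> germs 1" using pw_affine_germs[OF pw_affine\<zeta> p(1)] .
  let ?S = "{\<bar>snd (germ_map \<zeta> p) / snd p\<bar> |p. p \<in> germs n}"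
  \<comment> \<open>Passing between \<open>A\<close> and \<open>B\<close> changes the logarithm by
    two slopes of \<open>\<zeta>\<close>, of which there are finitely many. This gives the bounded
    error.\<close>
  have "finite ((\<lambda>s. \<bar>u (ln s)\<bar>) ` ?S)" using finite_slopes[OF pw_affine\<zeta>] by (rule finite_imageI)
  then obtain C where C: "\<forall>x \<in> (\<lambda>s. \<bar>u (ln s)\<bar>) ` ?S. x \<le> C"
    using bdd_above_finite[unfolded bdd_above_def] by blast
  have C': "\<bar>u (ln \<bar>snd (germ_map \<zeta> p) / snd p\<bar>)\<bar> \<le> C" if "p \<in> germs n" for p using C that by blast
  have um: "u (x - y) = u x - u y" for x y using u[of "x - y" y] by simp
  show "u m0 = 0"
  proof (rule slope_growth[OF u K(1) zp])
    fix N
    let ?q = "B (int (K * N)) ?p"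
    have q: "?q \<in> germs n" using p by simp
    obtain j :: int where j: "ln \<bar>snd ?q / snd ?p\<bar> = real N * m0 + of_int j * ln c"
      using slope_iterate[OF K(2) m0 p, of N] unfolding of_nat_mult[symmetric] mult.commute[of N K] by blast
    have "u (ln \<bar>snd ?q / snd ?p\<bar>) = real N * u m0"
      unfolding j u using additive_int[OF u, of "int N" m0] additive_int[OF u, of j "ln c"] uc by simp
    moreover have "ln \<bar>snd (A (int (K * N)) (germ_map \<zeta> ?p)) / snd (germ_map \<zeta> ?p)\<bar> =
        ln \<bar>snd (germ_map \<zeta> ?q) / snd ?q\<bar> + ln \<bar>snd ?q / snd ?p\<bar> - ln \<bar>snd (germ_map \<zeta> ?p) / snd ?p\<bar>"
    proof -
      have "snd ?q \<noteq> 0" "snd (germ_map \<zeta> ?p) \<noteq> 0" "snd (germ_map \<zeta> ?q) \<noteq> 0"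
        using q zp pw_affine_germs[OF pw_affine\<zeta> q] by (simp_all add: germs_def)
      then show ?thesis unfolding \<zeta>B[OF p(1), symmetric] by (simp add: ln_div)
    qed
    ultimately have "u (ln \<bar>snd (A (int (K * N)) (germ_map \<zeta> ?p)) / snd (germ_map \<zeta> ?p)\<bar>) - real N * u m0
      = u (ln \<bar>snd (germ_map \<zeta> ?q) / snd ?q\<bar>) - u (ln \<bar>snd (germ_map \<zeta> ?p) / snd ?p\<bar>)" by (simp only: u um)
    then show "\<bar>u (ln \<bar>snd (A (int (K * N)) (germ_map \<zeta> ?p)) / snd (germ_map \<zeta> ?p)\<bar>) - real N * u m0\<bar> \<le> C + C"
      using C'[OF q] C'[OF p(1)] by linarith
  qed
qed

text \<open>In logarithmic distance from the centre the component is a fundamental domain of the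
  dilation. Equal centre times tie the ratio of distances to the ratio of speeds, so the two
  positions differ by an integer number of domains.\<close>

lemma germ_rigid:
  assumes p: "p \<in> germs n" "fst (fst p) = i" and q: "q \<in> germs n" "fst (fst q) = i"
    and y: "centre_time q = centre_time p" and j: "ln \<bar>snd q / snd p\<bar> = of_int j * ln c"
  shows "q = p"
proof -
  define a where "a r = 1 + (c - 1) * pos r" for r
  have a_centre_time: "(c - 1) * centre_time r = a r / snd r" for r
  proof -
    have "(c - 1) * centre = - 1" using c by (simp add: centre_def)
    moreover have "(c - 1) * centre_time r = ((c - 1) * pos r - (c - 1) * centre) / snd r"
      by (simp add: centre_time_def right_diff_distrib)
    ultimately show ?thesis by (simp add: a_def)
  qed
  have ab: "(1 \<le> a r \<and> a r \<le> c) \<or> (c \<le> a r \<and> a r \<le> 1)" for r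
  proof (cases "c > 1")
    case True
    then have "0 \<le> (c - 1) * pos r" "(c - 1) * pos r \<le> (c - 1) * 1"
      using pos_bounds[of r] by (auto intro!: mult_nonneg_nonneg mult_left_mono simp del: mult_1_right)
    then show ?thesis by (simp add: a_def)
  next
    case False
    then have "0 \<le> (1 - c) * pos r" "(1 - c) * pos r \<le> (1 - c) * 1"
      using pos_bounds[of r] by (auto intro!: mult_nonneg_nonneg mult_left_mono simp del: mult_1_right)
    then show ?thesis by (simp add: a_def algebra_simps)
  qed
  then have apos: "a r > 0" for r using c by (meson less_le_trans zero_less_one)
  have nz: "snd p \<noteq> 0" "snd q \<noteq> 0" using p q by (auto simp: germs_def)
  have L: "ln c \<noteq> 0" using c by simp
  \<comment> \<open>Logarithmic position in the fundamental domain: \<open>a r\<close> is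
    \<open>c - 1\<close> times the signed distance from the centre, equal to 1 at the position 0 and
    to \<open>c\<close> at the position 1.\<close>
  define al where "al r = ln (a r) / ln c" for r
  have al: "0 \<le> al r" "al r \<le> 1" for r
    using ab[of r] apos[of r] c L unfolding al_def
    by (auto simp: zero_le_divide_iff divide_le_eq_1)
  have e: "a q / snd q = a p / snd p" using a_centre_time[of p] a_centre_time[of q] y by simp
  then have vq: "snd q = snd p * (a q / a p)" using nz apos[of p] by (simp add: field_simps)
  have "\<bar>snd q / snd p\<bar> = a q / a p" unfolding vq using nz apos[of p] apos[of q] by simp
  then have "ln (a q) - ln (a p) = of_int j * ln c" using j apos[of q] apos[of p] by (simp add: ln_div)
  then have alj: "al q - al p = of_int j" unfolding al_def using L by (simp add: field_simps)
  have al0: "pos r = 0" if "al r = 0" for r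
  proof -
    have "a r = 1" using that L apos[of r] by (simp add: al_def)
    then show ?thesis using c by (simp add: a_def)
  qed
  have al1: "pos r = 1" if "al r = 1" for r
  proof -
    have "ln (a r) = ln c" using that L by (simp add: al_def)
    then have "a r = c" using apos[of r] c by simp
    then have "(c - 1) * pos r = c - 1" unfolding a_def by linarith
    then show ?thesis using c by simp
  qed
  have pos0: "snd r > 0" if "pos r = 0" "snd r \<noteq> 0" for r
    using that by (auto simp: pos_def fr_eq_0_iff split: if_splits)
  have pos1: "snd r < 0" if "pos r = 1" for r
    using that less_imp_neq[OF fr_lt_1[of "snd (fst r)"]] by (auto simp: pos_def split: if_splits)
  have "snd q * snd p = (snd p)\<^sup>2 * (a q / a p)" unfolding vq by (simp add: power2_eq_square)
  then have sg: "snd q * snd p > 0" using nz apos[of p] apos[of q] by simp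
  have "of_int j < (2::real)" "of_int j > (-2::real)" using alj al[of p] al[of q] by linarith+
  then have "j = -1 \<or> j = 0 \<or> j = 1" by linarith
  \<comment> \<open>A difference of a full domain would put the germs at opposite ends, where they
    point in opposite directions. The relation between the velocities forces equal signs.\<close>
  then have "j = 0"
  proof (elim disjE)
    assume "j = -1"
    then have "al p = 1" "al q = 0" using alj al[of p] al[of q] by auto
    then have "snd p < 0" "snd q > 0" using pos1[OF al1] pos0[OF al0] nz by auto
    then show ?thesis using sg by (simp add: zero_less_mult_iff)
  next
    assume "j = 1"
    then have "al q = 1" "al p = 0" using alj al[of p] al[of q] by auto
    then have "snd q < 0" "snd p > 0" using pos1[OF al1] pos0[OF al0] nz by auto
    then show ?thesis using sg by (simp add: zero_less_mult_iff)
  qed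
  then have "ln (a q) = ln (a p)" using alj L by (simp add: al_def)
  then have aa: "a q = a p" using apos by simp
  then have "(c - 1) * pos q = (c - 1) * pos p" by (simp add: a_def)
  then have "pos q = pos p" using c by simp
  moreover have "snd q = snd p" using vq aa apos[of p] by simp
  ultimately show ?thesis using germ_eqI p q by simp
qed

lemma bad_circle_False: False
proof -
  obtain K :: nat where K: "K > 0" "\<And>p. p \<in> germs n \<Longrightarrow> fst (fst p) = i \<Longrightarrow> fst (fst (B (int K) p)) = i"
    using B_comp_periodic[OF i] by blast
  obtain m0 where m0: "\<And>p. p \<in> germs n \<Longrightarrow> fst (fst p) = i \<Longrightarrow> \<exists>j::int. ln \<bar>snd (B (int K) p) / snd p\<bar> = m0 + of_int j * ln c"
    using slope_mod[OF K(2)] by blast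
  obtain k l where kl: "k > 0" "real k * m0 = of_int l * ln c" using return_slope_rational[OF K m0] by blast
  \<comment> \<open>\<open>K\<close> brings the component back to itself, and \<open>k\<close> turns
    the logarithmic slope into an integer multiple of \<open>ln c\<close>, as
    \<open>germ_rigid\<close> demands.\<close>
  let ?M = "int k * int K"
  have M: "?M \<noteq> 0" using kl(1) K(1) by simp
  have fix_B: "B ?M p = p" if p: "p \<in> germs n" "fst (fst p) = i" for p
  proof -
    obtain j :: int where j: "ln \<bar>snd (B ?M p) / snd p\<bar> = real k * m0 + of_int j * ln c"
      using slope_iterate[OF K(2) m0 p] by blast
    have "centre_time (B ?M p) = centre_time p" by (rule centre_time_invariant[OF return_iterate[OF K(2)] p])
    then show ?thesis
      using germ_rigid[OF p B_germs[OF p(1)] return_iterate[OF K(2) p], of k "l + j"] j kl(2)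
      by (simp add: distrib_right)
  qed
  \<comment> \<open>A fixed germ has its partner computed without any limit, so on this component
    the gluing is the standard one of the original circle.\<close>
  have opp: "germ_map \<zeta> q = opp (germ_map \<zeta> p)" if "p \<in> germs n" "q \<in> germs n" "HH p q" "fst (fst p) = i" for p q
  proof (rule periodic_G[OF _ M])
    show "G (germ_map \<zeta> p) (germ_map \<zeta> q)" using that(3) by (simp add: H_def)
    show "A ?M (germ_map \<zeta> p) = germ_map \<zeta> p" using \<zeta>B[OF that(1)] fix_B[OF that(1,4)] by metis
    have "fst (fst q) = i" using HH_comp[OF that(1-3)] that(4) by simp
    then show "A ?M (germ_map \<zeta> q) = germ_map \<zeta> q" using \<zeta>B[OF that(2)] fix_B[OF that(2)] by metis
  qed
  have "\<exists>d. \<forall>z v. v = 1 \<or> v = - 1 \<longrightarrow> \<bar>snd (germ_map \<zeta> ((i, z), v))\<bar> = d"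
  proof (rule germ_constant)
    fix z assume z: "z \<noteq> to_rz 0"
    show "\<bar>snd (germ_map \<zeta> ((i, z), - 1))\<bar> = \<bar>snd (germ_map \<zeta> ((i, z), 1))\<bar>"
      using opp[of "((i, z), 1)" "((i, z), -1)"] HH_inner[of "((i, z), 1)"] z by (simp add: i)
  next
    fix z and v :: real assume v: "v = 1 \<or> v = -1"
    obtain y w where yw: "germ_map \<zeta> ((i, z), v) = (y, w)" by (cases "germ_map \<zeta> ((i, z), v)")
    have P: "((i, z), v) \<in> germs n" using v by (auto simp: i)
    then have "v \<noteq> 0" by simp
    then show "\<forall>\<^sub>F t in at_right 0. \<bar>snd (germ_map \<zeta> (fl (v * t) (i, z), v))\<bar> = \<bar>snd (germ_map \<zeta> ((i, z), v))\<bar>"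
      using germ_map_prop[OF pw_affine\<zeta> P yw] by (auto elim!: eventually_mono simp: yw)
  qed
  then have e: "\<bar>snd (germ_map \<zeta> ((i, to_rz 0), -1))\<bar> = \<bar>snd (germ_map \<zeta> ((i, to_rz 0), 1))\<bar>" by metis
  \<comment> \<open>The speed of \<open>\<zeta>\<close> is constant on the component. The standard
    gluing at the ends then compares this speed with \<open>c\<close> times itself.\<close>
  have "germ_map \<zeta> ((i, to_rz 0), - c) = opp (germ_map \<zeta> ((i, to_rz 0), 1))"
    using opp[OF _ _ glue] c by (simp add: i)
  moreover have "germ_map \<zeta> ((i, to_rz 0), - c) = sc c (germ_map \<zeta> ((i, to_rz 0), -1))"
    using germ_map_sc[OF pw_affine\<zeta> _ c(1), of "((i, to_rz 0), -1)"] by (simp add: i)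
  ultimately have "c * \<bar>snd (germ_map \<zeta> ((i, to_rz 0), 1))\<bar> = \<bar>snd (germ_map \<zeta> ((i, to_rz 0), 1))\<bar>"
    using e c by (metis abs_minus_cancel abs_mult abs_of_pos snd_opp snd_sc)
  moreover have "snd (germ_map \<zeta> ((i, to_rz 0), 1)) \<noteq> 0"
    using pw_affine_germs[OF pw_affine\<zeta>, of "((i, to_rz 0), 1)"] by (simp add: i germs_def)
  ultimately show False using c by simp
qed

end

context minimal
begin

text \<open>Only a difference of speeds at the two ends of one component is left to exclude, and
  after normalising one velocity to 1 this is a \<open>bad_circle\<close>.\<close>

lemma HH_opp:
  assumes "p \<in> germs n" "q \<in> germs n" "HH p q" shows "q = opp p"
proof (cases "snd (fst p) = to_rz 0")
  case False
  then show ?thesis using HH_form[OF assms] by blast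
next
  case True
  then have f: "fst q = fst p" "snd p * snd q < 0" using HH_form[OF assms] by auto
  have main: "q = opp p" if pq: "p \<in> germs n" "q \<in> germs n" "HH p q" "snd (fst p) = to_rz 0" "fst q = fst p" "snd p > 0" "snd q < 0" for p q
  proof (rule ccontr)
    assume ne: "q \<noteq> opp p"
    define c where "c = - snd q / snd p"
    have c: "c > 0" using pq by (simp add: c_def divide_neg_pos)
    have c1: "c \<noteq> 1"
    proof
      assume "c = 1"
      then have "snd q = - snd p" using pq(6) by (simp add: c_def field_simps)
      then show False using ne pq(5) by (simp add: prod_eq_iff)
    qed
    let ?i = "fst (fst p)"
    have "HH (sc (1 / snd p) p) (sc (1 / snd p) q)" by (rule H_sc[OF pw_affine\<zeta> pq(1-3)]) (use pq in simp)
    moreover have "sc (1 / snd p) p = ((?i, to_rz 0), 1)" "sc (1 / snd p) q = ((?i, to_rz 0), - c)"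
      using pq by (auto simp: prod_eq_iff c_def)
    ultimately have "bad_circle f g l n \<zeta> \<psi> ?i c"
      by unfold_locales (use c c1 pq in \<open>auto simp: germs_def\<close>)
    then show False by (rule bad_circle.bad_circle_False)
  qed
  show ?thesis
  proof (cases "snd p > 0")
    case pos: True
    then have "snd q < 0" using f(2) by (simp add: mult_less_0_iff)
    then show ?thesis using main[OF assms True f(1) pos] by simp
  next
    case False
    then have "snd p < 0" "snd q > 0" using f(2) by (auto simp: mult_less_0_iff)
    then have "p = opp q" using main[OF assms(2,1) H_sym[OF assms(3)]] f(1) True by metis
    then show ?thesis by simp
  qed
qed

end

section \<open>Curves with a local translation flow\<close>

abbreviation "TS C \<equiv> topspace (curve_top C)"

text \<open>For the curves at hand all charts are unit speed with respect to one and the same local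
  flow, so affine maps are those that intertwine the flows up to a change of speed.\<close>

definition flowcurve :: "'a curve \<Rightarrow> ('a \<Rightarrow> real \<Rightarrow> 'a) \<Rightarrow> bool" where
  "flowcurve C e \<longleftrightarrow>
     (\<forall>W p. openin (curve_top C) W \<and> p \<in> W \<longrightarrow> (\<exists>d>0. \<forall>t. \<bar>t\<bar> < d \<longrightarrow> e p t \<in> W)) \<and>
     (\<forall>p d. p \<in> topspace (curve_top C) \<and> d > 0 \<longrightarrow>
        (\<exists>W. openin (curve_top C) W \<and> p \<in> W \<and> (\<forall>q\<in>W. \<exists>t. \<bar>t\<bar> < d \<and> q = e p t))) \<and>
     (\<forall>U f. (U, f) \<in> charts C \<longrightarrow> openin (curve_top C) U \<and> inj_on f U \<and>
        (\<forall>p\<in>U. \<exists>d>0. \<forall>t. \<bar>t\<bar> < d \<longrightarrow> e p t \<in> U \<and> f (e p t) = f p + t)) \<and>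
     (\<forall>p \<in> topspace (curve_top C). \<exists>U f. (U, f) \<in> charts C \<and> p \<in> U) \<and>
     (\<forall>p q. p \<in> topspace (curve_top C) \<and> p \<noteq> q \<longrightarrow> (\<exists>d>0. \<forall>t. \<bar>t\<bar> < d \<longrightarrow> e p t \<noteq> q))"

lemma flowcurveI:
  assumes "\<And>W p. openin (curve_top C) W \<Longrightarrow> p \<in> W \<Longrightarrow> \<exists>d>0. \<forall>t. \<bar>t\<bar> < d \<longrightarrow> e p t \<in> W"
    "\<And>p d. p \<in> topspace (curve_top C) \<Longrightarrow> d > 0 \<Longrightarrow>
        \<exists>W. openin (curve_top C) W \<and> p \<in> W \<and> (\<forall>q\<in>W. \<exists>t. \<bar>t\<bar> < d \<and> q = e p t)"
    "\<And>U f. (U, f) \<in> charts C \<Longrightarrow> openin (curve_top C) U \<and> inj_on f U \<and>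
        (\<forall>p\<in>U. \<exists>d>0. \<forall>t. \<bar>t\<bar> < d \<longrightarrow> e p t \<in> U \<and> f (e p t) = f p + t)"
    "\<And>p. p \<in> topspace (curve_top C) \<Longrightarrow> \<exists>U f. (U, f) \<in> charts C \<and> p \<in> U"
    "\<And>p q. p \<in> topspace (curve_top C) \<Longrightarrow> p \<noteq> q \<Longrightarrow> \<exists>d>0. \<forall>t. \<bar>t\<bar> < d \<longrightarrow> e p t \<noteq> q"
  shows "flowcurve C e"
  unfolding flowcurve_def
  apply (intro conjI)
      apply (use assms(1) in blast)
     apply (use assms(2) in blast)
    apply (use assms(3) in blast)
   apply (use assms(4) in blast)
  apply (use assms(5) in blast)
  done

lemma flowcurve_stay:
  "flowcurve C e \<Longrightarrow> openin (curve_top C) W \<Longrightarrow> p \<in> W \<Longrightarrow> \<exists>d>0. \<forall>t. \<bar>t\<bar> < d \<longrightarrow> e p t \<in> W"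
  by (drule flowcurve_def[THEN iffD1, THEN conjunct1]) blast

lemma flowcurve_nbhd:
  "flowcurve C e \<Longrightarrow> p \<in> topspace (curve_top C) \<Longrightarrow> d > 0 \<Longrightarrow>
    \<exists>W. openin (curve_top C) W \<and> p \<in> W \<and> (\<forall>q\<in>W. \<exists>t. \<bar>t\<bar> < d \<and> q = e p t)"
  by (drule flowcurve_def[THEN iffD1, THEN conjunct2, THEN conjunct1]) blast

lemma flowcurve_chart:
  "flowcurve C e \<Longrightarrow> (U, f) \<in> charts C \<Longrightarrow> openin (curve_top C) U \<and> inj_on f U \<and>
    (\<forall>p\<in>U. \<exists>d>0. \<forall>t. \<bar>t\<bar> < d \<longrightarrow> e p t \<in> U \<and> f (e p t) = f p + t)"
  by (drule flowcurve_def[THEN iffD1, THEN conjunct2, THEN conjunct2, THEN conjunct1]) blast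

lemma flowcurve_cover:
  "flowcurve C e \<Longrightarrow> p \<in> topspace (curve_top C) \<Longrightarrow> \<exists>U f. (U, f) \<in> charts C \<and> p \<in> U"
  by (drule flowcurve_def[THEN iffD1, THEN conjunct2, THEN conjunct2, THEN conjunct2, THEN conjunct1]) blast

lemma flowcurve_avoid1:
  "flowcurve C e \<Longrightarrow> p \<in> topspace (curve_top C) \<Longrightarrow> p \<noteq> q \<Longrightarrow> \<exists>d>0. \<forall>t. \<bar>t\<bar> < d \<longrightarrow> e p t \<noteq> q"
  by (drule flowcurve_def[THEN iffD1, THEN conjunct2, THEN conjunct2, THEN conjunct2, THEN conjunct2]) blast

lemma flowcurve_avoid:
  assumes "flowcurve C e" "p \<in> topspace (curve_top C)" "finite F" "p \<notin> F"
  shows "\<exists>d>0. \<forall>t. \<bar>t\<bar> < d \<longrightarrow> e p t \<notin> F"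
  using assms(3,4)
proof (induction F rule: finite_induct)
  case empty then show ?case by (intro exI[of _ 1]) auto
next
  case (insert q F)
  then obtain d1 where d1: "d1 > 0" "\<forall>t. \<bar>t\<bar> < d1 \<longrightarrow> e p t \<notin> F" by auto
  obtain d2 where d2: "d2 > 0" "\<forall>t. \<bar>t\<bar> < d2 \<longrightarrow> e p t \<noteq> q" using flowcurve_avoid1[OF assms(1,2)] insert.prems by blast
  show ?case by (intro exI[of _ "min d1 d2"]) (use d1 d2 in auto)
qed

lemma flowcurve_cong:
  assumes "flowcurve C e" "\<And>p t. p \<in> topspace (curve_top C) \<Longrightarrow> e' p t = e p t"
  shows "flowcurve C e'"
proof (rule flowcurveI)
  fix W p assume "openin (curve_top C) W" "p \<in> W"
  moreover from this have "p \<in> topspace (curve_top C)" using openin_subset by blast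
  ultimately show "\<exists>d>0. \<forall>t. \<bar>t\<bar> < d \<longrightarrow> e' p t \<in> W" using flowcurve_stay[OF assms(1)] assms(2) by simp
next
  fix U f assume Uf: "(U, f) \<in> charts C"
  from flowcurve_chart[OF assms(1) this]
  show "openin (curve_top C) U \<and> inj_on f U \<and>
        (\<forall>p\<in>U. \<exists>d>0. \<forall>t. \<bar>t\<bar> < d \<longrightarrow> e' p t \<in> U \<and> f (e' p t) = f p + t)"
    using assms(2) openin_subset by fastforce
qed (use flowcurve_nbhd[OF assms(1)] flowcurve_cover[OF assms(1)] flowcurve_avoid1[OF assms(1)] assms(2) in auto)

lemma topspace_curve_minus [simp]:
  "topspace (curve_top (curve_minus C F)) = topspace (curve_top C) - F"
  by (auto simp: curve_minus_def)

lemma flowcurve_minus: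
  assumes "flowcurve C e" "finite F"
  shows "flowcurve (curve_minus C F) e"
proof (rule flowcurveI)
  fix W p assume "openin (curve_top (curve_minus C F)) W" "p \<in> W"
  then obtain V where V: "openin (curve_top C) V" "W = V \<inter> - F" "p \<in> V" "p \<notin> F"
    by (auto simp: curve_minus_def openin_subtopology)
  have pT: "p \<in> topspace (curve_top C)" using V openin_subset by blast
  obtain d1 where "d1 > 0" "\<forall>t. \<bar>t\<bar> < d1 \<longrightarrow> e p t \<in> V" using flowcurve_stay[OF assms(1) V(1,3)] by blast
  moreover obtain d2 where "d2 > 0" "\<forall>t. \<bar>t\<bar> < d2 \<longrightarrow> e p t \<notin> F" using flowcurve_avoid[OF assms(1) pT assms(2) V(4)] by blast
  ultimately show "\<exists>d>0. \<forall>t. \<bar>t\<bar> < d \<longrightarrow> e p t \<in> W"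
    unfolding V(2) by (intro exI[of _ "min d1 d2"]) auto
next
  fix p and d :: real assume p: "p \<in> topspace (curve_top (curve_minus C F))" "d > 0"
  then have "p \<in> TS C" by simp
  from flowcurve_nbhd[OF assms(1) this p(2)]
  obtain W where W: "openin (curve_top C) W" "p \<in> W" "\<forall>q\<in>W. \<exists>t. \<bar>t\<bar> < d \<and> q = e p t" by blast
  show "\<exists>W. openin (curve_top (curve_minus C F)) W \<and> p \<in> W \<and> (\<forall>q\<in>W. \<exists>t. \<bar>t\<bar> < d \<and> q = e p t)"
    by (rule exI[of _ "W \<inter> - F"]) (use W p in \<open>auto simp: curve_minus_def openin_subtopology\<close>)
next
  fix U f assume "(U, f) \<in> charts (curve_minus C F)"
  then obtain V where V: "(V, f) \<in> charts C" "U = V - F" by (auto simp: curve_minus_def)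
  note Vc = flowcurve_chart[OF assms(1) V(1)]
  have "\<exists>d>0. \<forall>t. \<bar>t\<bar> < d \<longrightarrow> e p t \<in> U \<and> f (e p t) = f p + t" if p: "p \<in> U" for p
  proof -
    have pT: "p \<in> topspace (curve_top C)" using p V Vc openin_subset by blast
    obtain d1 where "d1 > 0" "\<forall>t. \<bar>t\<bar> < d1 \<longrightarrow> e p t \<in> V \<and> f (e p t) = f p + t" using Vc p V(2) by blast
    moreover obtain d2 where "d2 > 0" "\<forall>t. \<bar>t\<bar> < d2 \<longrightarrow> e p t \<notin> F"
      using flowcurve_avoid[OF assms(1) pT assms(2)] p V(2) by blast
    ultimately show ?thesis unfolding V(2) by (intro exI[of _ "min d1 d2"]) auto
  qed
  moreover have "openin (curve_top (curve_minus C F)) U"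
    using Vc V(2) by (auto simp: curve_minus_def openin_subtopology)
  moreover have "inj_on f U" using Vc V(2) by (auto intro: inj_on_subset)
  ultimately show "openin (curve_top (curve_minus C F)) U \<and> inj_on f U \<and>
        (\<forall>p\<in>U. \<exists>d>0. \<forall>t. \<bar>t\<bar> < d \<longrightarrow> e p t \<in> U \<and> f (e p t) = f p + t)" by blast
next
  fix p assume p: "p \<in> topspace (curve_top (curve_minus C F))"
  then have "p \<in> TS C" by simp
  from flowcurve_cover[OF assms(1) this] obtain U f where "(U, f) \<in> charts C" "p \<in> U" by blast
  then have "(U - F, f) \<in> charts (curve_minus C F)" "p \<in> U - F" using p by (force simp: curve_minus_def)+
  then show "\<exists>U f. (U, f) \<in> charts (curve_minus C F) \<and> p \<in> U" by blast
qed (use flowcurve_avoid1[OF assms(1)] in auto)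

text \<open>\<open>affine_at e e' h p a\<close>: the map \<open>h\<close> is affine with slope \<open>a\<close> near \<open>p\<close>.\<close>

definition affine_at :: "('a \<Rightarrow> real \<Rightarrow> 'a) \<Rightarrow> ('b \<Rightarrow> real \<Rightarrow> 'b) \<Rightarrow> ('a \<Rightarrow> 'b) \<Rightarrow> 'a \<Rightarrow> real \<Rightarrow> bool" where
  "affine_at e e' h p a \<longleftrightarrow> a \<noteq> 0 \<and> (\<exists>d>0. \<forall>t. \<bar>t\<bar> < d \<longrightarrow> h (e p t) = e' (h p) (a * t))"

text \<open>A bound on the displacement, in place of an exact speed, also covers maps whose two
  one-sided slopes at a point differ.\<close>

lemma flow_continuous:
  assumes C: "flowcurve C e" and D: "flowcurve D e'"
    and h: "h ` TS C \<subseteq> TS D"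
    and lip: "\<And>p. p \<in> TS C \<Longrightarrow> \<exists>M>0. \<exists>d>0. \<forall>t. \<bar>t\<bar> < d \<longrightarrow> (\<exists>s. \<bar>s\<bar> \<le> M * \<bar>t\<bar> \<and> h (e p t) = e' (h p) s)"
  shows "continuous_map (curve_top C) (curve_top D) h"
  unfolding continuous_map_def
proof (intro conjI allI impI)
  show "h \<in> TS C \<rightarrow> TS D" using h by auto
  fix V assume V: "openin (curve_top D) V"
  show "openin (curve_top C) {x \<in> TS C. h x \<in> V}"
  proof (subst openin_subopen, intro ballI)
    fix p assume p: "p \<in> {x \<in> TS C. h x \<in> V}"
    obtain M d where M: "M > 0" "d > 0" "\<And>t. \<bar>t\<bar> < d \<Longrightarrow> \<exists>s. \<bar>s\<bar> \<le> M * \<bar>t\<bar> \<and> h (e p t) = e' (h p) s"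
      using lip[of p] p by auto
    obtain d2 where d2: "d2 > 0" "\<And>t. \<bar>t\<bar> < d2 \<Longrightarrow> e' (h p) t \<in> V" using flowcurve_stay[OF D V, of "h p"] p by blast
    obtain W where W: "openin (curve_top C) W" "p \<in> W" "\<And>q. q \<in> W \<Longrightarrow> \<exists>t. \<bar>t\<bar> < min d (d2 / M) \<and> q = e p t"
      using flowcurve_nbhd[OF C, of p "min d (d2 / M)"] p M(1,2) d2(1) by auto
    have "h q \<in> V" if q: "q \<in> W" for q
    proof -
      obtain t where t: "\<bar>t\<bar> < min d (d2 / M)" "q = e p t" using W(3)[OF q] by blast
      obtain s where s: "\<bar>s\<bar> \<le> M * \<bar>t\<bar>" "h (e p t) = e' (h p) s" using M(3)[of t] t by auto
      have "M * \<bar>t\<bar> < d2" using t(1) M(1) by (simp add: pos_less_divide_eq mult.commute)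
      then show ?thesis using s d2(2)[of s] t(2) by simp
    qed
    then show "\<exists>T. openin (curve_top C) T \<and> p \<in> T \<and> T \<subseteq> {x \<in> TS C. h x \<in> V}"
      using W openin_subset[OF W(1)] by blast
  qed
qed

lemma affine_at_continuous:
  assumes C: "flowcurve C e" and D: "flowcurve D e'"
    and h: "h ` TS C \<subseteq> TS D"
    and aff: "\<And>p. p \<in> TS C \<Longrightarrow> \<exists>a. affine_at e e' h p a"
  shows "continuous_map (curve_top C) (curve_top D) h"
proof (rule flow_continuous[OF C D h])
  fix p assume "p \<in> TS C"
  then obtain a d where a: "a \<noteq> 0" "d > 0" "\<And>t. \<bar>t\<bar> < d \<Longrightarrow> h (e p t) = e' (h p) (a * t)"
    using aff unfolding affine_at_def by blast
  then show "\<exists>M>0. \<exists>d>0. \<forall>t. \<bar>t\<bar> < d \<longrightarrow> (\<exists>s. \<bar>s\<bar> \<le> M * \<bar>t\<bar> \<and> h (e p t) = e' (h p) s)"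
    by (intro exI[of _ "\<bar>a\<bar>"] conjI exI[of _ d] allI impI exI[of _ "a * _"]) (auto simp: abs_mult)
qed

lemma affine_at_inverse:
  assumes C: "flowcurve C e" and bij: "bij_betw h (topspace (curve_top C)) T"
    and p: "p \<in> topspace (curve_top C)" and aff: "affine_at e e' h p a"
    and k: "\<And>q. q \<in> topspace (curve_top C) \<Longrightarrow> k (h q) = q"
  shows "affine_at e' e k (h p) (1 / a)"
proof -
  obtain d where a: "a \<noteq> 0" "d > 0" "\<And>t. \<bar>t\<bar> < d \<Longrightarrow> h (e p t) = e' (h p) (a * t)"
    using aff by (auto simp: affine_at_def)
  obtain d2 where d2: "d2 > 0" "\<And>t. \<bar>t\<bar> < d2 \<Longrightarrow> e p t \<in> topspace (curve_top C)"
    using flowcurve_stay[OF C openin_topspace p] by blast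
  have "k (e' (h p) s) = e (k (h p)) (1 / a * s)" if "\<bar>s\<bar> < min d d2 * \<bar>a\<bar>" for s
  proof -
    have "\<bar>s\<bar> / \<bar>a\<bar> < min d d2" using that a(1) by (subst pos_divide_less_eq) auto
    then have t: "\<bar>s / a\<bar> < min d d2" by simp
    then have "e' (h p) s = h (e p (s / a))" using a(1) a(3)[of "s / a"] by simp
    then show ?thesis using k d2(2)[of "s / a"] t p by simp
  qed
  then show ?thesis unfolding affine_at_def using a d2 by (intro conjI exI[of _ "min d d2 * \<bar>a\<bar>"]) auto
qed

lemma locally_affineD:
  assumes L: "locally_affine C D h" and U: "(U, f) \<in> charts C" and V: "(V, g) \<in> charts D" and p: "p \<in> U" "h p \<in> V"
  shows "\<exists>a b W. a \<noteq> 0 \<and> openin (curve_top C) W \<and> p \<in> W \<and> W \<subseteq> U \<and> h ` W \<subseteq> V \<and> (\<forall>q \<in> W. g (h q) = a * f q + b)"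
  by (rule mp[OF bspec[OF bspec[OF bspec[OF L[unfolded locally_affine_def] U, unfolded split_conv] V, unfolded split_conv] p(1)] p(2)])

text \<open>Charts move with unit speed along the flow and are injective, so an affine formula in
  charts and a change of speed along the flow translate into each other.\<close>

lemma locally_affine_iff:
  assumes C: "flowcurve C e" and D: "flowcurve D e'"
    and h: "continuous_map (curve_top C) (curve_top D) h"
  shows "locally_affine C D h \<longleftrightarrow> (\<forall>p \<in> topspace (curve_top C). \<exists>a. affine_at e e' h p a)"
proof
  assume L: "locally_affine C D h"
  show "\<forall>p \<in> topspace (curve_top C). \<exists>a. affine_at e e' h p a"
  proof
    fix p assume p: "p \<in> topspace (curve_top C)"
    have hp: "h p \<in> topspace (curve_top D)" using h p by (auto simp: continuous_map_def)
    obtain U f where U: "(U, f) \<in> charts C" "p \<in> U" using flowcurve_cover[OF C p] by blast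
    obtain V g where V: "(V, g) \<in> charts D" "h p \<in> V" using flowcurve_cover[OF D hp] by blast
    obtain a b W where W: "a \<noteq> 0" "openin (curve_top C) W" "p \<in> W" "W \<subseteq> U" "h ` W \<subseteq> V" "\<And>q. q \<in> W \<Longrightarrow> g (h q) = a * f q + b"
      using locally_affineD[OF L U(1) V(1) U(2) V(2)] by blast
    obtain d1 where d1: "d1 > 0" "\<And>t. \<bar>t\<bar> < d1 \<Longrightarrow> e p t \<in> W" using flowcurve_stay[OF C W(2,3)] by blast
    obtain d2 where d2: "d2 > 0" "\<And>t. \<bar>t\<bar> < d2 \<Longrightarrow> f (e p t) = f p + t" using flowcurve_chart[OF C U(1)] U(2) by blast
    obtain d3 where d3: "d3 > 0" "\<And>t. \<bar>t\<bar> < d3 \<Longrightarrow> e' (h p) t \<in> V \<and> g (e' (h p) t) = g (h p) + t"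
      using flowcurve_chart[OF D V(1)] V(2) by blast
    have inj: "inj_on g V" using flowcurve_chart[OF D V(1)] by blast
    have "h (e p t) = e' (h p) (a * t)" if t: "\<bar>t\<bar> < min d1 (min d2 (d3 / \<bar>a\<bar>))" for t
    proof -
      have at: "\<bar>a * t\<bar> < d3" using t W(1) by (simp add: abs_mult pos_less_divide_eq mult.commute)
      have "g (h (e p t)) = a * f (e p t) + b" using W(6) d1(2) t by simp
      also have "\<dots> = g (h p) + a * t" using d2(2)[of t] t W(6)[OF W(3)] by (simp add: algebra_simps)
      also have "\<dots> = g (e' (h p) (a * t))" using d3(2)[OF at] by simp
      finally show ?thesis using W(5) d1(2)[of t] t d3(2)[OF at] by (intro inj_onD[OF inj]) auto
    qed
    then show "\<exists>a. affine_at e e' h p a" unfolding affine_at_def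
      using W(1) d1(1) d2(1) d3(1) by (intro exI[of _ a] conjI exI[of _ "min d1 (min d2 (d3 / \<bar>a\<bar>))"]) auto
  qed
next
  assume A: "\<forall>p \<in> topspace (curve_top C). \<exists>a. affine_at e e' h p a"
  have "\<exists>a b W. a \<noteq> 0 \<and> openin (curve_top C) W \<and> p \<in> W \<and> W \<subseteq> U \<and> h ` W \<subseteq> V \<and> (\<forall>q \<in> W. g (h q) = a * f q + b)"
    if U: "(U, f) \<in> charts C" "p \<in> U" and V: "(V, g) \<in> charts D" "h p \<in> V" for U f V g p
  proof -
    have p: "p \<in> topspace (curve_top C)" using U flowcurve_chart[OF C U(1)] openin_subset by blast
    obtain a d where a: "a \<noteq> 0" "d > 0" "\<And>t. \<bar>t\<bar> < d \<Longrightarrow> h (e p t) = e' (h p) (a * t)"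
      using A p unfolding affine_at_def by blast
    obtain d2 where d2: "d2 > 0" "\<And>t. \<bar>t\<bar> < d2 \<Longrightarrow> e p t \<in> U \<and> f (e p t) = f p + t" using flowcurve_chart[OF C U(1)] U(2) by blast
    obtain d3 where d3: "d3 > 0" "\<And>t. \<bar>t\<bar> < d3 \<Longrightarrow> e' (h p) t \<in> V \<and> g (e' (h p) t) = g (h p) + t"
      using flowcurve_chart[OF D V(1)] V(2) by blast
    let ?d = "min d (min d2 (d3 / \<bar>a\<bar>))"
    obtain W where W: "openin (curve_top C) W" "p \<in> W" "\<And>q. q \<in> W \<Longrightarrow> \<exists>t. \<bar>t\<bar> < ?d \<and> q = e p t"
      using flowcurve_nbhd[OF C p, of ?d] a(1,2) d2(1) d3(1) by auto
    have q: "q \<in> U \<and> h q \<in> V \<and> g (h q) = a * f q + (g (h p) - a * f p)" if q: "q \<in> W" for q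
    proof -
      obtain t where t: "\<bar>t\<bar> < ?d" "q = e p t" using W(3)[OF q] by blast
      have at: "\<bar>a * t\<bar> < d3" using t a(1) by (simp add: abs_mult pos_less_divide_eq mult.commute)
      show ?thesis using a(3)[of t] d2(2)[of t] d3(2)[OF at] t by (simp add: algebra_simps)
    qed
    show ?thesis
    proof (intro exI conjI subsetI ballI)
      show "a \<noteq> 0" "openin (curve_top C) W" "p \<in> W" by fact+
      show "x \<in> U" if "x \<in> W" for x using q[OF that] by blast
      show "y \<in> V" if "y \<in> h ` W" for y using that q by blast
      show "g (h x) = a * f x + (g (h p) - a * f p)" if "x \<in> W" for x using q[OF that] by blast
    qed
  qed
  then show "locally_affine C D h" unfolding locally_affine_def by (intro ballI case_prodI2 impI) blast
qed

text \<open>A bijection that changes the speed by a nonzero factor at each point has an inverse of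
  the same kind, so continuity in both directions comes for free.\<close>

lemma affine_iso_iff:
  assumes C: "flowcurve C e" and D: "flowcurve D e'"
  shows "affine_iso C D h \<longleftrightarrow> bij_betw h (topspace (curve_top C)) (topspace (curve_top D)) \<and>
    (\<forall>p \<in> topspace (curve_top C). \<exists>a. affine_at e e' h p a)" (is "_ \<longleftrightarrow> ?bij \<and> ?aff")
proof
  assume h: "affine_iso C D h"
  then have hm: "homeomorphic_map (curve_top C) (curve_top D) h" by (simp add: affine_iso_def)
  have ?bij using hm homeomorphic_imp_injective_map homeomorphic_imp_surjective_map unfolding bij_betw_def by blast
  moreover have ?aff using locally_affine_iff[OF C D homeomorphic_imp_continuous_map[OF hm]] h by (simp add: affine_iso_def)
  ultimately show "?bij \<and> ?aff" ..
next
  assume h: "?bij \<and> ?aff"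
  let ?T = "topspace (curve_top C)" and ?T' = "topspace (curve_top D)"
  define k where "k = inv_into ?T h"
  have kh: "k (h q) = q" if "q \<in> ?T" for q using h that by (simp add: k_def bij_betw_def)
  have hk: "h (k q) = q" "k q \<in> ?T" if "q \<in> ?T'" for q
    using h that by (auto simp: k_def bij_betw_def f_inv_into_f inv_into_into)
  have ch: "continuous_map (curve_top C) (curve_top D) h"
    by (rule affine_at_continuous[OF C D]) (use h in \<open>auto simp: bij_betw_def\<close>)
  have ck: "continuous_map (curve_top D) (curve_top C) k"
  proof (rule affine_at_continuous[OF D C])
    show "k ` ?T' \<subseteq> ?T" using hk by auto
    fix q assume q: "q \<in> ?T'"
    obtain a where "affine_at e e' h (k q) a" using h hk(2)[OF q] by blast
    then show "\<exists>a. affine_at e' e k q a"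
      using affine_at_inverse[of C e h ?T' "k q" e' a k] C h hk[OF q] kh by auto
  qed
  have "homeomorphic_map (curve_top C) (curve_top D) h"
    unfolding homeomorphic_map_maps homeomorphic_maps_def using ch ck kh hk by blast
  then show "affine_iso C D h" using locally_affine_iff[OF C D ch] h by (simp add: affine_iso_def)
qed

section \<open>The groupoid of piecewise affine isomorphisms\<close>

lemma pc_maps_iff:
  assumes C: "flowcurve C e" and D: "flowcurve D e'"
  shows "h \<in> pc_maps C D \<longleftrightarrow> (\<exists>F F'. finite F \<and> F \<subseteq> TS C \<and> finite F' \<and> F' \<subseteq> TS D \<and>
    bij_betw h (TS C - F) (TS D - F') \<and> (\<forall>p \<in> TS C - F. \<exists>a. affine_at e e' h p a))"
proof -
  have "affine_iso (curve_minus C F) (curve_minus D F') h \<longleftrightarrow>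
      bij_betw h (TS C - F) (TS D - F') \<and> (\<forall>p \<in> TS C - F. \<exists>a. affine_at e e' h p a)" if "finite F" "finite F'" for F F'
    using affine_iso_iff[OF flowcurve_minus[OF C that(1)] flowcurve_minus[OF D that(2)], of h] by simp
  then show ?thesis by (simp add: pc_maps_def cong: conj_cong)
qed

lemma affine_at_cong:
  assumes C: "flowcurve C e" and "p \<in> TS C" "affine_at e e' h p a" "finite {x \<in> TS C. h x \<noteq> k x}" "h p = k p"
  shows "affine_at e e' k p a"
proof -
  obtain d where a: "a \<noteq> 0" "d > 0" "\<And>t. \<bar>t\<bar> < d \<Longrightarrow> h (e p t) = e' (h p) (a * t)"
    using assms(3) by (auto simp: affine_at_def)
  obtain d2 where d2: "d2 > 0" "\<And>t. \<bar>t\<bar> < d2 \<Longrightarrow> e p t \<notin> {x \<in> TS C. h x \<noteq> k x}"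
    using flowcurve_avoid[OF C assms(2,4)] assms(5) by blast
  obtain d3 where d3: "d3 > 0" "\<And>t. \<bar>t\<bar> < d3 \<Longrightarrow> e p t \<in> TS C"
    using flowcurve_stay[OF C openin_topspace assms(2)] by blast
  have "k (e p t) = e' (k p) (a * t)" if "\<bar>t\<bar> < min d (min d2 d3)" for t
    using a(3)[of t] d2(2)[of t] d3(2)[of t] that assms(5) by auto
  then show ?thesis unfolding affine_at_def using a d2 d3 by (intro conjI exI[of _ "min d (min d2 d3)"]) auto
qed

lemma pc_maps_cong:
  assumes C: "flowcurve C e" and D: "flowcurve D e'" and h: "h \<in> pc_maps C D"
    and fin: "finite {x \<in> TS C. h x \<noteq> k x}"
  shows "k \<in> pc_maps C D"
proof -
  obtain F F' where F: "finite F" "F \<subseteq> TS C" "finite F'" "F' \<subseteq> TS D" "bij_betw h (TS C - F) (TS D - F')"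
    "\<forall>p \<in> TS C - F. \<exists>a. affine_at e e' h p a" using h pc_maps_iff[OF C D] by auto
  let ?N = "{x \<in> TS C. h x \<noteq> k x}"
  have "bij_betw h (TS C - F - (?N - F)) (TS D - F' - h ` (?N - F))"
    by (rule bij_betw_DiffI[OF F(5)]) (use F(5) in \<open>auto intro!: bij_betw_subset[OF F(5)] simp: bij_betw_def inj_on_def\<close>)
  moreover have "TS C - F - (?N - F) = TS C - (F \<union> ?N)" "TS D - F' - h ` (?N - F) = TS D - (F' \<union> h ` (?N - F))" by auto
  ultimately have "bij_betw h (TS C - (F \<union> ?N)) (TS D - (F' \<union> h ` (?N - F)))" by simp
  then have "bij_betw k (TS C - (F \<union> ?N)) (TS D - (F' \<union> h ` (?N - F)))"
    by (subst bij_betw_cong[symmetric, of _ h]) auto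
  moreover have "h ` (?N - F) \<subseteq> TS D" using F(5) by (auto simp: bij_betw_def)
  moreover have "\<exists>a. affine_at e e' k p a" if "p \<in> TS C - (F \<union> ?N)" for p
    using affine_at_cong[OF C _ _ fin, of p e'] F(6) that by blast
  ultimately show ?thesis
    unfolding pc_maps_iff[OF C D] using F fin by (intro exI[of _ "F \<union> ?N"] exI[of _ "F' \<union> h ` (?N - F)"]) auto
qed

lemma affine_at_comp: "affine_at e e' h p a \<Longrightarrow> affine_at e' e'' k (h p) b \<Longrightarrow> affine_at e e'' (k \<circ> h) p (b * a)"
proof -
  assume "affine_at e e' h p a" "affine_at e' e'' k (h p) b"
  then obtain d d2 where a: "a \<noteq> 0" "d > 0" "\<And>t. \<bar>t\<bar> < d \<Longrightarrow> h (e p t) = e' (h p) (a * t)"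
    and b: "b \<noteq> 0" "d2 > 0" "\<And>t. \<bar>t\<bar> < d2 \<Longrightarrow> k (e' (h p) t) = e'' (k (h p)) (b * t)"
    by (auto simp: affine_at_def)
  have "(k \<circ> h) (e p t) = e'' ((k \<circ> h) p) (b * a * t)" if t: "\<bar>t\<bar> < min d (d2 / \<bar>a\<bar>)" for t
  proof -
    have at: "\<bar>a * t\<bar> < d2" using t a(1) by (simp add: abs_mult pos_less_divide_eq mult.commute)
    show ?thesis using a(3)[of t] b(3)[OF at] t by (simp add: mult.assoc)
  qed
  then show ?thesis unfolding affine_at_def using a b by (intro conjI exI[of _ "min d (d2 / \<bar>a\<bar>)"]) auto
qed

lemma affine_at_id: "affine_at e e id p 1"
  unfolding affine_at_def by (auto intro: exI[of _ 1])

lemma pc_maps_id: assumes C: "flowcurve C e" shows "id \<in> pc_maps C C"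
  unfolding pc_maps_iff[OF C C] using affine_at_id[of e] by (intro exI[of _ "{}"]) auto

lemma pc_maps_cofinite:
  assumes C: "flowcurve C e" and D: "flowcurve D e'" and h: "h \<in> pc_maps C D"
  obtains F F' where "finite F" "F \<subseteq> TS C" "finite F'" "F' \<subseteq> TS D" "bij_betw h (TS C - F) (TS D - F')"
    "\<forall>p \<in> TS C - F. \<exists>a. affine_at e e' h p a"
  using h pc_maps_iff[OF C D] by auto

text \<open>A criterion that avoids exhibiting the two removed finite sets: it suffices that
  \<open>h\<close> and a candidate inverse behave well up to finitely many points.\<close>

lemma pc_mapsI:
  assumes C: "flowcurve C e" and D: "flowcurve D e'"
    and h: "finite {p \<in> TS C. \<not> (h p \<in> TS D \<and> k (h p) = p \<and> (\<exists>a. affine_at e e' h p a))}"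
    and k: "finite {q \<in> TS D. \<not> (k q \<in> TS C \<and> h (k q) = q)}"
  shows "h \<in> pc_maps C D"
proof -
  let ?N = "{p \<in> TS C. \<not> (h p \<in> TS D \<and> k (h p) = p \<and> (\<exists>a. affine_at e e' h p a))}"
    and ?M = "{q \<in> TS D. \<not> (k q \<in> TS C \<and> h (k q) = q)}"
  have inj: "inj_on h (TS C - ?N)" by (rule inj_on_inverseI[of _ k]) auto
  have injk: "inj_on k (TS D - ?M)" by (rule inj_on_inverseI[of _ h]) auto
  \<comment> \<open>A point missed by the good part of \<open>h\<close> is either bad for
    \<open>k\<close> or sent by \<open>k\<close> to a bad point of \<open>h\<close>. Since
    \<open>k\<close> is injective off \<open>?M\<close>, there are finitely many of the
    latter.\<close>
  let ?F = "TS D - h ` (TS C - ?N)"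
  have "?F \<subseteq> ?M \<union> (k -` ?N \<inter> (TS D - ?M))"
  proof
    fix q assume q: "q \<in> ?F"
    show "q \<in> ?M \<union> (k -` ?N \<inter> (TS D - ?M))"
    proof (rule ccontr)
      assume "\<not> ?thesis"
      then have 1: "k q \<in> TS C - ?N" "h (k q) = q" using q by auto
      have "h (k q) \<in> h ` (TS C - ?N)" by (rule imageI) (rule 1(1))
      then have "q \<in> h ` (TS C - ?N)" unfolding 1(2) .
      then show False using q by blast
    qed
  qed
  moreover have "finite (k -` ?N \<inter> (TS D - ?M))" using finite_vimage_IntI[OF h injk] .
  ultimately have "finite ?F" using k finite_subset by blast
  moreover have "bij_betw h (TS C - ?N) (TS D - ?F)"
    unfolding bij_betw_def using inj by auto
  ultimately show ?thesis unfolding pc_maps_iff[OF C D]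
  proof (intro exI conjI)
    show "finite ?N" by (rule h)
    show "?N \<subseteq> TS C" "?F \<subseteq> TS D" by blast+
    show "\<forall>p\<in>TS C - ?N. \<exists>a. affine_at e e' h p a" by blast
  qed
qed

lemma finite_vimage_pc:
  assumes C: "flowcurve C e" and D: "flowcurve D e'" and h: "h \<in> pc_maps C D" and N: "finite N"
  shows "finite {p \<in> TS C. h p \<in> N}" "finite {p \<in> TS C. h p \<notin> TS D}"
proof -
  obtain F F' where F: "finite F" "bij_betw h (TS C - F) (TS D - F')" using pc_maps_cofinite[OF C D h] by metis
  have "finite (h -` N \<inter> (TS C - F))"
    by (rule finite_vimage_IntI[OF N]) (use F(2) in \<open>auto simp: bij_betw_def\<close>)
  then have "finite (F \<union> (h -` N \<inter> (TS C - F)))" using F(1) by simp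
  then show "finite {p \<in> TS C. h p \<in> N}" by (rule rev_finite_subset) auto
  show "finite {p \<in> TS C. h p \<notin> TS D}"
    by (rule rev_finite_subset[OF F(1)]) (use F(2) in \<open>auto simp: bij_betw_def\<close>)
qed

lemma pc_maps_comp:
  assumes C: "flowcurve C e" and D: "flowcurve D e'" and E: "flowcurve E e''"
    and h: "h \<in> pc_maps C D" and k: "k \<in> pc_maps D E"
  shows "k \<circ> h \<in> pc_maps C E"
proof -
  obtain F F' where F: "finite F" "F \<subseteq> TS C" "finite F'" "F' \<subseteq> TS D" "bij_betw h (TS C - F) (TS D - F')"
    "\<forall>p \<in> TS C - F. \<exists>a. affine_at e e' h p a" using pc_maps_cofinite[OF C D h] by metis
  obtain G G' where G: "finite G" "G \<subseteq> TS D" "finite G'" "G' \<subseteq> TS E" "bij_betw k (TS D - G) (TS E - G')"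
    "\<forall>p \<in> TS D - G. \<exists>a. affine_at e' e'' k p a" using pc_maps_cofinite[OF D E k] by metis
  let ?F = "F \<union> {p \<in> TS C. h p \<in> G}" and ?G = "G' \<union> k ` (F' - G)"
  have "bij_betw h (TS C - ?F) (TS D - (F' \<union> G))"
    using F(5) unfolding bij_betw_def by (auto simp: inj_on_def; blast)
  moreover have "bij_betw k (TS D - (F' \<union> G)) (TS E - ?G)"
    using G(5) F(4) unfolding bij_betw_def by (auto simp: inj_on_def; blast)
  ultimately have "bij_betw (k \<circ> h) (TS C - ?F) (TS E - ?G)" by (rule bij_betw_trans)
  moreover have "finite ?F" using F(1) finite_vimage_pc(1)[OF C D h G(1)] by simp
  moreover have "?G \<subseteq> TS E" using G(4,5) F(4) by (auto simp: bij_betw_def)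
  moreover have "\<exists>a. affine_at e e'' (k \<circ> h) p a" if p: "p \<in> TS C - ?F" for p
  proof -
    have "h p \<in> TS D - G" using p F(5) by (auto simp: bij_betw_def)
    then obtain b where b: "affine_at e' e'' k (h p) b" using G(6) by blast
    obtain a where "affine_at e e' h p a" using F(6) p by blast
    from affine_at_comp[OF this b] show ?thesis by blast
  qed
  ultimately show ?thesis
    unfolding pc_maps_iff[OF C E] using F(1,2,3) G(3) by (intro exI[of _ ?F] exI[of _ ?G]) auto
qed

lemma pc_maps_inverse:
  assumes C: "flowcurve C e" and D: "flowcurve D e'" and h: "h \<in> pc_maps C D"
  obtains k where "k \<in> pc_maps D C" "finite {p \<in> TS C. k (h p) \<noteq> p}" "finite {q \<in> TS D. h (k q) \<noteq> q}"
proof -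
  obtain F F' where F: "finite F" "F \<subseteq> TS C" "finite F'" "F' \<subseteq> TS D" "bij_betw h (TS C - F) (TS D - F')"
    "\<forall>p \<in> TS C - F. \<exists>a. affine_at e e' h p a" using pc_maps_cofinite[OF C D h] by metis
  define k where "k = inv_into (TS C - F) h"
  have kh: "k (h p) = p" if "p \<in> TS C - F" for p using F(5) that by (simp add: k_def bij_betw_def)
  have hk: "h (k q) = q" "k q \<in> TS C - F" if "q \<in> TS D - F'" for q
  proof -
    have "q \<in> h ` (TS C - F)" using F(5) that by (simp add: bij_betw_def)
    then show "h (k q) = q" "k q \<in> TS C - F" unfolding k_def by (rule f_inv_into_f, rule inv_into_into)
  qed
  have "bij_betw k (TS D - F') (TS C - F)" unfolding k_def by (rule bij_betw_inv_into[OF F(5)])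
  moreover have "\<exists>a. affine_at e' e k q a" if q: "q \<in> TS D - F'" for q
  proof -
    obtain a where "affine_at e e' h (k q) a" using F(6) hk(2)[OF q] by blast
    then show ?thesis
      using affine_at_inverse[OF flowcurve_minus[OF C F(1)], of h "TS D - F'" "k q" e' a k] F(5) kh hk[OF q] by auto
  qed
  ultimately have "k \<in> pc_maps D C"
    unfolding pc_maps_iff[OF D C] using F(1-4) by (intro exI[of _ F'] exI[of _ F]) auto
  moreover have "finite {p \<in> TS C. k (h p) \<noteq> p}" by (rule rev_finite_subset[OF F(1)]) (use kh in auto)
  moreover have "finite {q \<in> TS D. h (k q) \<noteq> q}" by (rule rev_finite_subset[OF F(3)]) (use hk in auto)
  ultimately show thesis using that by blast
qed

abbreviation pc_class :: "'a curve \<Rightarrow> 'b curve \<Rightarrow> ('a \<Rightarrow> 'b) \<Rightarrow> ('a \<Rightarrow> 'b) set" where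
  "pc_class C D h \<equiv> pc_rel C D `` {h}"

lemma pc_rel_equiv: "equiv (pc_maps C D) (pc_rel C D)"
proof (rule equivI)
  show "refl_on (pc_maps C D) (pc_rel C D)" by (auto simp: refl_on_def pc_rel_def)
  show "sym (pc_rel C D)"
  proof (rule symI)
    fix h k assume a: "(h, k) \<in> pc_rel C D"
    have "{x \<in> TS C. k x \<noteq> h x} = {x \<in> TS C. h x \<noteq> k x}" by auto
    then show "(k, h) \<in> pc_rel C D" using a by (simp add: pc_rel_def)
  qed
  show "trans (pc_rel C D)"
  proof (rule transI)
    fix x y z assume a: "(x, y) \<in> pc_rel C D" "(y, z) \<in> pc_rel C D"
    have "finite ({p \<in> TS C. x p \<noteq> y p} \<union> {p \<in> TS C. y p \<noteq> z p})" using a by (simp add: pc_rel_def)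
    then have "finite {p \<in> TS C. x p \<noteq> z p}" by (rule rev_finite_subset) auto
    then show "(x, z) \<in> pc_rel C D" using a by (simp add: pc_rel_def)
  qed
qed (auto simp: pc_rel_def)

lemma pc_class_eq_iff: "h \<in> pc_maps C D \<Longrightarrow> k \<in> pc_maps C D \<Longrightarrow> pc_class C D h = pc_class C D k \<longleftrightarrow> finite {x \<in> TS C. h x \<noteq> k x}"
  using eq_equiv_class_iff[OF pc_rel_equiv, of h C D k] by (auto simp: pc_rel_def)

lemma PC_iso_pc_class: "h \<in> pc_maps C D \<Longrightarrow> pc_class C D h \<in> PC_iso C D"
  unfolding PC_iso_def by (rule quotientI)

lemma PC_isoE: assumes "\<phi> \<in> PC_iso C D" obtains h where "h \<in> pc_maps C D" "\<phi> = pc_class C D h"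
  using assms unfolding PC_iso_def by (rule quotientE)

lemma pc_rel_iff: "(h, k) \<in> pc_rel C D \<longleftrightarrow> h \<in> pc_maps C D \<and> k \<in> pc_maps C D \<and> finite {x \<in> TS C. h x \<noteq> k x}"
  by (auto simp: pc_rel_def)

lemma comp_cofinite:
  assumes C: "flowcurve C e" and D: "flowcurve D e'" and h: "h \<in> pc_maps C D"
    and fh: "finite {x \<in> TS C. h x \<noteq> h' x}" and fk: "finite {x \<in> TS D. k x \<noteq> k' x}"
  shows "finite {x \<in> TS C. (k \<circ> h) x \<noteq> (k' \<circ> h') x}"
proof -
  have "finite ({x \<in> TS C. h x \<noteq> h' x} \<union> {p \<in> TS C. h p \<in> {x \<in> TS D. k x \<noteq> k' x}} \<union> {p \<in> TS C. h p \<notin> TS D})"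
    using fh finite_vimage_pc[OF C D h fk] by simp
  then show ?thesis by (rule rev_finite_subset) auto
qed

lemma pc_comp_pc_class:
  assumes C: "flowcurve C e" and D: "flowcurve D e'" and E: "flowcurve E e''"
    and h: "h \<in> pc_maps C D" and k: "k \<in> pc_maps D E"
  shows "pc_comp C E (pc_class D E k) (pc_class C D h) = pc_class C E (k \<circ> h)"
proof -
  have "pc_class C E (k' \<circ> h') = pc_class C E (k \<circ> h)" if "k' \<in> pc_class D E k" "h' \<in> pc_class C D h" for k' h'
  proof -
    have a: "h' \<in> pc_maps C D" "k' \<in> pc_maps D E" using that by (auto simp: pc_rel_iff)
    have "finite {x \<in> TS C. (k \<circ> h) x \<noteq> (k' \<circ> h') x}"
      by (rule comp_cofinite[OF C D h]) (use that in \<open>auto simp: pc_rel_iff\<close>)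
    then show ?thesis using pc_class_eq_iff[OF pc_maps_comp[OF C D E h k] pc_maps_comp[OF C D E a]] by simp
  qed
  moreover have "k \<in> pc_class D E k" "h \<in> pc_class C D h" using h k by (auto simp: pc_rel_iff)
  ultimately show ?thesis unfolding pc_comp_def by blast
qed

text \<open>\<open>pc_inv\<close> mentions one side only. A left inverse agrees cofinitely with the
  two-sided inverse \<open>k0\<close>, as both equal \<open>k \<circ> h \<circ> k0\<close> off a
  finite set.\<close>

lemma inverse_sides:
  assumes C: "flowcurve C e" and D: "flowcurve D e'" and h: "h \<in> pc_maps C D" and k: "k \<in> pc_maps D C"
    and kh: "finite {p \<in> TS C. k (h p) \<noteq> p}"
  shows "finite {q \<in> TS D. h (k q) \<noteq> q}"
proof -
  obtain k0 where k0: "k0 \<in> pc_maps D C" "finite {p \<in> TS C. k0 (h p) \<noteq> p}" "finite {q \<in> TS D. h (k0 q) \<noteq> q}"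
    using pc_maps_inverse[OF C D h] .
  have "finite {q \<in> TS D. ((k \<circ> h) \<circ> k0) q \<noteq> (id \<circ> k0) q}"
    by (rule comp_cofinite[OF D C k0(1)]) (use kh in auto)
  moreover have "finite {q \<in> TS D. (k \<circ> (h \<circ> k0)) q \<noteq> (k \<circ> id) q}"
    by (rule comp_cofinite[OF D D pc_maps_comp[OF D C D k0(1) h]]) (use k0(3) in auto)
  ultimately have "finite ({q \<in> TS D. ((k \<circ> h) \<circ> k0) q \<noteq> (id \<circ> k0) q} \<union> {q \<in> TS D. (k \<circ> (h \<circ> k0)) q \<noteq> (k \<circ> id) q})" by simp
  then have kk: "finite {q \<in> TS D. k q \<noteq> k0 q}" by (rule rev_finite_subset) auto
  have "finite {q \<in> TS D. (h \<circ> k) q \<noteq> (h \<circ> k0) q}" by (rule comp_cofinite[OF D C k kk]) simp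
  then have "finite ({q \<in> TS D. (h \<circ> k) q \<noteq> (h \<circ> k0) q} \<union> {q \<in> TS D. h (k0 q) \<noteq> q})" using k0(3) by simp
  then show ?thesis by (rule rev_finite_subset) auto
qed

lemma inverse_unique:
  assumes C: "flowcurve C e" and D: "flowcurve D e'" and h: "h \<in> pc_maps C D" and k: "k \<in> pc_maps D C" "k' \<in> pc_maps D C"
    and kh: "finite {p \<in> TS C. k (h p) \<noteq> p}" "finite {p \<in> TS C. k' (h p) \<noteq> p}"
  shows "finite {q \<in> TS D. k q \<noteq> k' q}"
proof -
  have hk: "finite {q \<in> TS D. h (k q) \<noteq> q}" by (rule inverse_sides[OF C D h k(1) kh(1)])
  have "finite {q \<in> TS D. ((k' \<circ> h) \<circ> k) q \<noteq> (id \<circ> k) q}"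
    by (rule comp_cofinite[OF D C k(1)]) (use kh(2) in auto)
  moreover have "finite {q \<in> TS D. (k' \<circ> (h \<circ> k)) q \<noteq> (k' \<circ> id) q}"
    by (rule comp_cofinite[OF D D pc_maps_comp[OF D C D k(1) h]]) (use hk in auto)
  ultimately have "finite ({q \<in> TS D. ((k' \<circ> h) \<circ> k) q \<noteq> (id \<circ> k) q} \<union> {q \<in> TS D. (k' \<circ> (h \<circ> k)) q \<noteq> (k' \<circ> id) q})" by simp
  then show ?thesis by (rule rev_finite_subset) auto
qed

lemma pc_inv_pc_class:
  assumes C: "flowcurve C e" and D: "flowcurve D e'" and h: "h \<in> pc_maps C D" and k: "k \<in> pc_maps D C"
    and kh: "finite {p \<in> TS C. k (h p) \<noteq> p}"
  shows "pc_inv C D (pc_class C D h) = pc_class D C k"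
proof (intro equalityI subsetI)
  fix k' assume "k' \<in> pc_inv C D (pc_class C D h)"
  then obtain h' where h': "k' \<in> pc_maps D C" "h' \<in> pc_class C D h" "(k' \<circ> h', id) \<in> pc_rel C C" by (auto simp: pc_inv_def)
  then have hm: "h' \<in> pc_maps C D" "finite {x \<in> TS C. h x \<noteq> h' x}" by (auto simp: pc_rel_iff)
  have "finite {x \<in> TS C. (k' \<circ> h) x \<noteq> (k' \<circ> h') x}" by (rule comp_cofinite[OF C D h hm(2)]) simp
  moreover have "finite {x \<in> TS C. (k' \<circ> h') x \<noteq> id x}" using h'(3) by (simp add: pc_rel_def)
  ultimately have "finite ({x \<in> TS C. (k' \<circ> h) x \<noteq> (k' \<circ> h') x} \<union> {x \<in> TS C. (k' \<circ> h') x \<noteq> id x})" by simp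
  then have "finite {p \<in> TS C. k' (h p) \<noteq> p}" by (rule rev_finite_subset) auto
  then show "k' \<in> pc_class D C k" using inverse_unique[OF C D h k h'(1) kh] k h'(1) by (simp add: pc_rel_iff)
next
  fix k' assume k': "k' \<in> pc_class D C k"
  then have km: "k' \<in> pc_maps D C" "finite {x \<in> TS D. k x \<noteq> k' x}" by (auto simp: pc_rel_iff)
  have "finite {x \<in> TS C. (k \<circ> h) x \<noteq> (k' \<circ> h) x}" by (rule comp_cofinite[OF C D h _ km(2)]) simp
  then have "finite ({x \<in> TS C. (k \<circ> h) x \<noteq> (k' \<circ> h) x} \<union> {p \<in> TS C. k (h p) \<noteq> p})" using kh by simp
  then have "finite {x \<in> TS C. (k' \<circ> h) x \<noteq> id x}" by (rule rev_finite_subset) auto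
  then have "(k' \<circ> h, id) \<in> pc_rel C C"
    using pc_maps_comp[OF C D C h km(1)] pc_maps_id[OF C] by (simp add: pc_rel_def)
  moreover have "h \<in> pc_class C D h" using h by (auto simp: pc_rel_iff)
  ultimately show "k' \<in> pc_inv C D (pc_class C D h)" using km(1) by (auto simp: pc_inv_def)
qed

lemma PC_group_simps [simp]:
  "carrier (PC_group C) = PC_iso C C" "mult (PC_group C) = pc_comp C C" "one (PC_group C) = pc_class C C id"
  by (simp_all add: PC_group_def)

lemma PC_group_group:
  assumes C: "flowcurve C e" shows "group (PC_group C)"
proof (rule groupI)
  fix x y assume "x \<in> carrier (PC_group C)" "y \<in> carrier (PC_group C)"
  then obtain h k where hk: "h \<in> pc_maps C C" "x = pc_class C C h" "k \<in> pc_maps C C" "y = pc_class C C k"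
    by (auto elim!: PC_isoE)
  then show "x \<otimes>\<^bsub>PC_group C\<^esub> y \<in> carrier (PC_group C)"
    using pc_comp_pc_class[OF C C C hk(3,1)] PC_iso_pc_class[OF pc_maps_comp[OF C C C hk(3,1)]] by (simp add: hk(2,4))
next
  show "\<one>\<^bsub>PC_group C\<^esub> \<in> carrier (PC_group C)" using pc_maps_id[OF C] PC_iso_pc_class by simp
next
  fix x y z assume "x \<in> carrier (PC_group C)" "y \<in> carrier (PC_group C)" "z \<in> carrier (PC_group C)"
  then obtain h k j where hk: "h \<in> pc_maps C C" "x = pc_class C C h" "k \<in> pc_maps C C" "y = pc_class C C k" "j \<in> pc_maps C C" "z = pc_class C C j"
    by (auto elim!: PC_isoE)
  then show "x \<otimes>\<^bsub>PC_group C\<^esub> y \<otimes>\<^bsub>PC_group C\<^esub> z = x \<otimes>\<^bsub>PC_group C\<^esub> (y \<otimes>\<^bsub>PC_group C\<^esub> z)"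
    using pc_comp_pc_class[OF C C C] pc_maps_comp[OF C C C] by (simp add: hk comp_assoc)
next
  fix x assume "x \<in> carrier (PC_group C)"
  then obtain h where h: "h \<in> pc_maps C C" "x = pc_class C C h" by (auto elim!: PC_isoE)
  show "\<one>\<^bsub>PC_group C\<^esub> \<otimes>\<^bsub>PC_group C\<^esub> x = x"
    using pc_comp_pc_class[OF C C C h(1) pc_maps_id[OF C]] by (simp add: h)
  obtain k where k: "k \<in> pc_maps C C" "finite {p \<in> TS C. k (h p) \<noteq> p}" using pc_maps_inverse[OF C C h(1)] by metis
  have "pc_class C C (k \<circ> h) = pc_class C C id"
    using k(2) by (subst pc_class_eq_iff) (auto intro: pc_maps_comp[OF C C C h(1) k(1)] pc_maps_id[OF C])
  then show "\<exists>y\<in>carrier (PC_group C). y \<otimes>\<^bsub>PC_group C\<^esub> x = \<one>\<^bsub>PC_group C\<^esub>"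
    using pc_comp_pc_class[OF C C C h(1) k(1)] PC_iso_pc_class[OF k(1)] by (intro bexI[of _ "pc_class C C k"]) (simp_all add: h)
qed

lemma PC_group_inv:
  assumes C: "flowcurve C e" and h: "h \<in> pc_maps C C" and k: "k \<in> pc_maps C C" and kh: "finite {p \<in> TS C. k (h p) \<noteq> p}"
  shows "m_inv (PC_group C) (pc_class C C h) = pc_class C C k"
proof (rule group.inv_equality[OF PC_group_group[OF C]])
  have "pc_class C C (k \<circ> h) = pc_class C C id"
    using kh by (subst pc_class_eq_iff) (auto intro: pc_maps_comp[OF C C C h k] pc_maps_id[OF C])
  then show "pc_class C C k \<otimes>\<^bsub>PC_group C\<^esub> pc_class C C h = \<one>\<^bsub>PC_group C\<^esub>" using pc_comp_pc_class[OF C C C h k] by simp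
qed (use h k PC_iso_pc_class in auto)

lemma PC_group_pow:
  assumes C: "flowcurve C e" and h: "h \<in> pc_maps C C"
  shows "h ^^ n \<in> pc_maps C C \<and> pc_class C C h [^]\<^bsub>PC_group C\<^esub> n = pc_class C C (h ^^ n)"
proof (induction n)
  case 0
  then show ?case using pc_maps_id[OF C] by (simp add: id_def[symmetric])
next
  case (Suc n)
  have "pc_class C C h [^]\<^bsub>PC_group C\<^esub> Suc n = pc_class C C (h ^^ n \<circ> h)" using pc_comp_pc_class[OF C C C h, of "h ^^ n"] Suc by simp
  moreover have "h ^^ n \<circ> h \<in> pc_maps C C" using pc_maps_comp[OF C C C h] Suc by blast
  ultimately show ?case unfolding funpow_Suc_right by blast
qed

section \<open>Standard curves\<close>

lemma flowcurve_RZ: "flowcurve RZ (\<lambda>z t. rotation t z)"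
proof -
  have open_im: "open (to_rz ` {a<..<b})" for a b
  proof -
    have "to_rz -` to_rz ` {a<..<b} = (\<Union>k::int. {a + of_int k<..<b + of_int k})"
    proof (intro equalityI subsetI)
      fix x assume "x \<in> to_rz -` to_rz ` {a<..<b}"
      then obtain y where y: "a < y" "y < b" "x - y \<in> \<int>" by (auto simp: to_rz_eq_iff)
      then obtain k where "x = y + of_int k" by (metis Ints_cases add.commute diff_add_cancel)
      then show "x \<in> (\<Union>k::int. {a + of_int k<..<b + of_int k})" using y by (intro UN_I[of k]) auto
    next
      fix x assume "x \<in> (\<Union>k::int. {a + of_int k<..<b + of_int k})"
      then obtain k :: int where k: "a < x - of_int k" "x - of_int k < b" by (auto simp: algebra_simps)
      moreover have "to_rz x = to_rz (x - of_int k)" by (simp add: to_rz_eq_iff)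
      ultimately show "x \<in> to_rz -` to_rz ` {a<..<b}" by auto
    qed
    then show ?thesis by (simp add: open_rz_def open_UN)
  qed
  have inj: "inj_on to_rz {a<..<a + 1}" for a
  proof (rule inj_onI)
    fix x y assume a: "x \<in> {a<..<a + 1}" "y \<in> {a<..<a + 1}" "to_rz x = to_rz y"
    then have "x - y \<in> \<int>" "\<bar>x - y\<bar> < 1" by (auto simp: to_rz_eq_iff)
    then show "x = y" using Ints_abs_less_1 by force
  qed
  show ?thesis
  proof (rule flowcurveI)
    fix W p assume W: "openin (curve_top RZ) W" "p \<in> W"
    obtain x where x: "p = to_rz x" by (rule to_rz_cases)
    have "open (to_rz -` W)" using W by (simp add: RZ_def open_rz_def)
    moreover have "x \<in> to_rz -` W" using W x by simp
    ultimately obtain d where d: "d > 0" "\<forall>y. dist y x < d \<longrightarrow> y \<in> to_rz -` W" unfolding open_dist by blast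
    show "\<exists>d>0. \<forall>t. \<bar>t\<bar> < d \<longrightarrow> rotation t p \<in> W"
      by (intro exI[of _ d]) (use d in \<open>auto simp: x rotation_to_rz dist_real_def\<close>)
  next
    fix p and d :: real assume d: "d > 0"
    obtain x where x: "p = to_rz x" by (rule to_rz_cases)
    show "\<exists>W. openin (curve_top RZ) W \<and> p \<in> W \<and> (\<forall>q\<in>W. \<exists>t. \<bar>t\<bar> < d \<and> q = rotation t p)"
    proof (intro exI[of _ "to_rz ` {x - d<..<x + d}"] conjI ballI)
      show "openin (curve_top RZ) (to_rz ` {x - d<..<x + d})" using open_im by (simp add: RZ_def)
      show "p \<in> to_rz ` {x - d<..<x + d}" using d x by auto
      fix q assume "q \<in> to_rz ` {x - d<..<x + d}"
      then obtain y where y: "x - d < y" "y < x + d" "q = to_rz y" by auto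
      then show "\<exists>t. \<bar>t\<bar> < d \<and> q = rotation t p" by (intro exI[of _ "y - x"]) (auto simp: x rotation_to_rz)
    qed
  next
    fix U f assume "(U, f) \<in> charts RZ"
    then obtain a where U: "U = to_rz ` {a<..<a + 1}" and f: "f = inv_into {a<..<a + 1} to_rz" by (auto simp: RZ_def)
    have "\<exists>d>0. \<forall>t. \<bar>t\<bar> < d \<longrightarrow> rotation t p \<in> U \<and> f (rotation t p) = f p + t" if p: "p \<in> U" for p
    proof -
      obtain x where x: "a < x" "x < a + 1" "p = to_rz x" using p U by auto
      have fx: "f (to_rz y) = y" if "a < y" "y < a + 1" for y
        unfolding f using that by (intro inv_into_f_f inj) auto
      have "rotation t p \<in> U \<and> f (rotation t p) = f p + t" if t: "\<bar>t\<bar> < min (x - a) (a + 1 - x)" for t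
      proof -
        have "a < x + t" "x + t < a + 1" using t by auto
        then show ?thesis using fx x U by (simp add: rotation_to_rz)
      qed
      then show ?thesis using x by (intro exI[of _ "min (x - a) (a + 1 - x)"]) auto
    qed
    moreover have "inj_on f U" unfolding f U by (rule inj_on_inv_into) simp
    ultimately show "openin (curve_top RZ) U \<and> inj_on f U \<and>
        (\<forall>p\<in>U. \<exists>d>0. \<forall>t. \<bar>t\<bar> < d \<longrightarrow> rotation t p \<in> U \<and> f (rotation t p) = f p + t)"
      using open_im U by (simp add: RZ_def)
  next
    fix p
    obtain x where x: "p = to_rz x" by (rule to_rz_cases)
    let ?I = "{x - 1/2<..<x - 1/2 + 1}"
    have "p \<in> to_rz ` ?I" unfolding x by (rule imageI) simp
    moreover have "(to_rz ` ?I, inv_into ?I to_rz) \<in> charts RZ" unfolding RZ_def curve.select_convs by blast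
    ultimately show "\<exists>U f. (U, f) \<in> charts RZ \<and> p \<in> U" by blast
  next
    fix p q :: rz assume "p \<noteq> q"
    then show "\<exists>d>0. \<forall>t. \<bar>t\<bar> < d \<longrightarrow> rotation t p \<noteq> q" using rz_local_eq[of q p] by metis
  qed
qed

lemma TS_RZ [simp]: "TS RZ = UNIV" by (simp add: RZ_def)

lemma flowcurve_interval: "flowcurve (interval_curve a b) (\<lambda>x t. x + t)"
proof (rule flowcurveI)
  fix W p assume W: "openin (curve_top (interval_curve a b)) W" "p \<in> W"
  then have "open W" by (auto simp: interval_curve_def openin_open_eq)
  then obtain d where "d > 0" "\<forall>y. dist y p < d \<longrightarrow> y \<in> W" using W(2) unfolding open_dist by blast
  then show "\<exists>d>0. \<forall>t. \<bar>t\<bar> < d \<longrightarrow> p + t \<in> W" by (intro exI[of _ d]) (auto simp: dist_real_def)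
next
  fix p d :: real assume p: "p \<in> TS (interval_curve a b)" "d > 0"
  have "openin (top_of_set {a<..<b}) ({a<..<b} \<inter> {p - d<..<p + d})" by (rule openin_open_Int) simp
  then show "\<exists>W. openin (curve_top (interval_curve a b)) W \<and> p \<in> W \<and> (\<forall>q\<in>W. \<exists>t. \<bar>t\<bar> < d \<and> q = p + t)"
    using p by (intro exI[of _ "{a<..<b} \<inter> {p - d<..<p + d}"])
      (auto simp: interval_curve_def intro!: exI[of _ "_ - p"])
next
  fix U f assume "(U, f) \<in> charts (interval_curve a b)"
  then have U: "U = {a<..<b}" "f = id" by (auto simp: interval_curve_def)
  have "\<exists>d>0. \<forall>t. \<bar>t\<bar> < d \<longrightarrow> p + t \<in> U \<and> f (p + t) = f p + t" if "p \<in> U" for p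
    using that U by (intro exI[of _ "min (p - a) (b - p)"]) auto
  then show "openin (curve_top (interval_curve a b)) U \<and> inj_on f U \<and>
        (\<forall>p\<in>U. \<exists>d>0. \<forall>t. \<bar>t\<bar> < d \<longrightarrow> p + t \<in> U \<and> f (p + t) = f p + t)"
    using U by (simp add: interval_curve_def)
next
  fix p q :: real assume "p \<noteq> q"
  then show "\<exists>d>0. \<forall>t. \<bar>t\<bar> < d \<longrightarrow> p + t \<noteq> q" by (intro exI[of _ "\<bar>q - p\<bar>"]) auto
qed (auto simp: interval_curve_def)

lemma TS_copy: "TS (copy_curve i j C) = j -` TS C \<inter> range i"
  by (simp add: copy_curve_def topspace_pullback_topology)

lemma flowcurve_copy:
  assumes C: "flowcurve C e" and ji: "\<And>x. j (i x) = x"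
  shows "flowcurve (copy_curve i j C) (\<lambda>p t. i (e (j p) t))"
proof -
  have op: "openin (curve_top (copy_curve i j C)) W \<longleftrightarrow> (\<exists>V. openin (curve_top C) V \<and> W = i ` V)" for W
  proof -
    have "j -` V \<inter> range i = i ` V" for V using ji by auto
    then show ?thesis by (simp add: copy_curve_def openin_pullback_topology)
  qed
  have T: "TS (copy_curve i j C) = i ` TS C" unfolding TS_copy using ji by (auto simp: image_iff)
  show ?thesis
  proof (rule flowcurveI)
    fix W p assume W: "openin (curve_top (copy_curve i j C)) W" "p \<in> W"
    then obtain V x where V: "openin (curve_top C) V" "W = i ` V" "p = i x" "x \<in> V" using op by auto
    then show "\<exists>d>0. \<forall>t. \<bar>t\<bar> < d \<longrightarrow> i (e (j p) t) \<in> W" using flowcurve_stay[OF C V(1,4)] ji by auto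
  next
    fix p and d :: real assume p: "p \<in> TS (copy_curve i j C)" "d > 0"
    then obtain x where x: "p = i x" "x \<in> TS C" using T by auto
    obtain W where W: "openin (curve_top C) W" "x \<in> W" "\<forall>q\<in>W. \<exists>t. \<bar>t\<bar> < d \<and> q = e x t"
      using flowcurve_nbhd[OF C x(2) p(2)] by blast
    show "\<exists>W. openin (curve_top (copy_curve i j C)) W \<and> p \<in> W \<and> (\<forall>q\<in>W. \<exists>t. \<bar>t\<bar> < d \<and> q = i (e (j p) t))"
      by (rule exI[of _ "i ` W"]) (use W x op ji in auto)
  next
    fix U f assume "(U, f) \<in> charts (copy_curve i j C)"
    then obtain V g where V: "(V, g) \<in> charts C" "U = i ` V" "f = g \<circ> j" by (auto simp: copy_curve_def)
    note Vc = flowcurve_chart[OF C V(1)]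
    have "inj_on f U" using Vc ji by (auto simp: V inj_on_def)
    then show "openin (curve_top (copy_curve i j C)) U \<and> inj_on f U \<and>
        (\<forall>p\<in>U. \<exists>d>0. \<forall>t. \<bar>t\<bar> < d \<longrightarrow> i (e (j p) t) \<in> U \<and> f (i (e (j p) t)) = f p + t)"
      using Vc op ji by (auto simp: V) (metis imageI)+
  next
    fix p assume "p \<in> TS (copy_curve i j C)"
    then obtain x where x: "p = i x" "x \<in> TS C" using T by auto
    then obtain U f where "(U, f) \<in> charts C" "x \<in> U" using flowcurve_cover[OF C] by blast
    then have "(i ` U, f \<circ> j) \<in> charts (copy_curve i j C)" "p \<in> i ` U" using x by (force simp: copy_curve_def)+
    then show "\<exists>U f. (U, f) \<in> charts (copy_curve i j C) \<and> p \<in> U" by blast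
  next
    fix p q assume p: "p \<in> TS (copy_curve i j C)" "p \<noteq> q"
    then obtain x where x: "p = i x" "x \<in> TS C" using T by auto
    show "\<exists>d>0. \<forall>t. \<bar>t\<bar> < d \<longrightarrow> i (e (j p) t) \<noteq> q"
    proof (cases "q \<in> range i")
      case True
      then obtain y where y: "q = i y" by blast
      then have "x \<noteq> y" using p x by blast
      then show ?thesis using flowcurve_avoid1[OF C x(2)] ji x y by metis
    next
      case False then show ?thesis by (intro exI[of _ 1]) auto
    qed
  qed
qed

lemma flowcurve_disjoint_union:
  assumes C: "\<And>i. i \<in> I \<Longrightarrow> flowcurve (C i) (e i)"
  shows "flowcurve (disjoint_union_curve I C) (\<lambda>p t. (fst p, e (fst p) (snd p) t))"
proof -
  have op: "openin (curve_top (disjoint_union_curve I C)) W \<longleftrightarrow>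
      W \<subseteq> Sigma I (\<lambda>i. TS (C i)) \<and> (\<forall>i\<in>I. openin (curve_top (C i)) {x. (i, x) \<in> W})" for W
    by (simp add: disjoint_union_curve_def openin_sum_topology o_def)
  have op1: "openin (curve_top (disjoint_union_curve I C)) ({i} \<times> V)" if "i \<in> I" "openin (curve_top (C i)) V" for i V
  proof -
    have "{x. (k, x) \<in> {i} \<times> V} = (if k = i then V else {})" for k by auto
    then show ?thesis unfolding op using that openin_subset[OF that(2)] by auto
  qed
  have T: "TS (disjoint_union_curve I C) = Sigma I (\<lambda>i. TS (C i))"
    by (simp add: disjoint_union_curve_def o_def)
  show ?thesis
  proof (rule flowcurveI)
    fix W p assume W: "openin (curve_top (disjoint_union_curve I C)) W" "p \<in> W"
    obtain i x where p: "p = (i, x)" by (cases p)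
    have "i \<in> I" "openin (curve_top (C i)) {x. (i, x) \<in> W}" "x \<in> {x. (i, x) \<in> W}" using W op p by auto
    then show "\<exists>d>0. \<forall>t. \<bar>t\<bar> < d \<longrightarrow> (fst p, e (fst p) (snd p) t) \<in> W"
      using flowcurve_stay[OF C, of i "{x. (i, x) \<in> W}" x] p by auto
  next
    fix p and d :: real assume p: "p \<in> TS (disjoint_union_curve I C)" "d > 0"
    obtain i x where p': "p = (i, x)" by (cases p)
    have ix: "i \<in> I" "x \<in> TS (C i)" using p p' T by auto
    obtain W where W: "openin (curve_top (C i)) W" "x \<in> W" "\<forall>q\<in>W. \<exists>t. \<bar>t\<bar> < d \<and> q = e i x t"
      using flowcurve_nbhd[OF C ix(2) p(2)] ix(1) by blast
    show "\<exists>W. openin (curve_top (disjoint_union_curve I C)) W \<and> p \<in> W \<and> (\<forall>q\<in>W. \<exists>t. \<bar>t\<bar> < d \<and> q = (fst p, e (fst p) (snd p) t))"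
      by (rule exI[of _ "{i} \<times> W"]) (use W op1[OF ix(1)] p' in auto)
  next
    fix U f assume "(U, f) \<in> charts (disjoint_union_curve I C)"
    then obtain i V g where V: "i \<in> I" "(V, g) \<in> charts (C i)" "U = {i} \<times> V" "f = g \<circ> snd"
      by (auto simp: disjoint_union_curve_def)
    note Vc = flowcurve_chart[OF C[OF V(1)] V(2)]
    have "inj_on f U" using Vc by (auto simp: V inj_on_def)
    then show "openin (curve_top (disjoint_union_curve I C)) U \<and> inj_on f U \<and>
        (\<forall>p\<in>U. \<exists>d>0. \<forall>t. \<bar>t\<bar> < d \<longrightarrow> (fst p, e (fst p) (snd p) t) \<in> U \<and> f (fst p, e (fst p) (snd p) t) = f p + t)"
      using Vc op1[OF V(1)] by (auto simp: V)
  next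
    fix p assume p: "p \<in> TS (disjoint_union_curve I C)"
    obtain i x where p': "p = (i, x)" by (cases p)
    have ix: "i \<in> I" "x \<in> TS (C i)" using p p' T by auto
    then obtain U f where "(U, f) \<in> charts (C i)" "x \<in> U" using flowcurve_cover[OF C] by blast
    then have "({i} \<times> U, f \<circ> snd) \<in> charts (disjoint_union_curve I C)" "p \<in> {i} \<times> U"
      using ix p' by (force simp: disjoint_union_curve_def)+
    then show "\<exists>U f. (U, f) \<in> charts (disjoint_union_curve I C) \<and> p \<in> U" by blast
  next
    fix p q assume p: "p \<in> TS (disjoint_union_curve I C)" "p \<noteq> q"
    obtain i x where p': "p = (i, x)" by (cases p)
    obtain k y where q': "q = (k, y)" by (cases q)
    have ix: "i \<in> I" "x \<in> TS (C i)" using p p' T by auto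
    show "\<exists>d>0. \<forall>t. \<bar>t\<bar> < d \<longrightarrow> (fst p, e (fst p) (snd p) t) \<noteq> q"
    proof (cases "k = i")
      case True
      then show ?thesis using flowcurve_avoid1[OF C ix(2), of y] ix(1) p(2) p' q' by auto
    next
      case False then show ?thesis using p' q' by (intro exI[of _ 1]) auto
    qed
  qed
qed

section \<open>Piecewise affine maps of the circle as maps of germs\<close>

abbreviation "rz_flow \<equiv> \<lambda>z t. rotation t z"
abbreviation "fp_flow \<equiv> \<lambda>x t. fl t x"

definition on_comps :: "(rz \<Rightarrow> rz) \<Rightarrow> fp \<Rightarrow> fp" where
  "on_comps h x = (fst x, h (snd x))"

lemma on_comps_comp: "on_comps (k \<circ> h) = on_comps k \<circ> on_comps h"
  by (simp add: on_comps_def fun_eq_iff)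

lemma on_comps_id: "on_comps id = id"
  by (simp add: on_comps_def fun_eq_iff)

lemma on_comps_funpow: "on_comps (h ^^ n) = on_comps h ^^ n"
  by (induction n) (simp_all only: funpow.simps on_comps_comp on_comps_id)

text \<open>The point \<open>z\<close> may itself belong to \<open>F\<close>. It is not met again,
  because a rotation by less than a full turn moves it.\<close>

lemma rotation_avoids:
  assumes "finite F"
  shows "\<exists>d>0. d \<le> 1 \<and> (\<forall>s. s \<noteq> 0 \<and> \<bar>s\<bar> < d \<longrightarrow> rotation s z \<notin> F)"
proof -
  obtain d where d: "d > 0" "\<forall>s. \<bar>s\<bar> < d \<longrightarrow> rotation s z \<notin> F - {z}"
    using flowcurve_avoid[OF flowcurve_RZ, of z "F - {z}"] assms by auto
  have "rotation s z \<noteq> z" if "s \<noteq> 0" "\<bar>s\<bar> < 1" for s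
    using that rotation_eq_iff[of s z 0] Ints_abs_less_1 by auto
  then show ?thesis using d by (intro exI[of _ "min d 1"]) auto
qed

lemma affine_at_RZ_near:
  assumes "affine_at rz_flow rz_flow h p a"
  shows "\<exists>d>0. \<forall>s. \<bar>s\<bar> < d \<longrightarrow> affine_at rz_flow rz_flow h (rotation s p) a \<and> h (rotation s p) = rotation (a * s) (h p)"
proof -
  obtain d where a: "a \<noteq> 0" "d > 0" "\<And>t. \<bar>t\<bar> < d \<Longrightarrow> h (rotation t p) = rotation (a * t) (h p)"
    using assms by (auto simp: affine_at_def)
  have "affine_at rz_flow rz_flow h (rotation s p) a" if "\<bar>s\<bar> < d" for s
    unfolding affine_at_def
  proof (intro conjI exI[of _ "d - \<bar>s\<bar>"] allI impI)
    fix t assume "\<bar>t\<bar> < d - \<bar>s\<bar>"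
    then have "\<bar>t + s\<bar> < d" by linarith
    then show "h (rotation t (rotation s p)) = rotation (a * t) (h (rotation s p))"
      using a(3)[of "t + s"] a(3)[OF that] by (simp add: algebra_simps)
  qed (use a that in auto)
  then show ?thesis using a by blast
qed

lemma affine_at_RZ_unique:
  assumes "affine_at rz_flow rz_flow h p a" "affine_at rz_flow rz_flow h p b" shows "a = b"
proof (rule ccontr)
  assume ne: "a \<noteq> b"
  obtain d where d: "d > 0" "\<And>t. \<bar>t\<bar> < d \<Longrightarrow> h (rotation t p) = rotation (a * t) (h p)"
    using assms(1) by (auto simp: affine_at_def)
  obtain e where e: "e > 0" "\<And>t. \<bar>t\<bar> < e \<Longrightarrow> h (rotation t p) = rotation (b * t) (h p)"
    using assms(2) by (auto simp: affine_at_def)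
  define t where "t = min (d / 2) (min (e / 2) (1 / (2 * \<bar>a - b\<bar>)))"
  have t: "t > 0" "t < d" "t < e" "t * \<bar>a - b\<bar> < 1"
  proof -
    have p: "\<bar>a - b\<bar> > 0" using ne by simp
    then show "t > 0" using d e by (simp add: t_def)
    show "t < d" "t < e" using d e by (auto simp: t_def min_def)
    have "t \<le> 1 / (2 * \<bar>a - b\<bar>)" by (simp add: t_def)
    then have "t * \<bar>a - b\<bar> \<le> 1 / (2 * \<bar>a - b\<bar>) * \<bar>a - b\<bar>" using p by (intro mult_right_mono) auto
    also have "\<dots> < 1" using p by simp
    finally show "t * \<bar>a - b\<bar> < 1" .
  qed
  have "rotation (a * t) (h p) = rotation (b * t) (h p)" using d(2)[of t] e(2)[of t] t by simp
  then have "a * t - b * t \<in> \<int>" by (simp add: rotation_eq_iff)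
  moreover have "\<bar>a * t - b * t\<bar> < 1" using t by (simp add: left_diff_distrib[symmetric] abs_mult mult.commute)
  ultimately have "a * t - b * t = 0" using Ints_abs_less_1 by blast
  then have "(a - b) * t = 0" by (simp add: left_diff_distrib)
  then show False using ne t by simp
qed

text \<open>Off a finite set the map is locally affine; since the slope and the translation part are
  locally constant along a one-sided punctured neighbourhood, they are constant there.\<close>

lemma pc_maps_pw_affine:
  assumes "h \<in> pc_maps RZ RZ" shows "pw_affine 1 1 (on_comps h)"
  unfolding pw_affine_def
proof
  fix p :: germ assume p: "p \<in> germs 1"
  obtain i z v where p': "p = ((i, z), v)" by (metis surj_pair)
  have i: "i = 0" and v: "v \<noteq> 0" using p p' by auto
  obtain F where F: "finite F" "\<And>z. z \<notin> F \<Longrightarrow> \<exists>a. affine_at rz_flow rz_flow h z a"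
    using pc_maps_cofinite[OF flowcurve_RZ flowcurve_RZ assms] by (metis Diff_iff TS_RZ UNIV_I)
  obtain d0 where d0: "d0 > 0" "\<And>s. s \<noteq> 0 \<Longrightarrow> \<bar>s\<bar> < d0 \<Longrightarrow> rotation s z \<notin> F"
    using rotation_avoids[OF F(1), of z] by blast
  define d where "d = d0 / \<bar>v\<bar>"
  have d: "d > 0" using d0 v by (simp add: d_def)
  define \<alpha> where "\<alpha> t = (SOME a. affine_at rz_flow rz_flow h (rotation (v * t) z) a)" for t
  \<comment> \<open>The affine piece seen at time \<open>t\<close>, extended back to time 0. Its
    constant value is the base point of the image germ.\<close>
  define \<beta> where "\<beta> t = rotation (- (\<alpha> t * v * t)) (h (rotation (v * t) z))" for t
  have aff: "affine_at rz_flow rz_flow h (rotation (v * t) z) (\<alpha> t)" if "t \<in> {0<..<d}" for t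
  proof -
    have "\<bar>v * t\<bar> < d0" "v * t \<noteq> 0" using that v by (auto simp: d_def abs_mult pos_less_divide_eq mult.commute)
    then have "\<exists>a. affine_at rz_flow rz_flow h (rotation (v * t) z) a" using d0(2) F(2) by blast
    then show ?thesis unfolding \<alpha>_def by (rule someI_ex)
  qed
  have const: "(\<alpha> t, \<beta> t) = (\<alpha> s, \<beta> s)" if "t \<in> {0<..<d}" "s \<in> {0<..<d}" for t s
  proof (rule connected_local_const[where A = "{0<..<d}" and f = "\<lambda>t. (\<alpha> t, \<beta> t)"])
    show "\<forall>a\<in>{0<..<d}. \<forall>\<^sub>F b in at a within {0<..<d}. (\<alpha> a, \<beta> a) = (\<alpha> b, \<beta> b)"
    proof
      fix a assume a: "a \<in> {0<..<d}"
      obtain e where e: "e > 0" "\<And>s. \<bar>s\<bar> < e \<Longrightarrow> affine_at rz_flow rz_flow h (rotation s (rotation (v * a) z)) (\<alpha> a) \<and>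
          h (rotation s (rotation (v * a) z)) = rotation (\<alpha> a * s) (h (rotation (v * a) z))"
        using affine_at_RZ_near[OF aff[OF a]] by blast
      have "(\<alpha> a, \<beta> a) = (\<alpha> b, \<beta> b)" if b: "b \<in> {0<..<d}" "\<bar>b - a\<bar> < e / \<bar>v\<bar>" for b
      proof -
        have s: "\<bar>v * (b - a)\<bar> < e" using b(2) v by (simp add: abs_mult pos_less_divide_eq mult.commute)
        have r: "rotation (v * (b - a)) (rotation (v * a) z) = rotation (v * b) z" by (simp add: algebra_simps)
        have ab: "\<alpha> a = \<alpha> b" using affine_at_RZ_unique[OF aff[OF b(1)]] e(2)[OF s] unfolding r by auto
        have "h (rotation (v * b) z) = rotation (\<alpha> a * (v * (b - a))) (h (rotation (v * a) z))"
          using e(2)[OF s] unfolding r by blast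
        then have "\<beta> b = \<beta> a" unfolding \<beta>_def ab[symmetric] by (simp add: algebra_simps)
        then show ?thesis using ab by simp
      qed
      then show "\<forall>\<^sub>F b in at a within {0<..<d}. (\<alpha> a, \<beta> a) = (\<alpha> b, \<beta> b)"
        unfolding eventually_at dist_real_def using e(1) v by (intro exI[of _ "e / \<bar>v\<bar>"]) auto
    qed
  qed (use that in auto)
  define a b where "a = \<alpha> (d/2)" and "b = \<beta> (d/2)"
  have a0: "a \<noteq> 0" using aff[of "d/2"] d by (simp add: a_def affine_at_def)
  have "h (rotation (v * t) z) = rotation (a * v * t) b" if "t \<in> {0<..<d}" for t
  proof -
    have "\<alpha> t = a" "\<beta> t = b" using const[OF that, of "d/2"] d unfolding a_def b_def by auto
    moreover have "h (rotation (v * t) z) = rotation (\<alpha> t * v * t) (\<beta> t)" by (simp add: \<beta>_def)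
    ultimately show ?thesis by simp
  qed
  then have "germ_rel (on_comps h) p ((i, b), a * v)"
    unfolding germ_rel_def by (intro ev_rightI[OF d]) (simp add: p' ev_def fl_def on_comps_def)
  then show "\<exists>q\<in>germs 1. germ_rel (on_comps h) p q" using a0 v i by (intro bexI) auto
qed

lemma cofinite_eventually:
  assumes "finite {z. \<not> Q z}" "v \<noteq> 0"
  shows "eventually (\<lambda>t. Q (snd (ev (x, v) t))) (at_right 0)"
proof -
  obtain d where d: "d > 0" "\<And>s. s \<noteq> 0 \<Longrightarrow> \<bar>s\<bar> < d \<Longrightarrow> rotation s (snd x) \<notin> {z. \<not> Q z}"
    using rotation_avoids[OF assms(1), of "snd x"] by blast
  have "Q (snd (ev (x, v) t))" if "0 < t" "t < d / \<bar>v\<bar>" for t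
  proof -
    have "\<bar>v * t\<bar> < d" "v * t \<noteq> 0" using that assms(2) by (auto simp: abs_mult pos_less_divide_eq mult.commute)
    then show ?thesis using d(2)[of "v * t"] by (simp add: ev_def fl_def)
  qed
  then show ?thesis using d(1) assms(2) by (intro ev_rightI[of "d / \<bar>v\<bar>"]) auto
qed

text \<open>The action on germs depends only on the class in the group, so a power may be replaced
  by a word that represents it.\<close>

lemma germ_map_on_comps_cong:
  assumes "finite {z. h z \<noteq> k z}" "p \<in> germs 1" "h \<in> pc_maps RZ RZ"
  shows "germ_map (on_comps h) p = germ_map (on_comps k) p"
proof -
  have "snd p \<noteq> 0" using assms(2) by (simp add: germs_def)
  then have "eventually (\<lambda>t. on_comps h (ev p t) = on_comps k (ev p t)) (at_right 0)"
    using cofinite_eventually[of "\<lambda>z. h z = k z" "snd p" "fst p"] assms(1)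
    by (auto elim!: eventually_mono simp: on_comps_def)
  then have "germ_rel (on_comps k) p (germ_map (on_comps h) p)"
    using germ_rel_cong[OF pw_affine_germ_rel[OF pc_maps_pw_affine[OF assms(3)] assms(2)]] by blast
  then show ?thesis using germ_map_eq by simp
qed

lemma pc_maps_pw_iso:
  assumes h: "h \<in> pc_maps RZ RZ" and k: "k \<in> pc_maps RZ RZ"
    and kh: "finite {z. k (h z) \<noteq> z}" and hk: "finite {z. h (k z) \<noteq> z}"
  shows "pw_iso 1 1 (on_comps h) (on_comps k)"
proof -
  have "germ_rel (on_comps k' \<circ> on_comps h') p p" if "finite {z. k' (h' z) \<noteq> z}" "p \<in> germs 1" for h' k' p
    using cofinite_eventually[of "\<lambda>z. k' (h' z) = z" "snd p" "fst p"] that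
    unfolding germ_rel_def by (auto elim!: eventually_mono simp: on_comps_def germs_def)
  then show ?thesis unfolding pw_iso_def using pc_maps_pw_affine h k kh hk by blast
qed

section \<open>Sublinearity from distortion\<close>

text \<open>A point carries only two rays. The image of an unbroken point receives both of them from
  that point, so no ray of another point can arrive there.\<close>

lemma base_inj:
  assumes "pw_iso 1 1 f f'" "fst x < 1" "fst y < 1" "\<not> broken f x" "fst (germ_map f (x, 1)) = fst (germ_map f (y, 1))"
  shows "x = y"
proof -
  have P: "(x, 1) \<in> germs 1" "(y, 1) \<in> germs 1" "(x, -1) \<in> germs 1" using assms by auto
  note pw_affine = pw_iso_pw_affine(1)[OF assms(1)]
  let ?v = "snd (germ_map f (x, 1))" and ?w = "snd (germ_map f (y, 1))"
  have nz: "?v \<noteq> 0" "?w \<noteq> 0" using pw_affine_germs[OF pw_affine P(1)] pw_affine_germs[OF pw_affine P(2)] by (auto simp: germs_def)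
  have inj: "p = q" if "p \<in> germs 1" "q \<in> germs 1" "germ_map f p = germ_map f q" for p q
    using pw_iso_inv[OF assms(1)] that by metis
  show ?thesis
  proof (cases "?w / ?v > 0")
    case True
    have "germ_map f (y, 1) = sc (?w / ?v) (germ_map f (x, 1))" using assms(5) nz by (simp add: prod_eq_iff)
    also have "\<dots> = germ_map f (sc (?w / ?v) (x, 1))" using germ_map_sc[OF pw_affine P(1) True] by simp
    finally have "(y, 1) = sc (?w / ?v) (x, 1)" using inj P(1,2) sc_germs[OF True] by blast
    then show ?thesis by simp
  next
    case False
    then have neg: "- ?w / ?v > 0" using nz by (simp add: not_less less_le)
    have "germ_map f (y, 1) = sc (- ?w / ?v) (opp (germ_map f (x, 1)))" using assms(5) nz by (simp add: prod_eq_iff)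
    also have "opp (germ_map f (x, 1)) = germ_map f (x, -1)" using assms(4) by (simp add: broken_def)
    also have "sc (- ?w / ?v) \<dots> = germ_map f (sc (- ?w / ?v) (x, -1))" using germ_map_sc[OF pw_affine P(3) neg] by simp
    finally have "(y, 1) = sc (- ?w / ?v) (x, -1)" using inj P(2,3) sc_germs[OF neg] by blast
    then show ?thesis by simp
  qed
qed

text \<open>Breaks of the composite outside those of \<open>f\<close> are transported by
  \<open>f\<close> to breaks of \<open>g\<close>, injectively by \<open>base_inj\<close>.\<close>

lemma card_broken_comp:
  assumes f: "pw_iso 1 1 f f'" and g: "pw_affine 1 1 g"
  shows "card {x. fst x < 1 \<and> broken (g \<circ> f) x} \<le> card {x. fst x < 1 \<and> broken g x} + card {x. fst x < 1 \<and> broken f x}"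
proof -
  note pw_affine = pw_iso_pw_affine(1)[OF f]
  let ?gf = "{x. fst x < 1 \<and> broken (g \<circ> f) x}" and ?f = "{x. fst x < 1 \<and> broken f x}" and ?g = "{x. fst x < 1 \<and> broken g x}"
  have fin: "finite ?gf" "finite ?f" "finite ?g" using finite_broken[OF pw_affine_comp[OF pw_affine g]] finite_broken[OF pw_affine] finite_broken[OF g] by blast+
  have "card (?gf - ?f) \<le> card ?g"
  proof (rule card_inj_on_le[OF _ _ fin(3)])
    show "inj_on (\<lambda>x. fst (germ_map f (x, 1))) (?gf - ?f)"
      by (rule inj_onI) (use base_inj[OF f] in auto)
    show "(\<lambda>x. fst (germ_map f (x, 1))) ` (?gf - ?f) \<subseteq> ?g"
      using broken_comp[OF pw_affine g] pw_affine_germs[OF pw_affine] by (fastforce simp: germs_def)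
  qed
  moreover have "card ?gf \<le> card ((?gf - ?f) \<union> ?f)" using fin by (intro card_mono) auto
  moreover have "card ((?gf - ?f) \<union> ?f) \<le> card (?gf - ?f) + card ?f" by (rule card_Un_le)
  ultimately show ?thesis by linarith
qed

section \<open>Breaks and slopes of words in the generators\<close>

abbreviation "GR \<equiv> PC_group RZ"

lemma GR_group: "group GR" by (rule PC_group_group[OF flowcurve_RZ])

definition word_fun :: "((rz \<Rightarrow> rz) set \<Rightarrow> rz \<Rightarrow> rz) \<Rightarrow> (rz \<Rightarrow> rz) set list \<Rightarrow> rz \<Rightarrow> rz" where
  "word_fun r ws = foldr (\<lambda>c h. r c \<circ> h) ws id"

lemma word_fun_Cons: "word_fun r (c # ws) = r c \<circ> word_fun r ws"
  by (simp add: word_fun_def)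

lemma word_fun_Nil: "word_fun r [] = id"
  by (simp add: word_fun_def)

lemma word_fun_pc_class:
  assumes "\<And>c. c \<in> T \<Longrightarrow> r c \<in> pc_maps RZ RZ \<and> c = pc_class RZ RZ (r c)" "set ws \<subseteq> T"
  shows "word_fun r ws \<in> pc_maps RZ RZ \<and> foldr (mult GR) ws (one GR) = pc_class RZ RZ (word_fun r ws)"
  using assms(2)
proof (induction ws)
  case Nil
  have "foldr (mult GR) [] (one GR) = one GR" by simp
  then show ?case unfolding word_fun_Nil PC_group_simps using pc_maps_id[OF flowcurve_RZ] by blast
next
  case (Cons c ws)
  then have c: "r c \<in> pc_maps RZ RZ" "c = pc_class RZ RZ (r c)" using assms(1) by auto
  have IH: "word_fun r ws \<in> pc_maps RZ RZ" "foldr (mult GR) ws (one GR) = pc_class RZ RZ (word_fun r ws)" using Cons by auto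
  have "pc_comp RZ RZ c (foldr (mult GR) ws (one GR)) = pc_class RZ RZ (r c \<circ> word_fun r ws)"
    using pc_comp_pc_class[OF flowcurve_RZ flowcurve_RZ flowcurve_RZ IH(1) c(1)] c(2) IH(2) by simp
  moreover have "foldr (mult GR) (c # ws) (one GR) = pc_comp RZ RZ c (foldr (mult GR) ws (one GR))" by simp
  ultimately show ?case
    using pc_maps_comp[OF flowcurve_RZ flowcurve_RZ flowcurve_RZ IH(1) c(1)] unfolding word_fun_Cons by metis
qed

lemma pc_maps_pw_iso_ex: "h \<in> pc_maps RZ RZ \<Longrightarrow> \<exists>k. pw_iso 1 1 (on_comps h) (on_comps k)"
proof -
  assume h: "h \<in> pc_maps RZ RZ"
  obtain k where "k \<in> pc_maps RZ RZ" "finite {z. k (h z) \<noteq> z}" "finite {z. h (k z) \<noteq> z}"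
    using pc_maps_inverse[OF flowcurve_RZ flowcurve_RZ h] by auto
  then show ?thesis using pc_maps_pw_iso[OF h] by blast
qed

lemma word_fun_breaks:
  assumes T: "\<And>c. c \<in> T \<Longrightarrow> r c \<in> pc_maps RZ RZ \<and> c = pc_class RZ RZ (r c)" and ws: "set ws \<subseteq> T"
    and K: "\<And>c. c \<in> T \<Longrightarrow> card {x. fst x < 1 \<and> broken (on_comps (r c)) x} \<le> K"
  shows "card {x. fst x < 1 \<and> broken (on_comps (word_fun r ws)) x} \<le> K * length ws"
  using ws
proof (induction ws)
  case Nil
  have "{x. fst x < 1 \<and> broken (id :: fp \<Rightarrow> fp) x} = {}" by (auto simp: broken_def)
  then show ?case unfolding word_fun_Nil on_comps_id by (metis card.empty zero_le)
next
  case (Cons c ws)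
  have w: "word_fun r ws \<in> pc_maps RZ RZ" using word_fun_pc_class[of T r ws] T Cons.prems by auto
  obtain k where k: "pw_iso 1 1 (on_comps (word_fun r ws)) (on_comps k)" using pc_maps_pw_iso_ex[OF w] by blast
  have "card {x. fst x < 1 \<and> broken (on_comps (word_fun r (c # ws))) x} \<le>
      card {x. fst x < 1 \<and> broken (on_comps (r c)) x} + card {x. fst x < 1 \<and> broken (on_comps (word_fun r ws)) x}"
    unfolding word_fun_Cons on_comps_comp by (rule card_broken_comp[OF k pc_maps_pw_affine]) (use T Cons.prems in auto)
  also have "\<dots> \<le> K + K * length ws" using K[of c] Cons by (intro add_mono) auto
  finally show ?case by simp
qed

lemma word_fun_slopes:
  fixes u :: "real \<Rightarrow> real"
  assumes T: "\<And>c. c \<in> T \<Longrightarrow> r c \<in> pc_maps RZ RZ \<and> c = pc_class RZ RZ (r c)" and ws: "set ws \<subseteq> T"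
    and u: "\<And>a b. u (a + b) = u a + u b"
    and K: "\<And>c p. c \<in> T \<Longrightarrow> p \<in> germs 1 \<Longrightarrow> \<bar>u (ln \<bar>snd (germ_map (on_comps (r c)) p) / snd p\<bar>)\<bar> \<le> K" and p: "p \<in> germs 1"
  shows "\<bar>u (ln \<bar>snd (germ_map (on_comps (word_fun r ws)) p) / snd p\<bar>)\<bar> \<le> K * real (length ws)"
  using ws
proof (induction ws)
  case Nil
  have "u 0 = 0" using u[of 0 0] by simp
  moreover have "snd p \<noteq> 0" using p by (simp add: germs_def)
  ultimately show ?case unfolding word_fun_Nil on_comps_id germ_map_id by simp
next
  case (Cons c ws)
  have w: "word_fun r ws \<in> pc_maps RZ RZ" using word_fun_pc_class[of T r ws] T Cons.prems by auto
  have c: "c \<in> T" "r c \<in> pc_maps RZ RZ" using T Cons.prems by auto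
  let ?q = "germ_map (on_comps (word_fun r ws)) p"
  have q: "?q \<in> germs 1" using pw_affine_germs[OF pc_maps_pw_affine[OF w] p] .
  have e: "germ_map (on_comps (word_fun r (c # ws))) p = germ_map (on_comps (r c)) ?q"
    unfolding word_fun_Cons on_comps_comp by (rule germ_map_comp[OF pc_maps_pw_affine[OF w] pc_maps_pw_affine[OF c(2)] p])
  have "germ_map (on_comps (r c)) ?q \<in> germs 1" using pw_affine_germs[OF pc_maps_pw_affine[OF c(2)] q] .
  then have nz: "snd p \<noteq> 0" "snd ?q \<noteq> 0" "snd (germ_map (on_comps (r c)) ?q) \<noteq> 0" using p q by (auto simp: germs_def)
  have "ln \<bar>snd (germ_map (on_comps (word_fun r (c # ws))) p) / snd p\<bar> = ln \<bar>snd (germ_map (on_comps (r c)) ?q) / snd ?q\<bar> + ln \<bar>snd ?q / snd p\<bar>"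
    unfolding e using nz by (simp add: ln_div)
  then have "u (ln \<bar>snd (germ_map (on_comps (word_fun r (c # ws))) p) / snd p\<bar>) = u (ln \<bar>snd (germ_map (on_comps (r c)) ?q) / snd ?q\<bar>) + u (ln \<bar>snd ?q / snd p\<bar>)"
    by (simp only: u)
  moreover have "\<bar>u (ln \<bar>snd ?q / snd p\<bar>)\<bar> \<le> K * real (length ws)" using Cons by simp
  moreover have "\<bar>u (ln \<bar>snd (germ_map (on_comps (r c)) ?q) / snd ?q\<bar>)\<bar> \<le> K" using K[OF c(1) q] .
  ultimately have "\<bar>u (ln \<bar>snd (germ_map (on_comps (word_fun r (c # ws))) p) / snd p\<bar>)\<bar> \<le> K + K * real (length ws)" by linarith
  then show ?case by (simp add: distrib_left)
qed

section \<open>Words realising the word length in an abstract group\<close>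

lemma (in group) foldr_append:
  assumes "set as \<subseteq> carrier G" "set base_B \<subseteq> carrier G"
  shows "foldr (mult G) (as @ base_B) \<one> = foldr (mult G) as \<one> \<otimes> foldr (mult G) base_B \<one> \<and> foldr (mult G) as \<one> \<in> carrier G \<and> foldr (mult G) base_B \<one> \<in> carrier G"
proof -
  have b: "foldr (mult G) base_B \<one> \<in> carrier G" using assms(2) by (induction base_B) auto
  show ?thesis using assms(1) by (induction as) (auto simp: b m_assoc)
qed

lemma (in group) generate_word:
  assumes "S \<subseteq> carrier G" "x \<in> generate G S"
  shows "\<exists>ws. set ws \<subseteq> S \<union> m_inv G ` S \<and> x = foldr (mult G) ws \<one>"
  using assms(2)
proof (induction rule: generate.induct)
  case one show ?case by (rule exI[of _ "[]"]) simp
next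
  case (incl h) then show ?case using assms(1) by (intro exI[of _ "[h]"]) auto
next
  case (inv h) then show ?case using assms(1) by (intro exI[of _ "[m_inv G h]"]) auto
next
  case (eng h1 h2)
  then obtain ws1 ws2 where w: "set ws1 \<subseteq> S \<union> m_inv G ` S" "h1 = foldr (mult G) ws1 \<one>"
    "set ws2 \<subseteq> S \<union> m_inv G ` S" "h2 = foldr (mult G) ws2 \<one>" by blast
  have "S \<union> m_inv G ` S \<subseteq> carrier G" using assms(1) by auto
  then have "set ws1 \<subseteq> carrier G" "set ws2 \<subseteq> carrier G" using w by auto
  then have "h1 \<otimes> h2 = foldr (mult G) (ws1 @ ws2) \<one>" using foldr_append[of ws1 ws2] w by metis
  then show ?case using w by (intro exI[of _ "ws1 @ ws2"]) auto
qed

lemma (in group) generate_pow: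
  assumes "x \<in> generate G S" shows "x [^] (n::nat) \<in> generate G S"
  by (induction n) (auto intro: generate.one generate.eng assms)

lemma (in group) word_length_word:
  assumes "S \<subseteq> carrier G" "x \<in> generate G S"
  shows "\<exists>ws. length ws = word_length G S x \<and> set ws \<subseteq> S \<union> m_inv G ` S \<and> x = foldr (mult G) ws \<one>"
  unfolding word_length_def by (rule LeastI_ex) (use generate_word[OF assms] in blast)

text \<open>The number of breaks, and the absolute value of an additive functional of the
  logarithmic slope, are subadditive under composition. Both are bounded on the finitely many
  generators and inverses, hence by a constant times the word length.\<close>

lemma distorted_sublinear:
  assumes h: "h \<in> pc_maps RZ RZ" and k: "pw_iso 1 1 (on_comps h) (on_comps k)" and dist: "distorted GR (pc_class RZ RZ h)"
  shows "\<exists>l. sublinear (on_comps h) (on_comps k) l"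
proof -
  interpret group GR by (rule GR_group)
  obtain S where S: "finite S" "S \<subseteq> carrier GR" "pc_class RZ RZ h \<in> generate GR S"
    and lim: "(\<lambda>n. real (word_length GR S (pc_class RZ RZ h [^]\<^bsub>GR\<^esub> n)) / real n) \<longlonglongrightarrow> 0"
    using dist unfolding distorted_def by blast
  define l where "l n = word_length GR S (pc_class RZ RZ h [^]\<^bsub>GR\<^esub> n)" for n :: nat
  define T where "T = S \<union> m_inv GR ` S"
  have T: "finite T" "T \<subseteq> carrier GR" using S inv_closed by (auto simp: T_def simp del: PC_group_simps)
  have "\<forall>c. \<exists>r. c \<in> T \<longrightarrow> r \<in> pc_maps RZ RZ \<and> c = pc_class RZ RZ r"
    using T(2) by (auto elim!: PC_isoE)
  from choice[OF this] obtain r where r: "\<And>c. c \<in> T \<Longrightarrow> r c \<in> pc_maps RZ RZ \<and> c = pc_class RZ RZ (r c)" by blast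
  have "\<exists>ws. length ws = l n \<and> set ws \<subseteq> T \<and> finite {z. (h ^^ n) z \<noteq> word_fun r ws z}" for n
  proof -
    obtain ws where ws: "length ws = l n" "set ws \<subseteq> T" "pc_class RZ RZ h [^]\<^bsub>GR\<^esub> n = foldr (mult GR) ws \<one>\<^bsub>GR\<^esub>"
      using word_length_word[OF S(2) generate_pow[OF S(3)], of n] unfolding l_def T_def by metis
    have hn: "h ^^ n \<in> pc_maps RZ RZ" "pc_class RZ RZ h [^]\<^bsub>GR\<^esub> n = pc_class RZ RZ (h ^^ n)"
      using PC_group_pow[OF flowcurve_RZ h] by auto
    have "pc_class RZ RZ (h ^^ n) = pc_class RZ RZ (word_fun r ws)" "word_fun r ws \<in> pc_maps RZ RZ"
      using word_fun_pc_class[OF r ws(2)] ws(3) hn(2) by auto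
    then have "finite {z. (h ^^ n) z \<noteq> word_fun r ws z}" using pc_class_eq_iff[OF hn(1)] by auto
    then show ?thesis using ws by blast
  qed
  then obtain w where w: "\<And>n. length (w n) = l n" "\<And>n. set (w n) \<subseteq> T" "\<And>n. finite {z. (h ^^ n) z \<noteq> word_fun r (w n) z}"
    by metis
  have hn: "h ^^ n \<in> pc_maps RZ RZ" for n using PC_group_pow[OF flowcurve_RZ h] by auto
  have germ_map_w: "germ_map (on_comps h ^^ n) p = germ_map (on_comps (word_fun r (w n))) p" if "p \<in> germs 1" for n p
    using germ_map_on_comps_cong[OF w(3)[of n] that hn] by (simp add: on_comps_funpow)
  have "sublinear (on_comps h) (on_comps k) l"
  proof
    show "pw_iso 1 1 (on_comps h) (on_comps k)" by (rule k)
    show "(\<lambda>n. real (l n) / real n) \<longlonglongrightarrow> 0" using lim by (simp add: l_def)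
    let ?b = "\<lambda>c. card {x. fst x < 1 \<and> broken (on_comps (r c)) x}"
    have "?b c \<le> sum ?b T" if "c \<in> T" for c
      using that T(1) by (intro member_le_sum) auto
    then have "card {x. fst x < 1 \<and> broken (on_comps h ^^ n) x} \<le> sum ?b T * l n" for n
    proof -
      have "{x. fst x < 1 \<and> broken (on_comps h ^^ n) x} = {x. fst x < 1 \<and> broken (on_comps (word_fun r (w n))) x}"
        using germ_map_w[of _ n] by (auto simp: broken_def)
      then show ?thesis using word_fun_breaks[OF r w(2)[of n], of "sum ?b T"] \<open>\<And>c. c \<in> T \<Longrightarrow> ?b c \<le> sum ?b T\<close> w(1)[of n] by simp
    qed
    then show "\<exists>K. \<forall>n. card {x. fst x < 1 \<and> broken (on_comps h ^^ n) x} \<le> K * l n" by blast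
  next
    fix u :: "real \<Rightarrow> real" assume u: "\<And>a b. u (a + b) = u a + u b"
    have "\<exists>K. \<forall>p\<in>germs 1. \<bar>u (ln \<bar>snd (germ_map (on_comps (r c)) p) / snd p\<bar>)\<bar> \<le> K" if "c \<in> T" for c
    proof -
      let ?S = "{\<bar>snd (germ_map (on_comps (r c)) p) / snd p\<bar> |p. p \<in> germs 1}"
      have "finite ((\<lambda>s. \<bar>u (ln s)\<bar>) ` ?S)" using finite_slopes[OF pc_maps_pw_affine] r[OF that] by blast
      then obtain K where K: "\<forall>x \<in> (\<lambda>s. \<bar>u (ln s)\<bar>) ` ?S. x \<le> K"
        using bdd_above_finite[unfolded bdd_above_def] by blast
      have "\<bar>u (ln \<bar>snd (germ_map (on_comps (r c)) p) / snd p\<bar>)\<bar> \<le> K" if "p \<in> germs 1" for p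
        by (rule bspec[OF K]) (use that in blast)
      then show ?thesis by blast
    qed
    then have "\<forall>c. \<exists>K. c \<in> T \<longrightarrow> (\<forall>p\<in>germs 1. \<bar>u (ln \<bar>snd (germ_map (on_comps (r c)) p) / snd p\<bar>)\<bar> \<le> K)" by blast
    from choice[OF this] obtain K where K: "\<And>c p. c \<in> T \<Longrightarrow> p \<in> germs 1 \<Longrightarrow> \<bar>u (ln \<bar>snd (germ_map (on_comps (r c)) p) / snd p\<bar>)\<bar> \<le> K c" by blast
    have Ks: "K c \<le> (\<Sum>c\<in>T. \<bar>K c\<bar>)" if "c \<in> T" for c
      using member_le_sum[of c T "\<lambda>c. \<bar>K c\<bar>"] that T(1) by auto
    have "\<bar>u (ln \<bar>snd (germ_map (on_comps h ^^ n) p) / snd p\<bar>)\<bar> \<le> (\<Sum>c\<in>T. \<bar>K c\<bar>) * real (l n)" if p: "p \<in> germs 1" for n p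
      unfolding germ_map_w[OF p] w(1)[symmetric]
      by (rule word_fun_slopes[OF r w(2) u _ p]) (use K Ks order_trans in blast)+
    then show "\<exists>K. \<forall>n. \<forall>p\<in>germs 1. \<bar>u (ln \<bar>snd (germ_map (on_comps h ^^ n) p) / snd p\<bar>)\<bar> \<le> K * real (l n)" by blast
  qed
  then show ?thesis by blast
qed

section \<open>Regular points\<close>

text \<open>The bridge back from germs to functions: off a finite set \<open>f\<close> takes the
  value predicted by its germs and is affine on both sides with the same slope.\<close>

lemma finite_irregular:
  assumes "pw_affine n m f"
  shows "finite {x. fst x < n \<and> \<not> (fst (f x) < m \<and> f x = fst (germ_map f (x, 1)) \<and> (\<exists>a. affine_at fp_flow fp_flow f x a))}"
proof (rule finite_exceptions)
  fix x :: fp and v assume x: "fst x < n" "v = 1 \<or> v = (-1::real)"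
  then have v: "v \<noteq> 0" "v * v = 1" by auto
  obtain y w where yw: "germ_map f (x, v) = (y, w)" by (cases "germ_map f (x, v)")
  have P: "(x, v) \<in> germs n" using x v by simp
  have yw0: "fst y < m" "w \<noteq> 0" using pw_affine_germs[OF assms P] yw by auto
  obtain e where e: "e > 0" "\<And>t. 0 < t \<Longrightarrow> t < e \<Longrightarrow> f (fl (v * t) x) = fl (w * t) y"
    using germ_map_prop[OF assms P yw] unfolding ev_right by blast
  have "\<exists>a. affine_at fp_flow fp_flow f (fl (v * t) x) a" if t: "0 < t" "t < e" for t
  proof -
    have "f (fl r (fl (v * t) x)) = fl (w * v * r) (f (fl (v * t) x))" if r: "\<bar>r\<bar> < min t (e - t)" for r
    proof -
      have "\<bar>v * r\<bar> < min t (e - t)" using r x(2) by auto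
      then have "0 < t + v * r" "t + v * r < e" by linarith+
      from e(2)[OF this] have "f (fl (v * t + v * v * r) x) = fl (w * t + w * v * r) y" by (simp add: algebra_simps)
      then show ?thesis unfolding e(2)[OF t] using v(2) by (simp add: add.commute)
    qed
    then have "affine_at fp_flow fp_flow f (fl (v * t) x) (w * v)"
      unfolding affine_at_def using v yw0 t by (intro conjI exI[of _ "min t (e - t)"]) auto
    then show ?thesis by blast
  qed
  then have "eventually (\<lambda>t. fst (f (fl (v * t) x)) < m \<and> (\<exists>a. affine_at fp_flow fp_flow f (fl (v * t) x) a)) (at_right 0)"
    using e yw0 by (intro ev_rightI[OF e(1)]) auto
  then show "eventually (\<lambda>t. fst (f (fl (v * t) x)) < m \<and> f (fl (v * t) x) = fst (germ_map f (fl (v * t) x, 1)) \<and>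
      (\<exists>a. affine_at fp_flow fp_flow f (fl (v * t) x) a)) (at_right 0)"
    using pw_affine_regular_near[OF assms x] by eventually_elim auto
qed

lemma pw_iso_inverse_cofinite:
  assumes "pw_iso n m f g" shows "finite {x. fst x < n \<and> g (f x) \<noteq> x}"
proof (rule finite_exceptions)
  fix x :: fp and v assume x: "fst x < n" "v = 1 \<or> v = (-1::real)"
  then have "(x, v) \<in> germs n" by auto
  then show "eventually (\<lambda>t. g (f (fl (v * t) x)) = fl (v * t) x) (at_right 0)"
    using assms unfolding pw_iso_def germ_rel_def ev_def comp_def by fastforce
qed

section \<open>The standard curve of a minimal decomposition\<close>

definition comps :: "nat \<Rightarrow> nat set \<Rightarrow> component list" where
  "comps n C = map (\<lambda>i. if i \<in> C then Circle else Interval 0 1) [0..<n]"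

definition std :: "nat \<Rightarrow> nat set \<Rightarrow> (nat \<times> (rz + real)) curve" where
  "std n C = disjoint_union_curve {..<length (comps n C)} (\<lambda>i. component_curve (comps n C ! i))"

definition std_flow :: "nat \<times> (rz + real) \<Rightarrow> real \<Rightarrow> nat \<times> (rz + real)" where
  "std_flow p t = (fst p, case snd p of Inl z \<Rightarrow> Inl (rotation t z) | Inr r \<Rightarrow> Inr (r + t))"

text \<open>The model circle of an interval component has the extra point 0, which is left out here.
  Circle components keep it.\<close>

definition std_points :: "nat \<Rightarrow> nat set \<Rightarrow> fp set" where
  "std_points n C = {x. fst x < n \<and> (snd x \<noteq> to_rz 0 \<or> fst x \<in> C)}"

definition toX :: "nat set \<Rightarrow> fp \<Rightarrow> nat \<times> (rz + real)" where
  "toX C x = (fst x, if fst x \<in> C then Inl (snd x) else Inr (fr (snd x)))"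

definition unX :: "nat \<times> (rz + real) \<Rightarrow> fp" where
  "unX p = (fst p, case snd p of Inl z \<Rightarrow> z | Inr r \<Rightarrow> to_rz r)"

lemma std_standard: "std n C \<in> standard_curves"
  unfolding standard_curves_def std_def
  by (rule CollectI, rule exI[of _ "comps n C"]) (auto simp: comps_def)

lemma flowcurve_component:
  "flowcurve (component_curve c) (\<lambda>p t. case p of Inl z \<Rightarrow> Inl (rotation t z) | Inr r \<Rightarrow> Inr (r + t))"
proof (cases c)
  case Circle
  show ?thesis unfolding Circle component_curve.simps
    by (rule flowcurve_cong[OF flowcurve_copy[OF flowcurve_RZ]]) (auto simp: TS_copy)
next
  case (Interval a b)
  show ?thesis unfolding Interval component_curve.simps
    by (rule flowcurve_cong[OF flowcurve_copy[OF flowcurve_interval]]) (auto simp: TS_copy)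
qed

lemma flowcurve_std: "flowcurve (std n C) std_flow"
proof -
  have "flowcurve (std n C) (\<lambda>p t. (fst p, case snd p of Inl z \<Rightarrow> Inl (rotation t z) | Inr r \<Rightarrow> Inr (r + t)))"
    unfolding std_def
    by (rule flowcurve_disjoint_union[of _ _ "\<lambda>i p t. case p of Inl z \<Rightarrow> Inl (rotation t z) | Inr r \<Rightarrow> Inr (r + t)"])
      (rule flowcurve_component)
  then show ?thesis by (rule flowcurve_cong) (simp add: std_flow_def)
qed

lemma TS_std: "p \<in> TS (std n C) \<longleftrightarrow> fst p < n \<and>
    (if fst p \<in> C then \<exists>z. snd p = Inl z else \<exists>r. 0 < r \<and> r < 1 \<and> snd p = Inr r)"
proof -
  have "TS (std n C) = Sigma {..<n} (\<lambda>i. TS (component_curve (comps n C ! i)))"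
    by (simp add: std_def disjoint_union_curve_def o_def comps_def)
  moreover have "TS (component_curve (comps n C ! i)) =
      (if i \<in> C then range Inl else projr -` {0<..<1} \<inter> range Inr)" if "i < n" for i
    using that by (simp add: comps_def TS_copy interval_curve_def)
  ultimately show ?thesis by (cases p) auto
qed

lemma unX_toX [simp]: "unX (toX C x) = x"
  by (simp add: unX_def toX_def)

lemma toX_unX: "p \<in> TS (std n C) \<Longrightarrow> toX C (unX p) = p"
  unfolding TS_std by (cases p) (auto simp: unX_def toX_def fr_to_rz_id split: if_splits)

lemma toX_TS: "toX C x \<in> TS (std n C) \<longleftrightarrow> x \<in> std_points n C"
  unfolding TS_std std_points_def using fr_pos[of "snd x"] fr_eq_0_iff[of "snd x"] by (auto simp: toX_def)

lemma unX_std_points: "p \<in> TS (std n C) \<Longrightarrow> unX p \<in> std_points n C"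
  using toX_TS toX_unX by metis

lemma affine_at_toX: "x \<in> std_points n C \<Longrightarrow> affine_at fp_flow std_flow (toX C) x 1"
proof -
  assume x: "x \<in> std_points n C"
  have "\<exists>d>0. \<forall>t. \<bar>t\<bar> < d \<longrightarrow> toX C (fl t x) = std_flow (toX C x) t"
  proof (cases "fst x \<in> C")
    case True
    then show ?thesis by (intro exI[of _ 1]) (auto simp: toX_def std_flow_def fl_def)
  next
    case False
    then have z: "snd x \<noteq> to_rz 0" using x by (simp add: std_points_def)
    let ?r = "fr (snd x)"
    have "toX C (fl t x) = std_flow (toX C x) t" if t: "\<bar>t\<bar> < min ?r (1 - ?r)" for t
    proof -
      have "rotation t (snd x) = to_rz (?r + t)" using rotation_to_rz[of t ?r] by simp
      moreover have "\<bar>t\<bar> < ?r" "\<bar>t\<bar> < 1 - ?r" using t by simp_all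
      then have "0 \<le> ?r + t" "?r + t < 1" by linarith+
      ultimately have "fr (rotation t (snd x)) = ?r + t" by (simp only: fr_to_rz_id)
      then show ?thesis using False by (simp add: toX_def std_flow_def fl_def)
    qed
    then show ?thesis using fr_pos[OF z] by (intro exI[of _ "min ?r (1 - ?r)"]) auto
  qed
  then show ?thesis by (simp add: affine_at_def)
qed

lemma affine_at_unX: "affine_at std_flow fp_flow unX p 1"
  unfolding affine_at_def
  by (auto simp: unX_def std_flow_def fl_def rotation_to_rz split: sum.splits intro!: exI[of _ 1])

lemma affine_at_Pair: "affine_at rz_flow fp_flow (Pair i) z 1"
  unfolding affine_at_def by (auto simp: fl_def intro!: exI[of _ 1])

lemma affine_at_snd: "affine_at fp_flow rz_flow snd x 1"
  unfolding affine_at_def by (auto simp: fl_def intro!: exI[of _ 1])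

lemma affine_at_comp': "affine_at e e' h p a \<Longrightarrow> affine_at e' e'' k (h p) b \<Longrightarrow> \<exists>c. affine_at e e'' (k \<circ> h) p c"
  by (rule exI, erule (1) affine_at_comp)

lemma finite_Pair: "finite S \<Longrightarrow> finite {z. (0::nat, z::rz) \<in> S}"
proof -
  assume "finite S"
  then have "finite (snd ` S)" by simp
  then show ?thesis by (rule rev_finite_subset) force
qed

section \<open>The affine automorphism of the standard curve\<close>

context minimal
begin

text \<open>All inner points, and the point 0 of exactly those components whose ends are glued to
  each other; these components close up to circles.\<close>

definition T :: "fp set" where "T = {x. fst x < n \<and> HH (x, 1) (x, -1)}"

definition base_B :: "int \<Rightarrow> fp \<Rightarrow> fp" where "base_B k x = fst (B k (x, 1))"

definition CC :: "nat set" where "CC = {i. (i, to_rz 0) \<in> T}"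

lemma T_std_points: "T = std_points n CC"
proof (intro equalityI subsetI)
  fix x assume x: "x \<in> T"
  then show "x \<in> std_points n CC" by (cases x) (auto simp: T_def std_points_def CC_def)
next
  fix x assume x: "x \<in> std_points n CC"
  show "x \<in> T"
  proof (cases "snd x = to_rz 0")
    case True
    then show ?thesis using x by (cases x) (auto simp: std_points_def CC_def)
  next
    case False
    then show ?thesis using HH_inner[of "(x, 1)"] x by (auto simp: std_points_def T_def)
  qed
qed

text \<open>The action preserves the gluing and glued germs are exactly opposite by
  \<open>HH_opp\<close>, so the image is again one point with equal slopes on both sides.\<close>

lemma B_on_T:
  assumes "x \<in> T"
  shows "base_B k x \<in> T" "\<exists>w. w \<noteq> 0 \<and> (\<forall>v. v \<noteq> 0 \<longrightarrow> B k (x, v) = (base_B k x, w * v))"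
proof -
  have x: "fst x < n" "HH (x, 1) (x, -1)" using assms by (auto simp: T_def)
  have P: "(x, 1) \<in> germs n" "(x, -1) \<in> germs n" using x by auto
  have hb: "HH (B k (x, 1)) (B k (x, -1))" by (rule HH_B[OF P x(2)])
  have o: "B k (x, -1) = opp (B k (x, 1))" by (rule HH_opp[OF B_germs[OF P(1)] B_germs[OF P(2)] hb])
  obtain w where b1: "B k (x, 1) = (base_B k x, w)" by (metis base_B_def prod.collapse)
  have w: "w \<noteq> 0" "fst (base_B k x) < n" using B_germs[OF P(1), of k] by (auto simp: b1)
  have "HH (base_B k x, w) (base_B k x, - w)" using hb unfolding o b1 by simp
  then show "base_B k x \<in> T" using H_one[OF pw_affine\<zeta> w(2) _ w(1)] w(2) by (simp add: T_def)
  have "B k (x, v) = (base_B k x, w * v)" if "v \<noteq> 0" for v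
  proof (cases "v > 0")
    case True
    then show ?thesis using B_sc[OF P(1) True, of k] b1 by (metis mult.commute mult.right_neutral sc_pair)
  next
    case False
    then have "- v > 0" using that by simp
    from B_sc[OF P(2) this, of k] show ?thesis unfolding o b1 by (simp add: mult.commute)
  qed
  then show "\<exists>w. w \<noteq> 0 \<and> (\<forall>v. v \<noteq> 0 \<longrightarrow> B k (x, v) = (base_B k x, w * v))" using w(1) by blast
qed

lemma base_B_inverse: assumes "x \<in> T" shows "base_B (- k) (base_B k x) = x"
proof -
  obtain w where w: "w \<noteq> 0" "\<And>v. v \<noteq> 0 \<Longrightarrow> B k (x, v) = (base_B k x, w * v)" using B_on_T(2)[OF assms] by blast
  obtain w' where w': "w' \<noteq> 0" "\<And>v. v \<noteq> 0 \<Longrightarrow> B (-k) (base_B k x, v) = (base_B (-k) (base_B k x), w' * v)"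
    using B_on_T(2)[OF B_on_T(1)[OF assms]] by blast
  have "(x, 1) \<in> germs n" using assms by (simp add: T_def)
  then have "B (- k) (B k (x, 1)) = (x, 1)" by (rule B_minus)
  then show ?thesis using w(2)[of 1] w'(2)[of w] w(1) by simp
qed

lemma base_B_affine_at:
  assumes "x \<in> T" "\<And>v. v \<noteq> 0 \<Longrightarrow> B k (x, v) = (base_B k x, w * v)" "w \<noteq> 0"
  shows "affine_at fp_flow fp_flow (base_B k) x w"
proof -
  have P: "(x, 1) \<in> germs n" "(x, -1) \<in> germs n" using assms(1) by (auto simp: T_def)
  define y where "y = base_B k x"
  have b: "B k (x, 1) = (y, w)" "B k (x, -1) = (y, - w)" using assms(2) by (simp_all add: y_def)
  have "eventually (\<lambda>t. base_B k (fl (1 * t) x) = fl (w * t) y) (at_right 0)"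
    using B_prop[OF P(1) b(1)] by eventually_elim (simp add: base_B_def)
  then obtain d1 where d1: "d1 > 0" "\<And>t. 0 < t \<Longrightarrow> t < d1 \<Longrightarrow> base_B k (fl t x) = fl (w * t) y"
    unfolding ev_right by auto
  have "eventually (\<lambda>t. base_B k (fl (- 1 * t) x) = fl (- w * t) y) (at_right 0)"
    using B_prop[OF P(2) b(2)] by eventually_elim (simp add: base_B_def)
  then obtain d2 where d2: "d2 > 0" "\<And>t. 0 < t \<Longrightarrow> t < d2 \<Longrightarrow> base_B k (fl (- t) x) = fl (- w * t) y"
    unfolding ev_right by auto
  have "base_B k (fl t x) = fl (w * t) y" if "\<bar>t\<bar> < min d1 d2" for t
    using d1(2)[of t] d2(2)[of "-t"] that y_def by (cases t "0 :: real" rule: linorder_cases) auto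
  then show ?thesis unfolding affine_at_def y_def[symmetric]
    using assms(3) d1(1) d2(1) by (intro conjI exI[of _ "min d1 d2"]) auto
qed

lemma finite_preimage:
  assumes "pw_iso a b F F'" "finite N" shows "finite {x. fst x < a \<and> F x \<in> N}"
proof -
  have "finite ({x. fst x < a \<and> F' (F x) \<noteq> x} \<union> F' ` N)" using pw_iso_inverse_cofinite[OF assms(1)] assms(2) by simp
  then show ?thesis by (rule rev_finite_subset) (auto intro: rev_image_eqI)
qed

lemma finite_std_points: "finite {x. fst x < n \<and> x \<notin> T}"
proof -
  have "{x. fst x < n \<and> x \<notin> T} \<subseteq> (\<lambda>i. (i, to_rz 0)) ` {..<n}" by (auto simp: T_std_points std_points_def)
  then show ?thesis using finite_subset by blast
qed

lemma finite_unX: "finite S \<Longrightarrow> finite {p \<in> TS (std n CC). unX p \<in> S}"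
proof -
  assume "finite S"
  then have "finite (toX CC ` S)" by simp
  then show ?thesis by (rule rev_finite_subset) (use toX_unX in \<open>auto intro: rev_image_eqI\<close>)
qed

definition \<phi>X :: "rz \<Rightarrow> nat \<times> (rz + real)" where "\<phi>X = toX CC \<circ> (\<psi> \<circ> Pair 0)"
definition kX :: "nat \<times> (rz + real) \<Rightarrow> rz" where "kX = snd \<circ> (\<zeta> \<circ> unX)"
definition hX :: "nat \<times> (rz + real) \<Rightarrow> nat \<times> (rz + real)" where "hX = toX CC \<circ> (base_B 1 \<circ> unX)"

abbreviation "X \<equiv> std n CC"

lemma finite_bad_\<psi>: "finite {x. fst x < 1 \<and> \<not> (\<psi> x \<in> T \<and> \<zeta> (\<psi> x) = x \<and> (\<exists>a. affine_at fp_flow fp_flow \<psi> x a))}"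
proof -
  have "finite ({x. fst x < 1 \<and> \<not> (fst (\<psi> x) < n \<and> \<psi> x = fst (germ_map \<psi> (x, 1)) \<and> (\<exists>a. affine_at fp_flow fp_flow \<psi> x a))}
    \<union> {x. fst x < 1 \<and> \<zeta> (\<psi> x) \<noteq> x} \<union> {x. fst x < 1 \<and> \<psi> x \<in> {x. fst x < n \<and> x \<notin> T}})"
    using finite_irregular[OF pw_affine\<psi>] pw_iso_inverse_cofinite[OF pw_iso_sym[OF \<zeta>\<psi>]]
      finite_preimage[OF pw_iso_sym[OF \<zeta>\<psi>] finite_std_points] by simp
  then show ?thesis by (rule rev_finite_subset) blast
qed

lemma finite_bad_\<zeta>: "finite {x. fst x < n \<and> \<not> (fst (\<zeta> x) < 1 \<and> \<psi> (\<zeta> x) = x \<and> (\<exists>a. affine_at fp_flow fp_flow \<zeta> x a))}"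
proof -
  have "finite ({x. fst x < n \<and> \<not> (fst (\<zeta> x) < 1 \<and> \<zeta> x = fst (germ_map \<zeta> (x, 1)) \<and> (\<exists>a. affine_at fp_flow fp_flow \<zeta> x a))}
    \<union> {x. fst x < n \<and> \<psi> (\<zeta> x) \<noteq> x})"
    using finite_irregular[OF pw_affine\<zeta>] pw_iso_inverse_cofinite[OF \<zeta>\<psi>] by simp
  then show ?thesis by (rule rev_finite_subset) blast
qed

lemma \<phi>X_good: "finite {z. \<not> (\<phi>X z \<in> TS X \<and> kX (\<phi>X z) = z \<and> (\<exists>a. affine_at rz_flow std_flow \<phi>X z a))}"
proof (rule rev_finite_subset[OF finite_Pair[OF finite_bad_\<psi>]], rule subsetI, rule ccontr)
  fix z assume z: "z \<in> {z. \<not> (\<phi>X z \<in> TS X \<and> kX (\<phi>X z) = z \<and> (\<exists>a. affine_at rz_flow std_flow \<phi>X z a))}"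
    "z \<notin> {z. (0, z) \<in> {x. fst x < 1 \<and> \<not> (\<psi> x \<in> T \<and> \<zeta> (\<psi> x) = x \<and> (\<exists>a. affine_at fp_flow fp_flow \<psi> x a))}}"
  then have g: "\<psi> (0, z) \<in> T" "\<zeta> (\<psi> (0, z)) = (0, z)" "\<exists>a. affine_at fp_flow fp_flow \<psi> (0, z) a" by auto
  obtain a where a: "affine_at fp_flow fp_flow \<psi> (0, z) a" using g(3) by blast
  obtain b where b: "affine_at rz_flow fp_flow (\<psi> \<circ> Pair 0) z b" using affine_at_comp'[OF affine_at_Pair a] by blast
  have tt: "\<psi> (0, z) \<in> std_points n CC" using g(1) by (simp add: T_std_points)
  then have "(\<psi> \<circ> Pair 0) z \<in> std_points n CC" by simp
  from affine_at_comp'[OF b affine_at_toX[OF this]] have "\<exists>c. affine_at rz_flow std_flow \<phi>X z c" unfolding \<phi>X_def .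
  moreover have "\<phi>X z \<in> TS X" using tt by (simp add: \<phi>X_def toX_TS)
  moreover have "kX (\<phi>X z) = z" using g(2) by (simp add: \<phi>X_def kX_def)
  ultimately show False using z(1) by blast
qed

lemma kX_good: "finite {p \<in> TS X. \<not> (\<phi>X (kX p) = p \<and> (\<exists>a. affine_at std_flow rz_flow kX p a))}"
proof (rule rev_finite_subset[OF finite_unX[OF finite_bad_\<zeta>]], rule subsetI, rule ccontr)
  fix p assume p: "p \<in> {p \<in> TS X. \<not> (\<phi>X (kX p) = p \<and> (\<exists>a. affine_at std_flow rz_flow kX p a))}"
    "p \<notin> {p \<in> TS X. unX p \<in> {x. fst x < n \<and> \<not> (fst (\<zeta> x) < 1 \<and> \<psi> (\<zeta> x) = x \<and> (\<exists>a. affine_at fp_flow fp_flow \<zeta> x a))}}"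
  then have "unX p \<in> std_points n CC" using unX_std_points by blast
  then have "fst (unX p) < n" by (simp add: std_points_def)
  then have g: "fst (\<zeta> (unX p)) < 1" "\<psi> (\<zeta> (unX p)) = unX p" "\<exists>a. affine_at fp_flow fp_flow \<zeta> (unX p) a" using p by auto
  obtain a where a: "affine_at fp_flow fp_flow \<zeta> (unX p) a" using g(3) by blast
  obtain b where b: "affine_at std_flow fp_flow (\<zeta> \<circ> unX) p b" using affine_at_comp'[OF affine_at_unX a] by blast
  have "\<exists>c. affine_at std_flow rz_flow kX p c" unfolding kX_def by (rule affine_at_comp'[OF b affine_at_snd])
  moreover have "(0, snd (\<zeta> (unX p))) = \<zeta> (unX p)" using g(1) by (simp add: prod_eq_iff)
  then have "\<phi>X (kX p) = p" using g(2) toX_unX[of p n CC] p(1) by (simp add: \<phi>X_def kX_def)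
  ultimately show False using p(1) by blast
qed

lemma \<phi>X_pc: "\<phi>X \<in> pc_maps RZ X" and kX_pc: "kX \<in> pc_maps X RZ"
  and kX_\<phi>X: "finite {z \<in> TS RZ. kX (\<phi>X z) \<noteq> z}"
proof -
  have 1: "finite {q \<in> TS X. \<phi>X (kX q) \<noteq> q}" by (rule rev_finite_subset[OF kX_good]) blast
  have 2: "finite {z. \<not> (\<phi>X z \<in> TS X \<and> kX (\<phi>X z) = z)}" by (rule rev_finite_subset[OF \<phi>X_good]) blast
  show "\<phi>X \<in> pc_maps RZ X"
    by (rule pc_mapsI[OF flowcurve_RZ flowcurve_std, where k = kX]) (use \<phi>X_good 1 in simp_all)
  show "kX \<in> pc_maps X RZ"
    by (rule pc_mapsI[OF flowcurve_std flowcurve_RZ, where k = \<phi>X]) (use kX_good 2 in simp_all)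
  show "finite {z \<in> TS RZ. kX (\<phi>X z) \<noteq> z}" by (rule rev_finite_subset[OF 2]) auto
qed

lemma hX_iso: "affine_iso X X hX"
  unfolding affine_iso_iff[OF flowcurve_std flowcurve_std]
proof
  show "bij_betw hX (TS X) (TS X)"
  proof (rule bij_betw_byWitness[where f' = "toX CC \<circ> (base_B (-1) \<circ> unX)"])
    have T: "unX p \<in> T" if "p \<in> TS X" for p using unX_std_points[OF that] by (simp add: T_std_points)
    show "\<forall>p\<in>TS X. (toX CC \<circ> (base_B (- 1) \<circ> unX)) (hX p) = p"
      using base_B_inverse[OF T, of _ 1] toX_unX[of _ n CC] by (simp add: hX_def)
    show "\<forall>p\<in>TS X. hX ((toX CC \<circ> (base_B (- 1) \<circ> unX)) p) = p"
      using base_B_inverse[OF T, of _ "-1"] toX_unX[of _ n CC] by (simp add: hX_def)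
    show "hX ` TS X \<subseteq> TS X" "(toX CC \<circ> (base_B (- 1) \<circ> unX)) ` TS X \<subseteq> TS X"
      using B_on_T(1)[OF T] by (auto simp: hX_def toX_TS T_std_points[symmetric])
  qed
  show "\<forall>p\<in>TS X. \<exists>a. affine_at std_flow std_flow hX p a"
  proof
    fix p assume "p \<in> TS X"
    then have T: "unX p \<in> T" using unX_std_points by (simp add: T_std_points)
    obtain w where w: "w \<noteq> 0" "\<And>v. v \<noteq> 0 \<Longrightarrow> B 1 (unX p, v) = (base_B 1 (unX p), w * v)" using B_on_T(2)[OF T] by blast
    obtain b where b: "affine_at std_flow fp_flow (base_B 1 \<circ> unX) p b"
      using affine_at_comp'[OF affine_at_unX base_B_affine_at[OF T w(2,1)]] by blast
    have "(base_B 1 \<circ> unX) p \<in> std_points n CC" using B_on_T(1)[OF T] by (simp add: T_std_points)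
    from affine_at_comp'[OF b affine_at_toX[OF this]] show "\<exists>a. affine_at std_flow std_flow hX p a" unfolding hX_def .
  qed
qed

text \<open>The automorphism is defined through germs. Here it is matched, off a finite set, with
  the composite of the original functions, so both give the same class.\<close>

lemma Bf1_base_B: "finite {x. fst x < n \<and> \<not> (fst (\<zeta> x) < 1 \<and> \<psi> (f (\<zeta> x)) = base_B 1 x)}"
proof -
  have "finite ({x. fst x < n \<and> \<not> (fst (\<zeta> x) < 1 \<and> \<psi> (\<zeta> x) = x \<and> (\<exists>a. affine_at fp_flow fp_flow \<zeta> x a))} \<union>
     {x. fst x < n \<and> \<not> (fst (B_fun 1 x) < n \<and> B_fun 1 x = fst (germ_map (B_fun 1) (x, 1)) \<and> (\<exists>a. affine_at fp_flow fp_flow (B_fun 1) x a))})"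
    using finite_bad_\<zeta> finite_irregular[OF B_fun_pw_affine] by simp
  then show ?thesis
    by (rule rev_finite_subset) (auto simp: B_fun_def f_pow_def base_B_def B_germ_map)
qed

end

lemma affine_on_standard_curve:
  assumes h: "h \<in> pc_maps RZ RZ" and m: "minimal (on_comps h) g l n \<zeta> \<psi>"
  shows "\<exists>X' \<in> standard_curves. \<exists>\<phi> \<in> PC_iso RZ X'.
    pc_comp X' X' (pc_comp RZ X' \<phi> (pc_class RZ RZ h)) (pc_inv RZ X' \<phi>) \<in> Aut_Aff X'"
proof -
  interpret minimal "on_comps h" g l n \<zeta> \<psi> by (rule m)
  note FR = flowcurve_RZ and FX = flowcurve_std[of n CC]
  have p1: "\<phi>X \<circ> h \<in> pc_maps RZ X" by (rule pc_maps_comp[OF FR FR FX h \<phi>X_pc])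
  have p2: "\<phi>X \<circ> h \<circ> kX \<in> pc_maps X X" by (rule pc_maps_comp[OF FX FR FX kX_pc p1])
  have "finite {p \<in> TS X. (\<phi>X \<circ> h \<circ> kX) p \<noteq> hX p}"
  proof (rule rev_finite_subset[OF finite_unX[OF Bf1_base_B]], rule subsetI, rule ccontr)
    fix p assume p: "p \<in> {p \<in> TS X. (\<phi>X \<circ> h \<circ> kX) p \<noteq> hX p}"
      "p \<notin> {p \<in> TS X. unX p \<in> {x. fst x < n \<and> \<not> (fst (\<zeta> x) < 1 \<and> \<psi> (on_comps h (\<zeta> x)) = base_B 1 x)}}"
    then have "unX p \<in> std_points n CC" using unX_std_points by blast
    then have "fst (unX p) < n" by (simp add: std_points_def)
    then have g: "fst (\<zeta> (unX p)) < 1" "\<psi> (on_comps h (\<zeta> (unX p))) = base_B 1 (unX p)" using p by auto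
    have "(0, h (snd (\<zeta> (unX p)))) = on_comps h (\<zeta> (unX p))" using g(1) by (simp add: on_comps_def)
    then have "(\<phi>X \<circ> h \<circ> kX) p = hX p" using g(2) by (simp add: \<phi>X_def kX_def hX_def)
    then show False using p(1) by blast
  qed
  moreover have "hX \<in> pc_maps X X"
    using hX_iso unfolding affine_iso_iff[OF FX FX] pc_maps_iff[OF FX FX] by (intro exI[of _ "{}"]) auto
  ultimately have "pc_class X X (\<phi>X \<circ> h \<circ> kX) = pc_class X X hX" using pc_class_eq_iff[OF p2] by blast
  moreover have "pc_comp X X (pc_comp RZ X (pc_class RZ X \<phi>X) (pc_class RZ RZ h)) (pc_inv RZ X (pc_class RZ X \<phi>X)) = pc_class X X (\<phi>X \<circ> h \<circ> kX)"
    unfolding pc_inv_pc_class[OF FR FX \<phi>X_pc kX_pc kX_\<phi>X] pc_comp_pc_class[OF FR FR FX h \<phi>X_pc] pc_comp_pc_class[OF FX FR FX kX_pc p1] ..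
  moreover have "pc_class X X hX \<in> Aut_Aff X" unfolding Aut_Aff_def using hX_iso by blast
  ultimately show ?thesis using std_standard PC_iso_pc_class[OF \<phi>X_pc] by metis
qed

section \<open>Distorted homeomorphisms of the circle\<close>

text \<open>Continuity enters only through \<open>base\<close>: all germs at a point are carried to
  germs at its image.\<close>

locale circle_homeo = sublinear +
  assumes base: "\<And>p. p \<in> germs 1 \<Longrightarrow> fst (germ_map f p) = f (fst p)"
    and inj: "inj_on f {x. fst x < 1}"
    and infinite_order: "\<And>k::nat. k > 0 \<Longrightarrow> \<exists>p\<in>germs 1. A (int k) p \<noteq> p"
begin

text \<open>Forward in time this is \<open>base\<close>. Backward in time it uses that
  \<open>f\<close> is injective.\<close>

lemma A_base:
  assumes "p \<in> germs 1" "q \<in> germs 1" "fst p = fst q" shows "fst (A k p) = fst (A k q)"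
proof (induction k rule: int_induct[where k = 0])
  case (step1 i)
  then show ?case using A_Suc assms base by simp
next
  case (step2 i)
  have "A i r = germ_map f (A (i - 1) r)" if "r \<in> germs 1" for r using A_Suc[OF that, of "i - 1"] by simp
  then have e: "f (fst (A (i - 1) p)) = f (fst (A (i - 1) q))" using step2 base assms by simp
  have m: "fst (A (i - 1) r) \<in> {x. fst x < 1}" if "r \<in> germs 1" for r
    using A_germs[OF that, of "i - 1"] unfolding germs_def by blast
  show ?case by (rule inj_onD[OF inj e m[OF assms(1)] m[OF assms(2)]])
qed (use assms in simp)

text \<open>The slope of the iterates at a returning germ is a power of \<open>c\<close>, whose
  logarithm grows linearly unless \<open>c = 1\<close>. The ordinary logarithm suffices, with the
  identity as functional.\<close>

lemma fixed_scale:
  assumes p: "p \<in> germs 1" and k: "k > 0" and c: "c > 0" "A (int k) p = sc c p" shows "c = 1"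
proof -
  have it: "A (int (k * N)) p = sc (c ^ N) p" for N
  proof (induction N)
    case (Suc N)
    have "A (int (k * Suc N)) p = A (int k) (A (int (k * N)) p)"
      using A_add[OF p, of "int k" "int (k * N)"] by (simp add: algebra_simps)
    also have "\<dots> = sc (c ^ N) (sc c p)" unfolding Suc using A_sc[OF p, of "c ^ N" "int k"] c by simp
    finally show ?case by (simp add: mult.commute)
  qed simp
  have "ln c = 0"
  proof (rule slope_growth[where u = "\<lambda>x. x" and C = 0, OF _ k p])
    fix N
    have "snd p \<noteq> 0" using p by (simp add: germs_def)
    then show "\<bar>ln \<bar>snd (A (int (k * N)) p) / snd p\<bar> - real N * ln c\<bar> \<le> 0"
      unfolding it using c by (simp add: ln_realpow)
  qed simp
  then show ?thesis using c by simp
qed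

text \<open>A returning germ is truly fixed by some power. Being fixed spreads to the opposite germs
  at the same point and along intervals, hence over the whole circle, which contradicts infinite
  order.\<close>

lemma no_periodic: assumes p0: "p0 \<in> germs 1" shows "\<not> periodic p0"
proof
  assume "periodic p0"
  then obtain k c where kc: "k \<noteq> 0" "c > 0" "A k p0 = sc c p0" by (auto simp: periodic_def)
  have "\<exists>k'::nat. \<exists>c'>0. k' > 0 \<and> A (int k') p0 = sc c' p0"
  proof (cases "k > 0")
    case True
    then show ?thesis using kc by (intro exI[of _ "nat k"] exI[of _ c]) auto
  next
    case False
    have "A (- k) (A k p0) = sc c (A (- k) p0)" using A_sc[OF p0 kc(2)] kc(3) by simp
    then have "p0 = sc c (A (- k) p0)" using A_minus[OF p0] by simp
    then have "sc (1 / c) p0 = sc (1 / c) (sc c (A (- k) p0))" by simp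
    then have "A (- k) p0 = sc (1 / c) p0" using kc(2) by simp
    then show ?thesis using kc False by (intro exI[of _ "nat (- k)"] exI[of _ "1 / c"]) auto
  qed
  then obtain k :: nat and c where kc: "k > 0" "c > 0" "A (int k) p0 = sc c p0" by blast
  \<comment> \<open>The opposite direction at \<open>q\<close> cannot be sent to the direction of
    \<open>q\<close>, which is already taken. So it returns to itself up to scale, and the scale is
    1.\<close>
  have fixp: "A (int k) p = p" if p: "p \<in> germs 1" "fst p = fst q" "q \<in> germs 1" "A (int k) q = q" for p q
  proof (cases "snd p * snd q > 0")
    case True
    have nz: "snd p \<noteq> 0" "snd q \<noteq> 0" using p by (auto simp: germs_def)
    then have d: "snd p / snd q > 0" using True by (auto simp: zero_less_mult_iff zero_less_divide_iff)
    have "p = sc (snd p / snd q) q" using p(2) nz by (simp add: prod_eq_iff)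
    then show ?thesis using A_sc[OF p(3) d, of "int k"] p(4) by metis
  next
    case False
    have nz: "snd p \<noteq> 0" "snd q \<noteq> 0" using p by (auto simp: germs_def)
    let ?r = "A (int k) p"
    have r: "?r \<in> germs 1" "fst ?r = fst p" using p A_base[OF p(1,3,2), of "int k"] by auto
    have nr: "snd ?r \<noteq> 0" using r by (simp add: germs_def)
    have "\<not> snd ?r * snd q > 0"
    proof
      assume "snd ?r * snd q > 0"
      then have d: "snd ?r / snd q > 0" by (auto simp: zero_less_mult_iff zero_less_divide_iff)
      have "?r = sc (snd ?r / snd q) q" using p(2) r(2) nz by (simp add: prod_eq_iff)
      then have "?r = A (int k) (sc (snd ?r / snd q) q)" using A_sc[OF p(3) d, of "int k"] p(4) by metis
      then have "p = sc (snd ?r / snd q) q" using A_inj[OF p(1)] sc_germs[OF d] p(3) by blast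
      then have "snd p = snd ?r / snd q * snd q" by (metis snd_sc)
      then show False using False \<open>snd ?r * snd q > 0\<close> nz by simp
    qed
    then have "snd ?r / snd p > 0" using False nz nr by (auto simp: zero_less_mult_iff zero_less_divide_iff)
    moreover have "?r = sc (snd ?r / snd p) p" using r(2) nz by (simp add: prod_eq_iff)
    ultimately show ?thesis using fixed_scale[OF p(1) kc(1)] by (metis sc_1)
  qed
  \<comment> \<open>Fixedness is both open and closed along a ray: nearby germs are fixed exactly
    when the map is the identity on the affine piece, that is, when the germ at the end point is
    fixed.\<close>
  have "\<exists>d. \<forall>z v. v = 1 \<or> v = - 1 \<longrightarrow> (A (int k) ((0, z), v) = ((0, z), v)) = d"
  proof (rule germ_constant)
    fix z
    have "((0, z), 1) \<in> germs 1" "((0, z), -1) \<in> germs 1" by auto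
    then show "(A (int k) ((0, z), - 1) = ((0, z), - 1)) = (A (int k) ((0, z), 1) = ((0, z), 1))"
      using fixp[of "((0, z), 1)" "((0, z), -1)"] fixp[of "((0, z), -1)" "((0, z), 1)"] by auto
  next
    fix z and v :: real assume v: "v = 1 \<or> v = -1"
    have P: "((0, z), v) \<in> germs 1" using v by auto
    obtain y w where yw: "A (int k) ((0, z), v) = (y, w)" by (cases "A (int k) ((0, z), v)")
    have v0: "v \<noteq> 0" using v by auto
    have "germ_map (f_pow (int k)) ((0, z), v) = (y, w)" using yw A_germ_map[OF P] by simp
    from germ_map_prop[OF f_pow_pw_affine P this]
    show "\<forall>\<^sub>F t in at_right 0. (A (int k) (fl (v * t) (0, z), v) = (fl (v * t) (0, z), v)) =
        (A (int k) ((0, z), v) = ((0, z), v))"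
    proof eventually_elim
      case (elim t)
      have "(fl (v * t) (0, z), v) \<in> germs 1" using v0 by simp
      then have "A (int k) (fl (v * t) (0, z), v) = (fl (w * t) y, w)" using elim A_germ_map v0 by simp
      then show ?case unfolding yw using fl_swap[of "v * t" y "v * t" "(0, z)"] by auto
    qed
  qed
  then obtain d where d: "\<And>z v. v = 1 \<or> v = (-1::real) \<Longrightarrow> (A (int k) ((0, z), v) = ((0, z), v)) = d" by blast
  have "A (int k) p0 = p0" using kc fixed_scale[OF p0] by (metis sc_1)
  moreover obtain z0 v0 where p0': "p0 = ((0, z0), v0)" using p0 by (cases p0) (auto simp: germs_def)
  ultimately have "A (int k) ((0, z0), 1) = ((0, z0), 1)" using fixp[of "((0, z0), 1)" p0] p0 by simp
  then have dT: "\<And>z. A (int k) ((0, z), 1) = ((0, z), 1)" using d by auto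
  obtain p where p: "p \<in> germs 1" "A (int k) p \<noteq> p" using infinite_order[OF kc(1)] by blast
  obtain z v where "p = ((0, z), v)" using p(1) by (cases p) (auto simp: germs_def)
  then show False using fixp[of p "((0, z), 1)"] dT p by simp
qed

text \<open>Pulling back an opposite germ through a power stays at the same base point, by
  \<open>A_base\<close>. So the new gluing only rescales speeds and never reconnects the
  circle.\<close>

lemma G_total: assumes "p \<in> germs 1" shows "\<exists>q. G p q \<and> fst q = fst p"
proof -
  obtain q k where q: "G p q" "q = A (- k) (opp (A k p))" using aperiodic_partner[OF assms no_periodic[OF assms]] by blast
  have "fst q = fst (A (- k) (A k p))" unfolding q(2) by (rule A_base) (use assms in auto)
  then have "fst q = fst p" using A_minus(1)[OF assms] by simp
  then show ?thesis using q(1) by blast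
qed

lemma G_opp: assumes "G p q" shows "\<exists>c>0. q = sc c (opp p)"
proof -
  have p: "p \<in> germs 1" "q \<in> germs 1" using G_germs[OF assms] .
  obtain q' where "G p q'" "fst q' = fst p" using G_total[OF p(1)] by blast
  then have b: "fst q = fst p" using G_unique[OF assms] by simp
  have nz: "snd p \<noteq> 0" "snd q \<noteq> 0" using p by (auto simp: germs_def)
  have "\<not> snd q / snd p > 0"
  proof
    assume d: "snd q / snd p > 0"
    have "q = sc (snd q / snd p) p" using b nz by (simp add: prod_eq_iff)
    then show False using G_not_sc[OF _ d] assms by metis
  qed
  then have "- snd q / snd p > 0" using nz by (auto simp: zero_less_divide_iff divide_less_0_iff not_less less_le)
  moreover have "q = sc (- snd q / snd p) (opp p)" using b nz by (simp add: prod_eq_iff)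
  ultimately show ?thesis by blast
qed

end

locale circle_minimal = circle_homeo f g l + minimal f g l n \<zeta> \<psi> for f g l n \<zeta> \<psi>
begin

text \<open>Every germ has a partner now, also at the ends, so all components are circles and none
  is an interval.\<close>

lemma HH_total: assumes "p \<in> germs n" shows "HH p (opp p)"
proof -
  have zp: "germ_map \<zeta> p \<in> germs 1" using pw_affine_germs[OF pw_affine\<zeta> assms] .
  obtain q' where q': "G (germ_map \<zeta> p) q'" using G_total[OF zp] by blast
  have q1: "q' \<in> germs 1" using G_germs(2)[OF q'] .
  have "HH p (germ_map \<psi> q')" unfolding H_def using q' pw_iso_inv[OF pw_iso_sym[OF \<zeta>\<psi>] q1] by simp
  then show ?thesis using HH_opp[OF assms pw_affine_germs[OF pw_affine\<psi> q1]] by simp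
qed

lemma \<zeta>_opp: "p \<in> germs n \<Longrightarrow> \<exists>c>0. germ_map \<zeta> (opp p) = sc c (opp (germ_map \<zeta> p))"
  using G_opp HH_total unfolding H_def by blast

lemma \<psi>_opp: assumes r: "r \<in> germs 1" shows "\<exists>c>0. germ_map \<psi> (opp r) = sc c (opp (germ_map \<psi> r))"
proof -
  let ?p = "germ_map \<psi> r"
  have p: "?p \<in> germs n" "germ_map \<zeta> ?p = r" using pw_affine_germs[OF pw_affine\<psi> r] pw_iso_inv[OF pw_iso_sym[OF \<zeta>\<psi>] r] by auto
  obtain c where c: "c > 0" "germ_map \<zeta> (opp ?p) = sc c (opp r)" using \<zeta>_opp[OF p(1)] p(2) by auto
  have "opp ?p = germ_map \<psi> (sc c (opp r))" using pw_iso_inv[OF \<zeta>\<psi>, of "opp ?p"] p(1) c(2) by simp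
  also have "\<dots> = sc c (germ_map \<psi> (opp r))" by (rule germ_map_sc[OF pw_affine\<psi> _ c(1)]) (use r in simp)
  finally have "sc (1 / c) (opp ?p) = sc (1 / c) (sc c (germ_map \<psi> (opp r)))" by simp
  then have "germ_map \<psi> (opp r) = sc (1 / c) (opp ?p)" using c(1) by simp
  then show ?thesis using c(1) by (intro exI[of _ "1 / c"]) simp
qed

lemma norm_GP1: assumes "r \<in> germs 1"
  obtains z v where "v = 1 \<or> v = (-1::real)" "r = sc \<bar>snd r\<bar> ((0, z), v)" "((0, z), v) \<in> germs 1" "\<bar>snd r\<bar> > 0"
proof (rule that[of "sgn (snd r)" "snd (fst r)"])
  show "r = sc \<bar>snd r\<bar> ((0, snd (fst r)), sgn (snd r))"
    using assms by (cases r) (auto simp: abs_mult_sgn germs_def prod_eq_iff)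
qed (use assms in \<open>auto simp: germs_def sgn_real_def\<close>)

text \<open>\<open>germ_constant\<close> for a quantity that depends on a germ and its image but not
  on where they sit within their components. It serves for the component index and for the relative
  orientation.\<close>

lemma \<psi>_constant:
  fixes \<Phi> :: "germ \<Rightarrow> germ \<Rightarrow> 'a"
  assumes "\<And>p q c. p \<in> germs n \<Longrightarrow> q \<in> germs 1 \<Longrightarrow> c > 0 \<Longrightarrow> \<Phi> (sc c (opp p)) (opp q) = \<Phi> p q"
    "\<And>s y w x v. v \<noteq> 0 \<Longrightarrow> w \<noteq> 0 \<Longrightarrow> \<Phi> (fl s y, w) (x, v) = \<Phi> (y, w) (x, v)"
    "\<And>p x y v. \<Phi> p (x, v) = \<Phi> p (y, v)"
    "\<And>p q c. p \<in> germs n \<Longrightarrow> q \<in> germs 1 \<Longrightarrow> c > 0 \<Longrightarrow> \<Phi> (sc c p) (sc c q) = \<Phi> p q"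
  shows "\<exists>d. \<forall>r\<in>germs 1. \<Phi> (germ_map \<psi> r) r = d"
proof -
  have "\<exists>d. \<forall>z v. v = 1 \<or> v = - 1 \<longrightarrow> \<Phi> (germ_map \<psi> ((0, z), v)) ((0, z), v) = d"
  proof (rule germ_constant)
    fix z
    have P: "((0, z), 1) \<in> germs 1" by simp
    obtain c where c: "c > 0" "germ_map \<psi> ((0, z), -1) = sc c (opp (germ_map \<psi> ((0, z), 1)))" using \<psi>_opp[OF P] by auto
    show "\<Phi> (germ_map \<psi> ((0, z), - 1)) ((0, z), - 1) = \<Phi> (germ_map \<psi> ((0, z), 1)) ((0, z), 1)"
      unfolding c(2) using assms(1)[OF pw_affine_germs[OF pw_affine\<psi> P] P c(1)] by simp
  next
    fix z and v :: real assume v: "v = 1 \<or> v = -1"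
    have P: "((0, z), v) \<in> germs 1" "v \<noteq> 0" using v by auto
    obtain y w where yw: "germ_map \<psi> ((0, z), v) = (y, w)" by (cases "germ_map \<psi> ((0, z), v)")
    have w: "w \<noteq> 0" using pw_affine_germs[OF pw_affine\<psi> P(1)] yw by simp
    show "\<forall>\<^sub>F t in at_right 0. \<Phi> (germ_map \<psi> (fl (v * t) (0, z), v)) (fl (v * t) (0, z), v) = \<Phi> (germ_map \<psi> ((0, z), v)) ((0, z), v)"
      using germ_map_prop[OF pw_affine\<psi> P(1) yw]
    proof eventually_elim
      case (elim t)
      then have e: "germ_map \<psi> (fl (v * t) (0, z), v) = (fl (w * t) y, w)" using P(2) by simp
      show ?case unfolding e yw using assms(2)[OF P(2) w] assms(3) by metis
    qed
  qed
  then obtain d where d: "\<And>z v. v = 1 \<or> v = (-1::real) \<Longrightarrow> \<Phi> (germ_map \<psi> ((0, z), v)) ((0, z), v) = d" by blast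
  have "\<Phi> (germ_map \<psi> r) r = d" if r: "r \<in> germs 1" for r
  proof -
    obtain z v where v: "v = 1 \<or> v = (-1::real)" "r = sc \<bar>snd r\<bar> ((0, z), v)" "((0, z), v) \<in> germs 1" "\<bar>snd r\<bar> > 0"
      using norm_GP1[OF r] .
    have "germ_map \<psi> r = sc \<bar>snd r\<bar> (germ_map \<psi> ((0, z), v))" using germ_map_sc[OF pw_affine\<psi> v(3,4)] v(2) by metis
    then show ?thesis using assms(4)[OF pw_affine_germs[OF pw_affine\<psi> v(3)] v(3,4)] d[OF v(1)] v(2) by metis
  qed
  then show ?thesis by blast
qed

text \<open>The image of the connected circle lies in one component, and \<open>\<psi>\<close>
  reaches every component.\<close>

lemma n_one: "n = 1"
proof -
  have "\<exists>d. \<forall>r\<in>germs 1. (\<lambda>p q. fst (fst p)) (germ_map \<psi> r) r = d" by (rule \<psi>_constant) auto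
  then obtain d where d: "\<And>r. r \<in> germs 1 \<Longrightarrow> fst (fst (germ_map \<psi> r)) = d" by auto
  have all: "i = d" if "i < n" for i
  proof -
    have "((i, to_rz 0), 1) \<in> germs n" using that by simp
    then show ?thesis using d[OF pw_affine_germs[OF pw_affine\<zeta>], of "((i, to_rz 0), 1)"] pw_iso_inv[OF \<zeta>\<psi>, of "((i, to_rz 0), 1)"] by simp
  qed
  have "((0, to_rz 0), 1) \<in> germs 1" by simp
  then have "fst (fst (germ_map \<psi> ((0, to_rz 0), 1))) < n" using pw_affine_germs[OF pw_affine\<psi>] by (auto simp: germs_def)
  then have "n > 0" by simp
  moreover have "\<not> n > 1" using all[of 0] all[of 1] by auto
  ultimately show ?thesis by simp
qed

lemma orientation: "(\<forall>r\<in>germs 1. snd (germ_map \<psi> r) * snd r > 0) \<or> (\<forall>r\<in>germs 1. snd (germ_map \<psi> r) * snd r < 0)"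
proof -
  have "\<exists>d. \<forall>r\<in>germs 1. (\<lambda>p q. snd p * snd q > 0) (germ_map \<psi> r) r = d"
    by (rule \<psi>_constant) (auto simp: zero_less_mult_iff mult_less_0_iff)
  moreover have "snd (germ_map \<psi> r) * snd r \<noteq> 0" if "r \<in> germs 1" for r using pw_affine_germs[OF pw_affine\<psi> that] that by (simp add: germs_def)
  ultimately show ?thesis by (metis linorder_neqE_linordered_idom)
qed

lemma oriented_exists:
  "\<exists>\<zeta>' \<psi>'. minimal f g l 1 \<zeta>' \<psi>' \<and> (\<forall>r\<in>germs 1. snd (germ_map \<psi>' r) * snd r > 0)"
proof (cases "\<forall>r\<in>germs 1. snd (germ_map \<psi> r) * snd r > 0")
  case True
  then show ?thesis using minimal_axioms n_one by blast
next
  case False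
  then have neg: "\<And>r. r \<in> germs 1 \<Longrightarrow> snd (germ_map \<psi> r) * snd r < 0" using orientation by blast
  \<comment> \<open>The reflection \<open>x \<mapsto> - x\<close>; composing with it makes
    \<open>\<psi>\<close> orientation-preserving.\<close>
  let ?N = "permute_flip id (\<lambda>_. True)"
  have "pw_iso 1 1 ?N (permute_flip id ((\<lambda>_. True) \<circ> id))" by (rule pw_iso_permute_flip) auto
  then have N: "pw_iso 1 1 ?N ?N" by (simp add: comp_def)
  note Z1 = \<zeta>\<psi>[unfolded n_one] and PZ1 = pw_affine\<zeta>[unfolded n_one] and PP1 = pw_affine\<psi>[unfolded n_one]
  have gN: "germ_map ?N ((i, z), v) = ((i, rz_neg z), - v)" for i z v using germ_map_permute_flip[of id "\<lambda>_. True" i z v] by simp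
  have gz: "germ_map (\<zeta> \<circ> ?N) p = germ_map \<zeta> (germ_map ?N p)" if "p \<in> germs 1" for p using germ_map_comp[OF pw_iso_pw_affine(1)[OF N] PZ1 that] .
  have "minimal f g l 1 (\<zeta> \<circ> ?N) (?N \<circ> \<psi>)"
  proof unfold_locales
    have "H (\<zeta> \<circ> ?N) (x, 1) (x, -1)" if "fst x < 1" for x
    proof -
      obtain i z where x: "x = (i, z)" by (cases x)
      have P: "(x, 1) \<in> germs 1" "(x, -1) \<in> germs 1" using that by auto
      have "HH ((i, rz_neg z), - 1) ((i, rz_neg z), 1)" using HH_total[of "((i, rz_neg z), - 1)"] that n_one x by simp
      then show ?thesis unfolding H_def gz[OF P(1)] gz[OF P(2)] unfolding x gN by simp
    qed
    then show "Good 1 (\<zeta> \<circ> ?N) (?N \<circ> \<psi>)" unfolding Good_def using pw_iso_comp[OF N Z1] by blast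
  next
    fix i j a b assume h: "i < (1::nat)" "j < (1::nat)" "a \<noteq> (0::real)" "b \<noteq> (0::real)" "H (\<zeta> \<circ> ?N) ((i, to_rz 0), a) ((j, to_rz 0), b)"
    have "HH ((i, to_rz 0), - a) ((j, to_rz 0), - b)"
      using h gz[of "((i, to_rz 0), a)"] gz[of "((j, to_rz 0), b)"] unfolding H_def gN by simp
    then show "i = j \<and> a * b < 0" using ends[of i j "-a" "-b"] h n_one by simp
  qed
  moreover have "snd (germ_map (?N \<circ> \<psi>) r) * snd r > 0" if r: "r \<in> germs 1" for r
  proof -
    obtain i z v where "germ_map \<psi> r = ((i, z), v)" by (metis surj_pair)
    then show ?thesis using neg[OF r] germ_map_comp[OF PP1 pw_iso_pw_affine(1)[OF N] r] gN by simp
  qed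
  ultimately show ?thesis by blast
qed

end

section \<open>Conjugation to a rotation\<close>

definition base_map :: "(fp \<Rightarrow> fp) \<Rightarrow> rz \<Rightarrow> rz" where "base_map F z = snd (fst (germ_map F ((0, z), 1)))"

locale circle_map =
  fixes F :: "fp \<Rightarrow> fp"
  assumes PAF: "pw_affine 1 1 F" and pos: "\<And>p. p \<in> germs 1 \<Longrightarrow> snd (germ_map F p) * snd p > 0"
    and same_base: "\<And>p. p \<in> germs 1 \<Longrightarrow> fst (germ_map F (opp p)) = fst (germ_map F p)"
begin

lemma germ_map_base_map: assumes "v \<noteq> 0" shows "\<exists>w. w * v > 0 \<and> germ_map F ((0, z), v) = ((0, base_map F z), w)"
proof -
  have P: "((0, z), v) \<in> germs 1" "((0, z), 1) \<in> germs 1" using assms by auto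
  have "fst (germ_map F ((0, z), v)) = fst (germ_map F ((0, z), 1))"
  proof (cases "v > 0")
    case True
    then show ?thesis using germ_map_sc[OF PAF P(2) True] by simp
  next
    case False
    then have nv: "- v > 0" using assms by simp
    show ?thesis using germ_map_sc[OF PAF _ nv, of "((0, z), - 1)"] same_base[OF P(2)] by simp
  qed
  moreover have "fst (fst (germ_map F ((0, z), 1))) < 1" using pw_affine_germs[OF PAF P(2)] by (simp add: germs_def)
  ultimately have "fst (germ_map F ((0, z), v)) = (0, base_map F z)" by (simp add: base_map_def prod_eq_iff)
  then show ?thesis using pos[OF P(1)] by (intro exI[of _ "snd (germ_map F ((0, z), v))"]) (simp add: prod_eq_iff)
qed

text \<open>The one-sided slopes at \<open>z\<close> are both positive but may differ, so the
  displacement is an increasing function that is linear on each side only.\<close>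

lemma base_map_near:
  "\<exists>s d M. d > 0 \<and> M > 0 \<and> strict_mono (s :: real \<Rightarrow> real) \<and>
     (\<forall>t. \<bar>s t\<bar> \<le> M * \<bar>t\<bar>) \<and> (\<forall>t. \<bar>t\<bar> < d \<longrightarrow> base_map F (rotation t z) = rotation (s t) (base_map F z))"
proof -
  obtain w1 where w1: "w1 > 0" "germ_map F ((0, z), 1) = ((0, base_map F z), w1)" using germ_map_base_map[of 1 z] by auto
  obtain w2' where w2': "w2' < 0" "germ_map F ((0, z), -1) = ((0, base_map F z), w2')" using germ_map_base_map[of "-1" z] by auto
  define w2 where "w2 = - w2'"
  have w2: "w2 > 0" "germ_map F ((0, z), -1) = ((0, base_map F z), - w2)" using w2' by (auto simp: w2_def)
  have P: "((0, z), 1) \<in> germs 1" "((0, z), -1) \<in> germs 1" by auto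
  have "eventually (\<lambda>t. base_map F (rotation t z) = rotation (w1 * t) (base_map F z)) (at_right 0)"
    using germ_map_prop[OF PAF P(1) w1(2)] by eventually_elim (simp add: base_map_def[of F "rotation _ z"] fl_def)
  then obtain d1 where d1: "d1 > 0" "\<And>t. 0 < t \<Longrightarrow> t < d1 \<Longrightarrow> base_map F (rotation t z) = rotation (w1 * t) (base_map F z)"
    unfolding ev_right by auto
  have "eventually (\<lambda>t. base_map F (rotation (- t) z) = rotation (- w2 * t) (base_map F z)) (at_right 0)"
    using germ_map_prop[OF PAF P(2) w2(2)] by eventually_elim (simp add: base_map_def[of F "rotation _ z"] fl_def)
  then obtain d2 where d2: "d2 > 0" "\<And>t. 0 < t \<Longrightarrow> t < d2 \<Longrightarrow> base_map F (rotation (- t) z) = rotation (- w2 * t) (base_map F z)"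
    unfolding ev_right by auto
  define s where "s t = (if t \<ge> 0 then w1 * t else w2 * t)" for t
  have "strict_mono s"
  proof (rule strict_monoI)
    fix a b :: real assume ab: "a < b"
    consider "a \<ge> 0" | "b < 0" | "a < 0" "b \<ge> 0" by linarith
    then show "s a < s b"
    proof cases
      case 3
      then have "w2 * a < 0" "0 \<le> w1 * b" using w1 w2 by (auto simp: mult_pos_neg)
      then show ?thesis using 3 by (simp add: s_def)
    qed (use ab w1 w2 in \<open>auto simp: s_def\<close>)
  qed
  moreover have "\<bar>s t\<bar> \<le> max w1 w2 * \<bar>t\<bar>" for t
    using w1 w2 by (auto simp: s_def abs_mult intro!: mult_right_mono)
  moreover have "base_map F (rotation t z) = rotation (s t) (base_map F z)" if "\<bar>t\<bar> < min d1 d2" for t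
    using d1(2)[of t] d2(2)[of "-t"] that by (cases t "0 :: real" rule: linorder_cases) (auto simp: s_def)
  ultimately show ?thesis using d1(1) d2(1) w1(1)
    by (intro exI[of _ s] exI[of _ "min d1 d2"] exI[of _ "max w1 w2"]) (auto simp: less_max_iff_disj)
qed

lemma base_map_continuous: "continuous_map (curve_top RZ) (curve_top RZ) (base_map F)"
proof (rule flow_continuous[OF flowcurve_RZ flowcurve_RZ])
  fix z
  obtain s d M where sdM: "d > 0" "M > 0" "\<And>t. \<bar>s t\<bar> \<le> M * \<bar>t\<bar>"
    "\<And>t. \<bar>t\<bar> < d \<Longrightarrow> base_map F (rotation t z) = rotation (s t) (base_map F z)" using base_map_near[of z] by blast
  then show "\<exists>M>0. \<exists>d>0. \<forall>t. \<bar>t\<bar> < d \<longrightarrow> (\<exists>s. \<bar>s\<bar> \<le> M * \<bar>t\<bar> \<and> base_map F (rotation t z) = rotation s (base_map F z))"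
    by meson
qed simp

lemma base_map_orientation: "orientation_preserving RZ (base_map F)"
  unfolding orientation_preserving_def
proof (intro ballI case_prodI2 impI)
  fix x y p U f V g assume x: "x \<in> charts RZ" "x = (U, f)" and y: "y \<in> charts RZ" "y = (V, g)" and p: "p \<in> U" "base_map F p \<in> V"
  have Uf: "(U, f) \<in> charts RZ" and Vg: "(V, g) \<in> charts RZ" using x y by auto
  obtain s d M where sdM: "d > 0" "M > 0" "strict_mono s" "\<And>t. \<bar>s t\<bar> \<le> M * \<bar>t\<bar>"
    "\<And>t. \<bar>t\<bar> < d \<Longrightarrow> base_map F (rotation t p) = rotation (s t) (base_map F p)" using base_map_near[of p] by blast
  obtain d2 where d2: "d2 > 0" "\<And>t. \<bar>t\<bar> < d2 \<Longrightarrow> rotation t p \<in> U \<and> f (rotation t p) = f p + t"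
    using flowcurve_chart[OF flowcurve_RZ Uf] p(1) by blast
  obtain d3 where d3: "d3 > 0" "\<And>t. \<bar>t\<bar> < d3 \<Longrightarrow> rotation t (base_map F p) \<in> V \<and> g (rotation t (base_map F p)) = g (base_map F p) + t"
    using flowcurve_chart[OF flowcurve_RZ Vg] p(2) by blast
  let ?d = "min d (min d2 (d3 / M))"
  have "?d > 0" using sdM d2 d3 by simp
  then obtain W where W: "openin (curve_top RZ) W" "p \<in> W" "\<And>q. q \<in> W \<Longrightarrow> \<exists>t. \<bar>t\<bar> < ?d \<and> q = rotation t p"
    using flowcurve_nbhd[OF flowcurve_RZ, of p ?d] by auto
  have key: "\<exists>t. q \<in> U \<and> base_map F q \<in> V \<and> f q = f p + t \<and> g (base_map F q) = g (base_map F p) + s t" if q: "q \<in> W" for q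
  proof -
    obtain t where t: "\<bar>t\<bar> < ?d" "q = rotation t p" using W(3)[OF q] by blast
    have "M * \<bar>t\<bar> < d3" using t(1) sdM(2) by (simp add: pos_less_divide_eq mult.commute)
    then have "\<bar>s t\<bar> < d3" using sdM(4)[of t] by linarith
    then show ?thesis using t d2(2)[of t] d3(2)[of "s t"] sdM(5)[of t] by (intro exI[of _ t]) auto
  qed
  show "\<exists>W. openin (curve_top RZ) W \<and> p \<in> W \<and> W \<subseteq> U \<and> base_map F ` W \<subseteq> V \<and>
      (\<forall>x\<in>W. \<forall>y\<in>W. f x < f y \<longrightarrow> g (base_map F x) < g (base_map F y))"
  proof (intro exI[of _ W] conjI ballI impI)
    show "openin (curve_top RZ) W" "p \<in> W" by fact+
    show "W \<subseteq> U" "base_map F ` W \<subseteq> V" using key by blast+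
    fix a b assume ab: "a \<in> W" "b \<in> W" "f a < f b"
    obtain t where t: "f a = f p + t" "g (base_map F a) = g (base_map F p) + s t" using key[OF ab(1)] by blast
    obtain t' where t': "f b = f p + t'" "g (base_map F b) = g (base_map F p) + s t'" using key[OF ab(2)] by blast
    have "s t < s t'" using sdM(3) ab(3) t(1) t'(1) by (simp add: strict_mono_less)
    then show "g (base_map F a) < g (base_map F b)" using t t' by simp
  qed
qed

end

lemma circle_map_inverse:
  assumes "circle_map F" "circle_map F'" "pw_iso 1 1 F F'" shows "base_map F' (base_map F z) = z"
proof -
  interpret F: circle_map F by fact
  interpret F': circle_map F' by fact
  obtain w where w: "w * 1 > 0" "germ_map F ((0, z), 1) = ((0, base_map F z), w)" using F.germ_map_base_map[of 1 z] by auto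
  then obtain w' where w': "germ_map F' ((0, base_map F z), w) = ((0, base_map F' (base_map F z)), w')" using F'.germ_map_base_map[of w "base_map F z"] by auto
  have "germ_map F' (germ_map F ((0, z), 1)) = ((0, z), 1)" by (rule pw_iso_inv[OF assms(3)]) simp
  then show ?thesis using w w' by simp
qed

lemma circle_map_homeo:
  assumes "circle_map F" "circle_map F'" "pw_iso 1 1 F F'"
  shows "homeomorphic_map (curve_top RZ) (curve_top RZ) (base_map F)"
  unfolding homeomorphic_map_maps homeomorphic_maps_def
  using circle_map.base_map_continuous[OF assms(1)] circle_map.base_map_continuous[OF assms(2)]
    circle_map_inverse[OF assms] circle_map_inverse[OF assms(2,1) pw_iso_sym[OF assms(3)]] by blast

text \<open>The raw function, good enough for computing classes. The representative known to be a
  homeomorphism is \<open>base_map\<close>, which differs from it at finitely many points.\<close>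

definition circle_part :: "(fp \<Rightarrow> fp) \<Rightarrow> rz \<Rightarrow> rz" where "circle_part F = snd \<circ> (F \<circ> Pair 0)"

lemma circle_part_inverse: assumes "pw_iso 1 1 F F'" shows "finite {z. circle_part F' (circle_part F z) \<noteq> z}"
proof -
  note P = pw_iso_pw_affine[OF assms]
  have "finite ({x. fst x < 1 \<and> \<not> (fst (F x) < 1 \<and> F x = fst (germ_map F (x, 1)) \<and> (\<exists>a. affine_at fp_flow fp_flow F x a))} \<union> {x. fst x < 1 \<and> F' (F x) \<noteq> x})"
    using finite_irregular[OF P(1)] pw_iso_inverse_cofinite[OF assms] by simp
  note fin = finite_Pair[OF this]
  show ?thesis
  proof (rule rev_finite_subset[OF fin], rule subsetI, rule ccontr)
    fix z assume z: "z \<in> {z. circle_part F' (circle_part F z) \<noteq> z}" "z \<notin> {z. (0, z) \<in> {x. fst x < 1 \<and> \<not> (fst (F x) < 1 \<and> F x = fst (germ_map F (x, 1)) \<and> (\<exists>a. affine_at fp_flow fp_flow F x a))} \<union> {x. fst x < 1 \<and> F' (F x) \<noteq> x}}"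
    then have g: "fst (F (0, z)) < 1" "F' (F (0, z)) = (0, z)" by auto
    have "(0, snd (F (0, z))) = F (0, z)" using g(1) by (simp add: prod_eq_iff)
    then have "circle_part F' (circle_part F z) = z" using g(2) by (simp add: circle_part_def)
    then show False using z(1) by blast
  qed
qed

lemma circle_part_pc: assumes "pw_iso 1 1 F F'" shows "circle_part F \<in> pc_maps RZ RZ"
proof (rule pc_mapsI[OF flowcurve_RZ flowcurve_RZ, where k = "circle_part F'"])
  note P = pw_iso_pw_affine[OF assms]
  have "affine_at fp_flow fp_flow F (0, z) a \<Longrightarrow> \<exists>c. affine_at rz_flow rz_flow (circle_part F) z c" for z a
  proof -
    assume a: "affine_at fp_flow fp_flow F (0, z) a"
    obtain b where b: "affine_at rz_flow fp_flow (F \<circ> Pair 0) z b" using affine_at_comp'[OF affine_at_Pair a] by blast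
    from affine_at_comp'[OF b affine_at_snd] show ?thesis unfolding circle_part_def .
  qed
  then have sub: "{p \<in> TS RZ. \<not> (circle_part F p \<in> TS RZ \<and> circle_part F' (circle_part F p) = p \<and> (\<exists>a. affine_at rz_flow rz_flow (circle_part F) p a))} \<subseteq>
    {z. circle_part F' (circle_part F z) \<noteq> z} \<union> {z. (0, z) \<in> {x. fst x < 1 \<and> \<not> (fst (F x) < 1 \<and> F x = fst (germ_map F (x, 1)) \<and> (\<exists>a. affine_at fp_flow fp_flow F x a))}}"
    by auto
  show "finite {p \<in> TS RZ. \<not> (circle_part F p \<in> TS RZ \<and> circle_part F' (circle_part F p) = p \<and> (\<exists>a. affine_at rz_flow rz_flow (circle_part F) p a))}"
    by (rule finite_subset[OF sub]) (use circle_part_inverse[OF assms] finite_Pair[OF finite_irregular[OF P(1)]] in simp)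
  show "finite {q \<in> TS RZ. \<not> (circle_part F' q \<in> TS RZ \<and> circle_part F (circle_part F' q) = q)}" using circle_part_inverse[OF pw_iso_sym[OF assms]] by simp
qed

lemma circle_part_base_map: assumes "pw_affine 1 1 F" shows "finite {z. circle_part F z \<noteq> base_map F z}"
  by (rule rev_finite_subset[OF finite_Pair[OF finite_irregular[OF assms]]]) (auto simp: circle_part_def base_map_def)

section \<open>The conjugated map is an irrational rotation\<close>

locale circle_oriented = circle_minimal f g l 1 \<zeta> \<psi> for f g l \<zeta> \<psi> +
  assumes oriented: "\<And>r. r \<in> germs 1 \<Longrightarrow> snd (germ_map \<psi> r) * snd r > 0"
begin

lemma circle_map_\<psi>: "circle_map \<psi>"
proof
  show "pw_affine 1 1 \<psi>" by (rule pw_affine\<psi>)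
  show "fst (germ_map \<psi> (opp p)) = fst (germ_map \<psi> p)" if "p \<in> germs 1" for p using \<psi>_opp[OF that] by auto
qed (rule oriented)

lemma circle_map_\<zeta>: "circle_map \<zeta>"
proof
  show "pw_affine 1 1 \<zeta>" by (rule pw_affine\<zeta>)
  show "fst (germ_map \<zeta> (opp p)) = fst (germ_map \<zeta> p)" if "p \<in> germs 1" for p using \<zeta>_opp[OF that] by auto
  show "snd (germ_map \<zeta> p) * snd p > 0" if "p \<in> germs 1" for p
    using oriented[OF pw_affine_germs[OF pw_affine\<zeta> that]] pw_iso_inv[OF \<zeta>\<psi> that] by (simp add: mult.commute)
qed

lemma T_all: "fst x < 1 \<Longrightarrow> x \<in> T"
  using HH_total[of "(x, 1)"] by (simp add: T_def)

lemma B_slope: "\<exists>m. m \<noteq> 0 \<and> (\<forall>z v. v \<noteq> 0 \<longrightarrow> B k ((0, z), v) = (base_B k (0, z), m * v))"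
proof -
  have "\<exists>m. \<forall>z v. v = 1 \<or> v = - 1 \<longrightarrow> snd (B k ((0, z), v)) / snd ((0 :: nat, z), v) = m"
  proof (rule germ_constant[where \<Phi> = "\<lambda>p. snd (B k p) / snd p" and i = 0])
    fix z
    obtain w where "\<And>v. v \<noteq> 0 \<Longrightarrow> B k ((0, z), v) = (base_B k (0, z), w * v)" using B_on_T(2)[OF T_all, of "(0, z)" k] by auto
    then show "snd (B k ((0, z), -1)) / snd ((0 :: nat, z), -1 :: real) = snd (B k ((0, z), 1)) / snd ((0 :: nat, z), 1 :: real)" by simp
  next
    fix z and v :: real assume v: "v = 1 \<or> v = -1"
    have P: "((0, z), v) \<in> germs 1" "v \<noteq> 0" using v by auto
    obtain y w where yw: "B k ((0, z), v) = (y, w)" by (cases "B k ((0, z), v)")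
    show "\<forall>\<^sub>F t in at_right 0. snd (B k (fl (v * t) (0, z), v)) / snd (fl (v * t) (0, z), v) = snd (B k ((0, z), v)) / snd ((0 :: nat, z), v)"
      using B_prop[OF P(1) yw] by eventually_elim (use P(2) in \<open>simp add: yw\<close>)
  qed
  then obtain m where m: "\<And>z. snd (B k ((0, z), 1)) = m" by auto
  have "B k ((0, z), v) = (base_B k (0, z), m * v)" if "v \<noteq> 0" for z v
  proof -
    obtain w where w: "\<And>v. v \<noteq> 0 \<Longrightarrow> B k ((0, z), v) = (base_B k (0, z), w * v)" using B_on_T(2)[OF T_all, of "(0, z)" k] by auto
    then show ?thesis using m[of z] that by simp
  qed
  moreover have "m \<noteq> 0" using m[of "to_rz 0"] B_germs[of "((0, to_rz 0), 1)" k] by (auto simp: germs_def)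
  ultimately show ?thesis by blast
qed

text \<open>A map of the circle with constant slope is globally affine, and going once around the
  circle must close up, so the slope is an integer.\<close>

lemma base_B_global:
  assumes m: "m \<noteq> 0" "\<And>z v. v \<noteq> 0 \<Longrightarrow> B k ((0, z), v) = (base_B k (0, z), m * v)" and x: "fst x < 1"
  shows "base_B k (fl t x) = fl (m * t) (base_B k x)" "m \<in> \<int>"
proof -
  \<comment> \<open>The expected displacement is undone. The result is locally constant in
    \<open>t\<close>, hence constant.\<close>
  define D where "D t = fl (- (m * t)) (base_B k (fl t x))" for t
  have D0: "D t = D 0" for t
  proof (rule connected_local_const[where A = UNIV and f = D])
    show "\<forall>a\<in>UNIV. \<forall>\<^sub>F b in at a. D a = D b"
    proof
      fix a
      have T: "fl a x \<in> T" using T_all x by simp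
      obtain z where z: "fl a x = (0, z)" using x by (cases "fl a x") (metis fst_conv fst_fl less_one)
      have "affine_at fp_flow fp_flow (base_B k) (fl a x) m" by (rule base_B_affine_at[OF T]) (use m z in auto)
      then obtain d where d: "d > 0" "\<And>t. \<bar>t\<bar> < d \<Longrightarrow> base_B k (fl t (fl a x)) = fl (m * t) (base_B k (fl a x))"
        unfolding affine_at_def by blast
      have "D a = D b" if "\<bar>b - a\<bar> < d" for b
        using d(2)[OF that] by (simp add: D_def algebra_simps)
      then show "\<forall>\<^sub>F b in at a. D a = D b"
        unfolding eventually_at dist_real_def using d(1) by (intro exI[of _ d]) auto
    qed
  qed auto
  have "fl (m * t) (D t) = fl (m * t) (D 0)" for t by (rule arg_cong[OF D0])
  then have g: "base_B k (fl t x) = fl (m * t) (base_B k x)" for t by (simp add: D_def)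
  then show "base_B k (fl t x) = fl (m * t) (base_B k x)" .
  have "fl 1 x = x" using fl_eq_iff[of 1 x 0] by simp
  then have "fl m (base_B k x) = base_B k x" using g[of 1] by simp
  then show "m \<in> \<int>" using fl_eq_iff[of m "base_B k x" 0] by simp
qed

lemma B_infinite: assumes "k > 0" shows "\<exists>p\<in>germs 1. B (int k) p \<noteq> p"
proof (rule ccontr)
  assume a: "\<not> ?thesis"
  obtain p where p: "p \<in> germs 1" "A (int k) p \<noteq> p" using infinite_order[OF assms] by blast
  have q: "germ_map \<psi> p \<in> germs 1" "germ_map \<zeta> (germ_map \<psi> p) = p" using pw_affine_germs[OF pw_affine\<psi> p(1)] pw_iso_inv[OF pw_iso_sym[OF \<zeta>\<psi>] p(1)] by auto
  then have "B (int k) (germ_map \<psi> p) = germ_map \<psi> p" using a by blast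
  then show False using \<zeta>B[OF q(1), of "int k"] q(2) p(2) by simp
qed

lemma base_B_rotation: "\<exists>r. r \<notin> \<rat> \<and> (\<forall>z. snd (base_B 1 (0, z)) = rotation r z)"
proof -
  obtain m where m: "m \<noteq> 0" "\<And>z v. v \<noteq> 0 \<Longrightarrow> B 1 ((0, z), v) = (base_B 1 (0, z), m * v)" using B_slope by blast
  obtain m' where m': "m' \<noteq> 0" "\<And>z v. v \<noteq> 0 \<Longrightarrow> B (-1) ((0, z), v) = (base_B (-1) (0, z), m' * v)" using B_slope by blast
  have bs0: "base_B k (0, z) = (0, snd (base_B k (0, z)))" for k z
    using B_on_T(1)[OF T_all, of "(0, z)" k] by (simp add: T_def prod_eq_iff)
  have "B (- 1) (B 1 ((0, to_rz 0), 1)) = ((0, to_rz 0), 1)" using B_minus[of "((0, to_rz 0), 1)" 1] by simp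
  then have mm: "m' * m = 1" using m(2)[of 1 "to_rz 0"] m'(2)[of m] m(1) bs0[of 1 "to_rz 0"] by (metis mult.right_neutral snd_conv zero_neq_one)
  have mZ: "m \<in> \<int>" "m' \<in> \<int>" using base_B_global(2)[OF m, of "(0, to_rz 0)"] base_B_global(2)[OF m', of "(0, to_rz 0)"] by auto
  \<comment> \<open>The slope and that of the inverse are nonzero integers with product 1.\<close>
  have "\<bar>m\<bar> \<ge> 1" "\<bar>m'\<bar> \<ge> 1" using mZ m(1) m'(1) Ints_nonzero_abs_ge1 by auto
  moreover have "\<bar>m'\<bar> * \<bar>m\<bar> = 1" using mm by (metis abs_mult abs_one)
  ultimately have m1: "\<bar>m\<bar> = 1"
    using mult_mono[of 1 "\<bar>m'\<bar>" "\<bar>m\<bar>" "\<bar>m\<bar>"] by auto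
  obtain r where r: "snd (base_B 1 (0, to_rz 0)) = to_rz r" by (meson to_rz_cases)
  have base_B: "base_B 1 (0, to_rz a) = (0, to_rz (r + m * a))" for a
    using base_B_global(1)[OF m, of "(0, to_rz 0)" a] bs0[of 1 "to_rz 0"] r by (simp add: fl_def rotation_to_rz)
  \<comment> \<open>A map \<open>x \<mapsto> r - x\<close> is an involution, which is incompatible
    with infinite order. Rational \<open>r\<close> is excluded below for the same reason.\<close>
  have "m \<noteq> -1"
  proof
    assume neg: "m = -1"
    have "B 2 p = p" if p: "p \<in> germs 1" for p
    proof -
      obtain z v where p': "p = ((0, z), v)" "v \<noteq> 0" using p by (cases p) (auto simp: germs_def)
      obtain a where a: "z = to_rz a" by (meson to_rz_cases)
      have "B 2 p = B 1 (B 1 p)" using B_add[OF p, of 1 1] by simp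
      also have "\<dots> = p" using m(2) base_B p'(2) by (simp add: p'(1) a neg)
      finally show ?thesis .
    qed
    then show False using B_infinite[of 2] by auto
  qed
  then have m1: "m = 1" using m1 by auto
  have rot: "snd (base_B 1 (0, z)) = rotation r z" for z
    by (rule to_rz_cases[of z]) (simp add: base_B m1 rotation_to_rz add.commute)
  have Bk: "B (int k) ((0, z), v) = ((0, rotation (real k * r) z), v)" if v: "v \<noteq> 0" for k z v
  proof (induction k)
    case (Suc k)
    have "B (int (Suc k)) ((0, z), v) = B 1 (B (int k) ((0, z), v))"
      using B_add[of "((0, z), v)" 1 "int k"] v by simp
    also have "\<dots> = ((0, rotation (real (Suc k) * r) z), v)"
      unfolding Suc using m(2)[OF v] m1 bs0[of 1] rot by (simp add: algebra_simps)
    finally show ?case .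
  qed (use v in simp)
  have "r \<notin> \<rat>"
  proof
    assume "r \<in> \<rat>"
    then obtain a b where ab: "b > 0" "r = of_int a / of_int b" using Rats_cases' by metis
    have "real (nat b) * r = of_int a" using ab by simp
    then have "rotation (real (nat b) * r) z = z" for z using rotation_eq_iff[of "of_int a" z 0] by simp
    then have "B (int (nat b)) p = p" if pG: "p \<in> germs 1" for p
    proof -
      obtain z v where p: "p = ((0, z), v)" "v \<noteq> 0" using pG by (cases p) (auto simp: germs_def)
      show ?thesis unfolding p(1) Bk[OF p(2)] \<open>\<And>z. rotation (real (nat b) * r) z = z\<close> ..
    qed
    then show False using B_infinite[of "nat b"] ab(1) by auto
  qed
  then show ?thesis using rot by blast
qed

end

lemma conjugate_to_rotation:
  assumes h: "h \<in> pc_maps RZ RZ" and m: "circle_oriented (on_comps h) g l \<zeta> \<psi>"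
  shows "\<exists>\<phi> \<in> PC0_plus RZ. \<exists>r. r \<notin> \<rat> \<and>
    \<phi> \<otimes>\<^bsub>GR\<^esub> pc_class RZ RZ h \<otimes>\<^bsub>GR\<^esub> inv\<^bsub>GR\<^esub> \<phi> = pc_class RZ RZ (rotation r)"
proof -
  interpret circle_oriented "on_comps h" g l \<zeta> \<psi> by (rule m)
  note F = flowcurve_RZ
  note P = pw_iso_sym[OF \<zeta>\<psi>]
  have c\<psi>: "circle_part \<psi> \<in> pc_maps RZ RZ" and c\<zeta>: "circle_part \<zeta> \<in> pc_maps RZ RZ" using circle_part_pc[OF P] circle_part_pc[OF \<zeta>\<psi>] .
  have base_map: "base_map \<psi> \<in> pc_maps RZ RZ" by (rule pc_maps_cong[OF F F c\<psi>]) (use circle_part_base_map[OF pw_affine\<psi>] in simp)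
  \<comment> \<open>The class of the raw function contains the homeomorphism, which is what
    membership in \<open>PC0_plus\<close> asks for.\<close>
  have mem: "base_map \<psi> \<in> pc_class RZ RZ (circle_part \<psi>)" using c\<psi> base_map circle_part_base_map[OF pw_affine\<psi>] by (simp add: pc_rel_iff)
  have plus: "pc_class RZ RZ (circle_part \<psi>) \<in> PC0_plus RZ"
    unfolding PC0_plus_def using PC_iso_pc_class[OF c\<psi>] mem
      circle_map_homeo[OF circle_map_\<psi> circle_map_\<zeta> P] circle_map.base_map_orientation[OF circle_map_\<psi>] by blast
  obtain r where r: "r \<notin> \<rat>" "\<And>z. snd (base_B 1 (0, z)) = rotation r z" using base_B_rotation by blast
  have inv: "inv\<^bsub>GR\<^esub> (pc_class RZ RZ (circle_part \<psi>)) = pc_class RZ RZ (circle_part \<zeta>)"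
    by (rule PC_group_inv[OF F c\<psi> c\<zeta>]) (use circle_part_inverse[OF P] in simp)
  have p1: "circle_part \<psi> \<circ> h \<in> pc_maps RZ RZ" by (rule pc_maps_comp[OF F F F h c\<psi>])
  have p2: "circle_part \<psi> \<circ> h \<circ> circle_part \<zeta> \<in> pc_maps RZ RZ" by (rule pc_maps_comp[OF F F F c\<zeta> p1])
  have "finite {z. (circle_part \<psi> \<circ> h \<circ> circle_part \<zeta>) z \<noteq> rotation r z}"
  proof (rule rev_finite_subset[OF finite_Pair[OF Bf1_base_B]], rule subsetI, rule ccontr)
    fix z assume z: "z \<in> {z. (circle_part \<psi> \<circ> h \<circ> circle_part \<zeta>) z \<noteq> rotation r z}"
      "z \<notin> {z. (0, z) \<in> {x. fst x < 1 \<and> \<not> (fst (\<zeta> x) < 1 \<and> \<psi> (on_comps h (\<zeta> x)) = base_B 1 x)}}"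
    then have g: "fst (\<zeta> (0, z)) < 1" "\<psi> (on_comps h (\<zeta> (0, z))) = base_B 1 (0, z)" by auto
    have "(0, h (snd (\<zeta> (0, z)))) = on_comps h (\<zeta> (0, z))" using g(1) by (simp add: on_comps_def)
    then have "(circle_part \<psi> \<circ> h \<circ> circle_part \<zeta>) z = rotation r z" using g(2) r(2) by (simp add: circle_part_def)
    then show False using z(1) by blast
  qed
  then have fin: "finite {z \<in> TS RZ. (circle_part \<psi> \<circ> h \<circ> circle_part \<zeta>) z \<noteq> rotation r z}" by simp
  have "rotation r \<in> pc_maps RZ RZ" by (rule pc_maps_cong[OF F F p2 fin])
  then have "pc_class RZ RZ (circle_part \<psi> \<circ> h \<circ> circle_part \<zeta>) = pc_class RZ RZ (rotation r)" using pc_class_eq_iff[OF p2] fin by blast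
  moreover have "pc_class RZ RZ (circle_part \<psi>) \<otimes>\<^bsub>GR\<^esub> pc_class RZ RZ h \<otimes>\<^bsub>GR\<^esub> inv\<^bsub>GR\<^esub> (pc_class RZ RZ (circle_part \<psi>)) = pc_class RZ RZ (circle_part \<psi> \<circ> h \<circ> circle_part \<zeta>)"
    unfolding inv PC_group_simps pc_comp_pc_class[OF F F F h c\<psi>] pc_comp_pc_class[OF F F F c\<zeta> p1] ..
  ultimately show ?thesis using plus r(1) by metis
qed

text \<open>The base point of an image germ is the one-sided limit of \<open>h\<close>, which
  continuity identifies with the value.\<close>

lemma homeo_base:
  assumes h: "h \<in> pc_maps RZ RZ" "homeomorphic_map (curve_top RZ) (curve_top RZ) h" and p: "p \<in> germs 1"
  shows "fst (germ_map (on_comps h) p) = on_comps h (fst p)"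
proof -
  obtain i z v where p': "p = ((i, z), v)" by (metis surj_pair)
  have i: "i = 0" and v: "v \<noteq> 0" using p p' by auto
  obtain j y w where q: "germ_map (on_comps h) p = ((j, y), w)" by (metis surj_pair)
  have j: "j = 0" using pw_affine_germs[OF pc_maps_pw_affine[OF h(1)] p] q by simp
  obtain e where e: "e > 0" "\<And>t. 0 < t \<Longrightarrow> t < e \<Longrightarrow> h (rotation (v * t) z) = rotation (w * t) y"
  proof -
    have "germ_rel (on_comps h) p ((j, y), w)" using pw_affine_germ_rel[OF pc_maps_pw_affine[OF h(1)] p] q by simp
    then show thesis using that unfolding germ_rel_def ev_right p' by (auto simp: ev_def fl_def on_comps_def)
  qed
  have cont: "continuous_map (curve_top RZ) (curve_top RZ) h" using homeomorphic_imp_continuous_map[OF h(2)] .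
  have "y = h z"
  proof (rule rz_local_eq)
    fix \<epsilon> :: real assume \<epsilon>: "\<epsilon> > 0"
    obtain V where V: "openin (curve_top RZ) V" "h z \<in> V" "\<And>q. q \<in> V \<Longrightarrow> \<exists>t. \<bar>t\<bar> < \<epsilon> / 2 \<and> q = rotation t (h z)"
      using flowcurve_nbhd[OF flowcurve_RZ, of "h z" "\<epsilon> / 2"] \<epsilon> by auto
    have "openin (curve_top RZ) {x \<in> TS RZ. h x \<in> V}" using cont V(1) by (auto simp: continuous_map_def)
    then obtain d where d: "d > 0" "\<And>t. \<bar>t\<bar> < d \<Longrightarrow> h (rotation t z) \<in> V"
      using flowcurve_stay[OF flowcurve_RZ, of "{x \<in> TS RZ. h x \<in> V}" z] V(2) by auto
    \<comment> \<open>A time at which three things hold: the germ formula for \<open>h\<close>, the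
      continuity estimate at \<open>z\<close>, and a displacement of the image germ below
      \<open>\<epsilon> / 2\<close>.\<close>
    define t where "t = min (e / 2) (min (d / (2 * \<bar>v\<bar>)) (\<epsilon> / (4 * (\<bar>w\<bar> + 1))))"
    have t: "0 < t" "t < e" "\<bar>v * t\<bar> < d" "\<bar>w * t\<bar> < \<epsilon> / 2"
    proof -
      have w1: "\<bar>w\<bar> + 1 > 0" by (simp add: add_nonneg_pos)
      have "0 < \<epsilon> / (4 * (\<bar>w\<bar> + 1))" using \<epsilon> w1 by simp
      then show t0: "0 < t" using e d v by (auto simp: t_def)
      have "t \<le> e / 2" unfolding t_def by (rule min.cobounded1)
      then show "t < e" using e(1) by linarith
      have "t \<le> d / (2 * \<bar>v\<bar>)" unfolding t_def by (rule min.coboundedI2[OF min.cobounded1])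
      then have "t * (2 * \<bar>v\<bar>) \<le> d" using v by (subst pos_le_divide_eq[symmetric]) auto
      then show "\<bar>v * t\<bar> < d" using t0 d(1) by (simp add: abs_mult mult_ac)
      have "t \<le> \<epsilon> / (4 * (\<bar>w\<bar> + 1))" unfolding t_def by (rule min.coboundedI2[OF min.cobounded2])
      then have "t * (4 * (\<bar>w\<bar> + 1)) \<le> \<epsilon>" using w1 by (subst pos_le_divide_eq[symmetric]) auto
      then have "4 * (t * \<bar>w\<bar>) + 4 * t \<le> \<epsilon>" by (simp add: algebra_simps)
      then have "t * \<bar>w\<bar> < \<epsilon> / 2" using t0 mult_nonneg_nonneg[of t "\<bar>w\<bar>"] by linarith
      then show "\<bar>w * t\<bar> < \<epsilon> / 2" using t0 by (simp add: abs_mult mult.commute)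
    qed
    obtain s where s: "\<bar>s\<bar> < \<epsilon> / 2" "h (rotation (v * t) z) = rotation s (h z)" using V(3)[OF d(2)[OF t(3)]] by blast
    have "rotation (- (w * t)) (rotation (w * t) y) = rotation (- (w * t)) (rotation s (h z))" using e(2)[OF t(1,2)] s(2) by simp
    then have "y = rotation (s - w * t) (h z)" by simp
    moreover have "\<bar>s - w * t\<bar> < \<epsilon>" using s(1) t(4) by linarith
    ultimately show "\<exists>s. \<bar>s\<bar> < \<epsilon> \<and> y = rotation s (h z)" by blast
  qed
  then show ?thesis using q i j p' by (simp add: on_comps_def)
qed

text \<open>If a power fixed all germs, it would be the identity off finitely many points by
  compactness, hence trivial in the group.\<close>

lemma homeo_circle:
  assumes h: "h \<in> pc_maps RZ RZ" "homeomorphic_map (curve_top RZ) (curve_top RZ) h" and sub: "sublinear (on_comps h) g l"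
    and inf: "\<And>n::nat. n > 0 \<Longrightarrow> pc_class RZ RZ h [^]\<^bsub>GR\<^esub> n \<noteq> \<one>\<^bsub>GR\<^esub>"
  shows "circle_homeo (on_comps h) g l"
proof -
  interpret sublinear "on_comps h" g l by (rule sub)
  show ?thesis
  proof
    show "fst (germ_map (on_comps h) p) = on_comps h (fst p)" if "p \<in> germs 1" for p by (rule homeo_base[OF h that])
    have "inj h" using homeomorphic_imp_injective_map[OF h(2)] by simp
    then show "inj_on (on_comps h) {x. fst x < 1}" by (auto simp: inj_on_def on_comps_def prod_eq_iff)
    fix k :: nat assume k: "k > 0"
    show "\<exists>p\<in>germs 1. A (int k) p \<noteq> p"
    proof (rule ccontr)
      assume no: "\<not> ?thesis"
      have hk: "h ^^ k \<in> pc_maps RZ RZ" "pc_class RZ RZ h [^]\<^bsub>GR\<^esub> k = pc_class RZ RZ (h ^^ k)"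
        using PC_group_pow[OF flowcurve_RZ h(1)] by auto
      have germ_map: "germ_rel (on_comps (h ^^ k)) p p" if "p \<in> germs 1" for p
      proof -
        have "germ_map (on_comps (h ^^ k)) p = p" using A_germ_map[OF that, of "int k"] no that by (simp add: f_pow_def on_comps_funpow)
        then show ?thesis using pw_affine_germ_rel[OF pc_maps_pw_affine[OF hk(1)] that] by simp
      qed
      have "finite {x. fst x < 1 \<and> \<not> on_comps (h ^^ k) x = x}"
      proof (rule finite_exceptions)
        fix x :: fp and v :: real assume "fst x < 1" "v = 1 \<or> v = -1"
        then have "(x, v) \<in> germs 1" by auto
        from germ_map[OF this] show "\<forall>\<^sub>F t in at_right 0. on_comps (h ^^ k) (fl (v * t) x) = fl (v * t) x"
          by (simp add: germ_rel_def ev_def)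
      qed
      from finite_Pair[OF this] have "finite {z \<in> TS RZ. (h ^^ k) z \<noteq> id z}" by (simp add: on_comps_def)
      then have "pc_class RZ RZ (h ^^ k) = pc_class RZ RZ id" using pc_class_eq_iff[OF hk(1) pc_maps_id[OF flowcurve_RZ]] by blast
      then show False using inf[OF k] hk(2) unfolding PC_group_simps by simp
    qed
  qed
qed

lemma sublinear_minimal:
  assumes "sublinear f g l" shows "\<exists>n \<zeta> \<psi>. minimal f g l n \<zeta> \<psi>"
proof -
  interpret sublinear f g l by (rule assms)
  obtain n \<zeta> \<psi> where "Good n \<zeta> \<psi>" "\<And>i j a b. i < n \<Longrightarrow> j < n \<Longrightarrow> a \<noteq> 0 \<Longrightarrow> b \<noteq> 0 \<Longrightarrow>
      H \<zeta> ((i, to_rz 0), a) ((j, to_rz 0), b) \<Longrightarrow> i = j \<and> a * b < 0"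
    using minimal_Good by blast
  then have "minimal f g l n \<zeta> \<psi>" by unfold_locales
  then show ?thesis by blast
qed

lemma distorted_minimal:
  assumes h: "h \<in> pc_maps RZ RZ" and dist: "distorted GR (pc_class RZ RZ h)"
  shows "\<exists>g l n \<zeta> \<psi>. minimal (on_comps h) g l n \<zeta> \<psi>"
proof -
  obtain k where k: "pw_iso 1 1 (on_comps h) (on_comps k)" using pc_maps_pw_iso_ex[OF h] by blast
  then obtain l where "sublinear (on_comps h) (on_comps k) l" using distorted_sublinear[OF h _ dist] by blast
  then show ?thesis using sublinear_minimal by blast
qed

theorem corollary1p5:
  fixes \<sigma> :: "(rz \<Rightarrow> rz) set"
  assumes "\<sigma> \<in> carrier (PC_group RZ)"
    and "distorted (PC_group RZ) \<sigma>"
  shows "(\<exists>X' \<in> standard_curves. \<exists>\<phi> \<in> PC_iso RZ X'.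
            pc_comp X' X' (pc_comp RZ X' \<phi> \<sigma>) (pc_inv RZ X' \<phi>) \<in> Aut_Aff X') \<and>
         (\<sigma> \<in> PC0 RZ \<and> (\<forall>n::nat. n > 0 \<longrightarrow> \<sigma> [^]\<^bsub>PC_group RZ\<^esub> n \<noteq> \<one>\<^bsub>PC_group RZ\<^esub>) \<longrightarrow>
            (\<exists>\<phi> \<in> PC0_plus RZ. \<exists>r. r \<notin> \<rat> \<and>
               \<phi> \<otimes>\<^bsub>PC_group RZ\<^esub> \<sigma> \<otimes>\<^bsub>PC_group RZ\<^esub> inv\<^bsub>PC_group RZ\<^esub> \<phi> = pc_rel RZ RZ `` {rotation r}))"
proof (intro conjI impI)
  obtain h where h: "h \<in> pc_maps RZ RZ" "\<sigma> = pc_class RZ RZ h" using assms(1) by (auto elim: PC_isoE)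
  obtain g l n \<zeta> \<psi> where m: "minimal (on_comps h) g l n \<zeta> \<psi>" using distorted_minimal h assms(2) by blast
  show "\<exists>X' \<in> standard_curves. \<exists>\<phi> \<in> PC_iso RZ X'.
      pc_comp X' X' (pc_comp RZ X' \<phi> \<sigma>) (pc_inv RZ X' \<phi>) \<in> Aut_Aff X'"
    unfolding h(2) by (rule affine_on_standard_curve[OF h(1) m])
  assume b: "\<sigma> \<in> PC0 RZ \<and> (\<forall>n::nat. n > 0 \<longrightarrow> \<sigma> [^]\<^bsub>PC_group RZ\<^esub> n \<noteq> \<one>\<^bsub>PC_group RZ\<^esub>)"
  \<comment> \<open>The representative is exchanged for a homeomorphism. Distortion concerns only
    the class, so the decomposition can be constructed anew for \<open>h'\<close>.\<close>
  then obtain h' where h': "h' \<in> \<sigma>" "homeomorphic_map (curve_top RZ) (curve_top RZ) h'" by (auto simp: PC0_def)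
  have hp: "h' \<in> pc_maps RZ RZ" "finite {x \<in> TS RZ. h x \<noteq> h' x}" using h'(1) unfolding h(2) by (auto simp: pc_rel_iff)
  have \<sigma>: "\<sigma> = pc_class RZ RZ h'" unfolding h(2) using pc_class_eq_iff[OF h(1) hp(1)] hp(2) by blast
  obtain g l n \<zeta> \<psi> where m: "minimal (on_comps h') g l n \<zeta> \<psi>" using distorted_minimal hp(1) assms(2) \<sigma> by blast
  have c: "circle_homeo (on_comps h') g l"
    by (rule homeo_circle[OF hp(1) h'(2)]) (use m minimal.axioms(1) b \<sigma> in blast)+
  then have "circle_minimal (on_comps h') g l n \<zeta> \<psi>" using m by (simp add: circle_minimal_def)
  from circle_minimal.oriented_exists[OF this] obtain \<zeta>' \<psi>'
    where o: "minimal (on_comps h') g l 1 \<zeta>' \<psi>'" "\<forall>r\<in>germs 1. snd (germ_map \<psi>' r) * snd r > 0" by blast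
  then have "circle_oriented (on_comps h') g l \<zeta>' \<psi>'"
    using c by (simp add: circle_oriented_def circle_oriented_axioms_def circle_minimal_def)
  from conjugate_to_rotation[OF hp(1) this]
  show "\<exists>\<phi> \<in> PC0_plus RZ. \<exists>r. r \<notin> \<rat> \<and>
      \<phi> \<otimes>\<^bsub>PC_group RZ\<^esub> \<sigma> \<otimes>\<^bsub>PC_group RZ\<^esub> inv\<^bsub>PC_group RZ\<^esub> \<phi> = pc_rel RZ RZ `` {rotation r}"
    unfolding \<sigma> .
qed

end
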